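(* Let $\varepsilon>0$, $r,s\ge1$, and let $f(X_1,\ldots,X_r,T_1,\ldots,T_s)\in\mathbb{Z}[X_1,\ldots,X_r,T_1,\ldots,T_s]$ be irreducible. Suppose that for some $i\in\{1,\ldots,r\}$ the monomial of highest degree in $X_i$ is of the form $X_i^n h$, where $n\ge1$ and $h$ depends at most on $T_1,\ldots,T_s$ and not on $X_j$ for $j\ne i$ (i.e. as a polynomial in $X_i$, $f$ has degree $n$ and leading coefficient $h\in\mathbb{Z}[T_1,\ldots,T_s]$). Let $G$ be the Galois group of the splitting field of $f(X_i)$, considered as a polynomial in $X_i$ over the function field $\mathbb{Q}(X_1,\ldots,X_{i-1},X_{i+1},\ldots,X_r,T_1,\ldots,T_s)$, viewed as a permutation group on the $n$ roots, and let $$\gamma_G=\max\{|G/K|^{-1}: K\text{ is an intransitive subgroup of }G\}.$$ For $H\ge1$ let $$J_f(H)=\#\{\mathbf{t}\in\mathbb{Z}^s:|\mathbf{t}|\le H \text{ and } f(X_1,\ldots,X_r,\mathbf{t}) \text{ is reducible in } \mathbb{Q}[X_1,\ldots,X_r]\}.$$ Then $J_f(H)\ll_{f,\varepsilon}H^{\,s-\gamma_G+\varepsilon}$.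
   Context: $|\mathbf{t}|$ is the maximum norm; $|G/K|$ is the index of $K$ in $G$; a subgroup is intransitive if it does not act transitively on the $n$ roots. Irreducibility of $f$ is over $\mathbb{Q}$. The implied constant depends only on $f$ and $\varepsilon$. *)

theory Defs
  imports
    Complex_Main
    "HOL-Library.Cardinality"
    "HOL-Library.Poly_Mapping"
    "HOL-Computational_Algebra.Computational_Algebra"
    "HOL-Algebra.Group_Action"
    "HOL-Algebra.Generated_Fields"
    "HOL-Algebra.Algebraic_Closure_Type"
begin

text \<open>
  The variables \<open>X\<^sub>1, \<dots>, X\<^sub>r\<close> and \<open>T\<^sub>1, \<dots>, T\<^sub>s\<close> are indexed by nonempty finite types \<open>'r\<close> and \<open>'s\<close>,
  so that \<open>r = CARD('r)\<close> and \<open>s = CARD('s)\<close>. The linear order on the variables has no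
  mathematical role: the library proves that a polynomial ring is an integral domain only for
  ordered sets of variables.
\<close>

datatype ('r, 's) var = XVar 'r | TVar 's

instantiation var :: (linorder, linorder) linorder
begin

fun less_eq_var :: "('a, 'b) var \<Rightarrow> ('a, 'b) var \<Rightarrow> bool" where
  "less_eq_var (XVar a) (XVar b) \<longleftrightarrow> a \<le> b"
| "less_eq_var (XVar a) (TVar b) \<longleftrightarrow> True"
| "less_eq_var (TVar a) (XVar b) \<longleftrightarrow> False"
| "less_eq_var (TVar a) (TVar b) \<longleftrightarrow> a \<le> b"

definition less_var :: "('a, 'b) var \<Rightarrow> ('a, 'b) var \<Rightarrow> bool" where
  "less_var x y \<longleftrightarrow> x \<le> y \<and> \<not> y \<le> x"

instance
proof
  fix x y z :: "('a, 'b) var"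
  show "x < y \<longleftrightarrow> x \<le> y \<and> \<not> y \<le> x" by (rule less_var_def)
  show "x \<le> x" by (cases x) auto
  show "x \<le> y \<Longrightarrow> y \<le> z \<Longrightarrow> x \<le> z" by (cases x; cases y; cases z) auto
  show "x \<le> y \<Longrightarrow> y \<le> x \<Longrightarrow> x = y" by (cases x; cases y) auto
  show "x \<le> y \<or> y \<le> x" by (cases x; cases y) auto
qed

end

type_synonym ('v, 'a) mpoly = "('v \<Rightarrow>\<^sub>0 nat) \<Rightarrow>\<^sub>0 'a"

definition mvar :: "'v \<Rightarrow> ('v, 'a::comm_ring_1) mpoly" where
  "mvar v = Poly_Mapping.single (Poly_Mapping.single v 1) 1"

definition mvars :: "('v, 'a::zero) mpoly \<Rightarrow> 'v set" where
  "mvars p = (\<Union>m\<in>Poly_Mapping.keys p. Poly_Mapping.keys m)"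

text \<open>The value of an integer polynomial at a point of an arbitrary commutative ring.\<close>

definition mpoly_eval :: "('v \<Rightarrow> 'b::comm_ring_1) \<Rightarrow> ('v, int) mpoly \<Rightarrow> 'b" where
  "mpoly_eval x p =
     (\<Sum>m\<in>Poly_Mapping.keys p. of_int (Poly_Mapping.lookup p m) *
        (\<Prod>v\<in>Poly_Mapping.keys m. x v ^ Poly_Mapping.lookup m v))"

definition rat_mpoly :: "('v, int) mpoly \<Rightarrow> ('v, rat) mpoly" where
  "rat_mpoly p = mpoly_eval mvar p"

definition specialize :: "(('r, 's) var, int) mpoly \<Rightarrow> ('s \<Rightarrow> int) \<Rightarrow> ('r, rat) mpoly" where
  "specialize f t = mpoly_eval (case_var mvar (\<lambda>j. of_int (t j))) f"

definition poly_in :: "'v \<Rightarrow> ('v, int) mpoly \<Rightarrow> ('v, int) mpoly poly" where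
  "poly_in v f = mpoly_eval (\<lambda>w. if w = v then [:0, 1:] else [:mvar w:]) f"

text \<open>
  The zero polynomial is reducible in this sense, a nonzero constant over a field is neither
  reducible nor irreducible.
\<close>

definition reducible :: "'a::comm_semiring_1 \<Rightarrow> bool" where
  "reducible p \<longleftrightarrow> (\<exists>a b. p = a * b \<and> \<not> a dvd 1 \<and> \<not> b dvd 1)"

text \<open>
  We work inside an algebraic closure of \<open>\<rat>(V)\<close>, where \<open>V\<close> is the set of all variables. The
  function field in the variables other than \<open>v\<close> is a subfield of \<open>\<rat>(V)\<close>, and the splitting
  field over it is generated by it and the roots.
\<close>

type_synonym 'v closure = "('v, rat) mpoly fract alg_closure"

definition function_field :: "'v::linorder \<Rightarrow> 'v closure set" where
  "function_field v = {to_ac (Fraction_Field.Fract p q) | p q. q \<noteq> 0 \<and> v \<notin> mvars p \<and> v \<notin> mvars q}"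

definition root_set :: "'v::linorder \<Rightarrow> ('v, int) mpoly \<Rightarrow> 'v closure set" where
  "root_set v f =
     {x. poly (map_poly (\<lambda>c. to_ac (Fraction_Field.Fract (rat_mpoly c) 1)) (poly_in v f)) x = 0}"

definition splitting_field :: "'v::linorder \<Rightarrow> ('v, int) mpoly \<Rightarrow> 'v closure ring" where
  "splitting_field v f =
     ring_of_type_algebra
       \<lparr>carrier := generate_field ring_of_type_algebra (function_field v \<union> root_set v f)\<rparr>"

definition galois_automorphisms ::
    "'v::linorder \<Rightarrow> ('v, int) mpoly \<Rightarrow> ('v closure \<Rightarrow> 'v closure) set" where
  "galois_automorphisms v f =
     {\<sigma> \<in> ring_hom (splitting_field v f) (splitting_field v f) \<inter> Bij (carrier (splitting_field v f)).
        \<forall>x\<in>function_field v. \<sigma> x = x}"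

text \<open>The Galois group as a permutation group on the roots.\<close>

definition galois_group ::
    "'v::linorder \<Rightarrow> ('v, int) mpoly \<Rightarrow> ('v closure \<Rightarrow> 'v closure) monoid" where
  "galois_group v f =
     BijGroup (root_set v f)
       \<lparr>carrier := (\<lambda>\<sigma>. restrict \<sigma> (root_set v f)) ` galois_automorphisms v f\<rparr>"

definition intransitive_subgroup ::
    "'v::linorder \<Rightarrow> ('v, int) mpoly \<Rightarrow> ('v closure \<Rightarrow> 'v closure) set \<Rightarrow> bool" where
  "intransitive_subgroup v f K \<longleftrightarrow>
     subgroup K (galois_group v f) \<and>
     \<not> transitive_action (galois_group v f \<lparr>carrier := K\<rparr>) (root_set v f) (\<lambda>\<sigma>. \<sigma>)"

text \<open>
  All the values \<open>|G/K|\<^sup>-\<^sup>1\<close> are positive, so inserting 0 only fixes the maximum of the empty set,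
  which occurs precisely for a single root.
\<close>

definition gamma :: "'v::linorder \<Rightarrow> ('v, int) mpoly \<Rightarrow> real" where
  "gamma v f =
     Max (insert 0 {inverse (real (card (rcosets\<^bsub>galois_group v f\<^esub> K))) | K.
                      intransitive_subgroup v f K})"

definition J :: "(('r, 's::finite) var, int) mpoly \<Rightarrow> real \<Rightarrow> nat" where
  "J f H = card {t :: 's \<Rightarrow> int. real_of_int (MAX j. \<bar>t j\<bar>) \<le> H \<and> reducible (specialize f t)}"

end

theory Submission
  imports Defs "Jordan_Normal_Form.Char_Poly" "HOL-Real_Asymp.Real_Asymp" "HOL-Library.Nat_Bijection"
begin

text \<open>
  Since \<open>f\<close> is irreducible, \<open>G\<close> is transitive on the roots, so an intransitive subgroup has index at
  least 2. Hence \<open>\<gamma>\<^sub>G \<le> 1/2\<close>, and it suffices to bound \<open>J\<^sub>f(H)\<close> by \<open>H\<^bsup>s - 1/2 + \<epsilon>\<^esup>\<close>.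

  Give integer values to the \<open>X\<^sub>j\<close> with \<open>j \<noteq> i\<close> as well, and let \<open>u\<close> be the resulting point. As the
  leading coefficient \<open>h\<close> involves only the \<open>T\<^sub>j\<close>, a factorization of \<open>f(X, t)\<close> with \<open>h(t) \<noteq> 0\<close>
  restricts to a proper factorization over \<open>\<rat>\<close> of the polynomial \<open>f(X\<^sub>i, u)\<close>, for all values of
  the \<open>X\<^sub>j\<close>. The coefficients of a factor, scaled by powers of \<open>h(u)\<close>, are integers that are
  roots of fixed monic polynomials over \<open>\<int>[u]\<close>. Outside a set of \<open>O(N\<^bsup>k - 1/2 + \<epsilon>\<^esup>)\<close> of the points of
  height at most \<open>N\<close> in dimension \<open>k\<close>, such a root is \<open>r(u) / q\<close>, where \<open>r\<close> is one of finitely many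
  polynomials and \<open>q\<close> is a fixed integer. Then the factor is the specialization of one of finitely many polynomials
  \<open>D\<close> over \<open>\<int>[u]\<close>. The remainder in the pseudo-division of \<open>f\<close> by \<open>D\<close> is not the zero
  polynomial, because \<open>f\<close> is irreducible, but it vanishes at \<open>u\<close>.

  The bound for integer roots reduces to plane curves \<open>\<Phi>(z, t) = 0\<close>, monic in \<open>z\<close>. Take primes of size
  \<open>N\<^bsup>1/2 + \<epsilon>\<^esup>\<close>. By Hensel's lemma and the pigeonhole principle, the points in one residue class lie on a
  curve \<open>A(t) + z B(t) = 0\<close> with \<open>A\<close>, \<open>B\<close> of bounded degree, so unless \<open>z\<close> is a polynomial in \<open>t\<close>
  there are boundedly many of them.
\<close>


section \<open>Primes in short multiplicative intervals\<close>

text \<open>The size of the primes comes from a count of conditions. To precision 2M the coefficient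
  of (t - t0)^k matters only modulo p^(2M-k), which makes p^(M(2M+1)) residue vectors. With Z a
  bound for z, the coefficients of A and B small enough to force A(t) + z B(t) = 0 fill a box of
  volume about (p^(4M) / (Z N^(M-1)))^M. The box wins once p^(2M-1) exceeds a constant times Z
  N^(M-1), and for large M this tends to p > N^(1/2), whatever fixed power of N bounds Z. The O(p)
  residue classes then give the exponent 1/2 + \<epsilon>. That Z may be any power of N is
  essential: higher dimensions are treated along lines, and the curves over these lines vary and
  have coefficients growing with N, so the count on a curve must be uniform in them. The prime must
  suit the point, since p may divide the derivative there; boundedly many primes suffice because
  their product outgrows that derivative. Giving values to the other X_j costs nothing: each bad t
  carries about N^(r-1) bad points u, which cancels the added dimension.\<close>

lemma leibniz_triangle_dvd_Lcm:
  assumes "k \<le> n"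
  shows "Suc n * (n choose k) dvd Lcm {1..Suc n}"
  using assms
proof (induction k arbitrary: n)
  case 0
  then show ?case by (auto intro: dvd_Lcm)
next
  case (Suc k)
  then obtain m where n: "n = Suc m" and km: "k \<le> m" by (cases n) auto
  let ?L = "Lcm {1..Suc n}"
  have "Suc m * (m choose k) dvd Lcm {1..Suc m}" using Suc.IH km by blast
  also have "Lcm {1..Suc m} dvd ?L" unfolding n by (rule Lcm_subset) auto
  finally obtain a' where a': "?L = Suc m * (m choose k) * a'" by blast
  have "Suc n * (n choose k) dvd ?L" using Suc.IH[of n] Suc.prems by simp
  then obtain b' where b': "?L = Suc n * (n choose k) * b'" by blast
  have e1: "int (Suc k) * int (n choose Suc k) = int (Suc m) * int (m choose k)"
    unfolding n of_nat_mult[symmetric] by (subst Suc_times_binomial_eq) (simp only: mult.commute)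
  have "(Suc m - k) * (Suc m choose k) = Suc m * (m choose k)"
    using km binomial_absorb_comp[of "Suc m" k] by simp
  then have e2: "(int n - int k) * int (n choose k) = int n * int (m choose k)"
    unfolding n using km by (metis Suc_leD le_SucI of_nat_diff of_nat_mult)
  \<comment> \<open>In the Leibniz harmonic triangle 1/c = 1/a - 1/b. Hence l/c = l/a - l/b is an
    integer as soon as a and b divide l.\<close>
  define l a b c where "l = int ?L" and "a = int (Suc m * (m choose k))"
    and "b = int (Suc n * (n choose k))" and "c = int (Suc n * (n choose Suc k))"
  have la: "l = a * int a'" and lb: "l = b * int b'"
    unfolding l_def a_def b_def using a' b' by (metis of_nat_mult)+
  have ab: "b - a = int (Suc k) * int (n choose k)"
    using e2 unfolding a_def b_def n by (simp add: algebra_simps)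
  have "c * (b - a) = int (Suc n) * (int (Suc k) * int (n choose Suc k)) * int (n choose k)"
    unfolding ab c_def by (simp only: mult_ac of_nat_mult)
  also have "\<dots> = a * b" unfolding e1 a_def b_def by (simp add: algebra_simps)
  finally have cab: "c * (b - a) = a * b" .
  have ne: "a \<noteq> 0" "b \<noteq> 0" unfolding a_def b_def of_nat_eq_0_iff using km Suc.prems by (auto simp del: mult_Suc)
  have "(a * b) * (c * (int a' - int b')) = c * (b * (a * int a') - a * (b * int b'))"
    by (simp add: algebra_simps)
  also have "\<dots> = c * (b - a) * l" using la lb by (metis left_diff_distrib mult.assoc)
  also have "\<dots> = (a * b) * l" using cab by simp
  finally have "l = c * (int a' - int b')" using ne by simp
  then have "c dvd l" by simp
  then show ?case unfolding c_def l_def by (simp only: of_nat_dvd_iff)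
qed

text \<open>The n + 1 divisors \<open>Suc n * (n choose k)\<close> of the lcm add up to
  \<open>Suc n * 2 ^ n\<close>, and the lcm is at least their mean.\<close>

lemma two_power_le_Lcm: "2 ^ n \<le> Lcm {1..Suc n}"
proof -
  have pos: "Lcm {1..Suc n} > 0" by (metis Lcm_0_iff_nat atLeastAtMost_iff finite_atLeastAtMost not_gr_zero not_one_le_zero)
  have "Suc n * 2 ^ n = (\<Sum>k\<le>n. Suc n * (n choose k))"
    by (simp only: choose_row_sum sum_distrib_left[symmetric])
  also have "\<dots> \<le> (\<Sum>k\<le>n. Lcm {1..Suc n})"
    by (intro sum_mono dvd_imp_le[OF leibniz_triangle_dvd_Lcm] pos) auto
  also have "\<dots> = Suc n * Lcm {1..Suc n}" by simp
  finally show ?thesis by (simp only: Suc_mult_le_cancel1)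
qed

text \<open>The exponent of p in an lcm is the largest exponent among its arguments, so p^e already
  divides one of the numbers up to n.\<close>

lemma prime_power_dvd_Lcm_le:
  fixes p n e :: nat
  assumes "prime p" "p ^ e dvd Lcm {1..n}" "e > 0"
  shows "p ^ e \<le> n"
  using assms(2)
proof (induction n)
  case 0
  then have "p ^ e = 1" by simp
  then show ?case using assms by (simp add: prime_gt_1_nat power_eq_1_iff)
next
  case (Suc n)
  have "Lcm {1..Suc n} = lcm (Suc n) (Lcm {1..n})"
    by (simp add: atLeastAtMostSuc_conv)
  then have d: "p ^ e dvd lcm (Suc n) (Lcm {1..n})" using Suc.prems by simp
  have nz: "Lcm {1..n} \<noteq> 0" by (simp add: Lcm_0_iff_nat)
  have "e \<le> multiplicity p (lcm (Suc n) (Lcm {1..n}))"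
    using d assms(1) nz by (intro multiplicity_geI) (auto simp: lcm_eq_0_iff)
  also have "\<dots> = max (multiplicity p (Suc n)) (multiplicity p (Lcm {1..n}))"
    using assms(1) nz by (subst multiplicity_lcm) auto
  finally consider "e \<le> multiplicity p (Suc n)" | "e \<le> multiplicity p (Lcm {1..n})"
    by (auto simp: le_max_iff_disj)
  then show ?case
  proof cases
    case 1
    then have "p ^ e dvd Suc n" by (rule multiplicity_dvd')
    then show ?thesis by (rule dvd_imp_le) simp
  next
    case 2
    then have "p ^ e dvd Lcm {1..n}" by (rule multiplicity_dvd')
    then show ?thesis using Suc.IH by simp
  qed
qed

text \<open>Every prime power composing the lcm is at most n. Together with the lower bound 2^(n-1)
  this is Chebyshev's estimate: there are at least (n-1) log 2 / log n primes up to n.\<close>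

lemma Lcm_le_power_card_primes:
  fixes n :: nat
  shows "Lcm {1..n} \<le> n ^ card {p. prime p \<and> p \<le> n}"
proof -
  let ?L = "Lcm {1..n}"
  have nz: "?L > 0" by (simp add: Lcm_0_iff_nat flip: neq0_conv)
  have m: "multiplicity p ?L > 0" if "p \<in> prime_factors ?L" for p
    using that by (simp add: prime_factors_multiplicity)
  have le: "p ^ multiplicity p ?L \<le> n" if "p \<in> prime_factors ?L" for p
    using that m[OF that] by (intro prime_power_dvd_Lcm_le multiplicity_dvd) auto
  have sub: "prime_factors ?L \<subseteq> {p. prime p \<and> p \<le> n}"
  proof
    fix p assume p: "p \<in> prime_factors ?L"
    then have "p ^ 1 \<le> p ^ multiplicity p ?L"
      using m[OF p] by (intro power_increasing) (auto simp: in_prime_factors_iff dest!: prime_gt_0_nat)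
    then show "p \<in> {p. prime p \<and> p \<le> n}" using le[OF p] p by (auto simp: in_prime_factors_iff)
  qed
  show ?thesis
  proof (cases "n = 0")
    case False
    have "?L = (\<Prod>p\<in>prime_factors ?L. p ^ multiplicity p ?L)"
      by (rule prime_factorization_nat[OF nz])
    also have "\<dots> \<le> (\<Prod>p\<in>prime_factors ?L. n)" by (intro prod_mono conjI le) auto
    also have "\<dots> = n ^ card (prime_factors ?L)" by simp
    also have "\<dots> \<le> n ^ card {p. prime p \<and> p \<le> n}"
      using False by (intro power_increasing card_mono sub) auto
    finally show ?thesis .
  next
    case True
    then have e: "{p. prime p \<and> p \<le> n} = {}" by (auto dest: prime_gt_0_nat)
    show ?thesis unfolding e using True by simp
  qed
qed

text \<open>Chebyshev's lower bound at x^(1+\<delta>) exceeds x + k for large x, while at most x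
  primes lie below x. Allowing x^(1+\<delta>) instead of a multiple of x will only cost an
  \<epsilon> in the exponent.\<close>

lemma exists_primes_between_powr:
  fixes \<delta> :: real and k :: nat
  assumes "\<delta> > 0"
  shows "\<exists>x0. \<forall>x\<ge>x0. \<exists>S. finite S \<and> card S = k \<and>
           (\<forall>p\<in>S. prime (p::nat) \<and> x < real p \<and> real p \<le> x powr (1 + \<delta>))"
proof -
  \<comment> \<open>With n the integer part of x^(1+\<delta>), the left side bounds log 2^(n-1) from
    below and the right side bounds log n^(x+k) from above; the 2 absorbs the rounding and the shift
    of the exponent.\<close>
  have "eventually (\<lambda>x::real. (x powr (1+\<delta>) - 2) * ln 2 > (x + real k) * ((1+\<delta>) * ln x)) at_top"
    using assms by real_asymp
  moreover have "eventually (\<lambda>x::real. x \<ge> 3) at_top" by real_asymp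
  ultimately have "eventually (\<lambda>x::real. (x powr (1+\<delta>) - 2) * ln 2 > (x + real k) * ((1+\<delta>) * ln x) \<and> x \<ge> 3) at_top"
    by eventually_elim auto
  then obtain x0 where x0: "\<And>x. x \<ge> x0 \<Longrightarrow> (x powr (1+\<delta>) - 2) * ln 2 > (x + real k) * ((1+\<delta>) * ln x) \<and> x \<ge> 3"
    by (auto simp: eventually_at_top_linorder)
  show ?thesis
  proof (rule exI[of _ x0], intro allI impI)
    fix x :: real assume "x \<ge> x0"
    note x = x0[OF this]
    define n where "n = nat \<lfloor>x powr (1 + \<delta>)\<rfloor>"
    have "x powr 1 \<le> x powr (1 + \<delta>)" using x assms by (intro powr_mono) auto
    then have y: "x powr (1 + \<delta>) \<ge> 3" using x by auto
    have n1: "real n \<le> x powr (1 + \<delta>)" "real n > x powr (1 + \<delta>) - 1" "n \<ge> 3"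
      unfolding n_def using y by (auto simp: le_nat_iff le_floor_iff)
    let ?T = "{p. prime p \<and> x < real p \<and> p \<le> n}"
    have fT: "finite ?T" by (rule finite_subset[of _ "{..n}"]) auto
    have "card ?T \<ge> k"
    proof (rule ccontr)
      assume "\<not> card ?T \<ge> k"
      have "{p. prime p \<and> p \<le> n} \<subseteq> {1..nat \<lfloor>x\<rfloor>} \<union> ?T"
        using x by (auto simp: le_nat_iff le_floor_iff dest: prime_gt_0_nat)
      then have "card {p. prime p \<and> p \<le> n} \<le> card ({1..nat \<lfloor>x\<rfloor>} \<union> ?T)"
        using fT by (intro card_mono) auto
      also have "\<dots> \<le> nat \<lfloor>x\<rfloor> + card ?T" using card_Un_le[of "{1..nat \<lfloor>x\<rfloor>}" ?T] by simp
      finally have c: "card {p. prime p \<and> p \<le> n} \<le> nat \<lfloor>x\<rfloor> + card ?T" .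
      have "real (nat \<lfloor>x\<rfloor>) \<le> x" using x by simp
      with c \<open>\<not> card ?T \<ge> k\<close> have c': "real (card {p. prime p \<and> p \<le> n}) \<le> x + real k" by linarith
      have "2 ^ (n - 1) \<le> n ^ card {p. prime p \<and> p \<le> n}"
        using two_power_le_Lcm[of "n - 1"] Lcm_le_power_card_primes[of n] n1 by simp
      then have "real (2 ^ (n - 1)) \<le> real (n ^ card {p. prime p \<and> p \<le> n})" by (simp only: of_nat_le_iff)
      then have "ln (2 ^ (n - 1)) \<le> ln (real n ^ card {p. prime p \<and> p \<le> n})"
        using n1 by (subst ln_le_cancel_iff) auto
      then have "real (n - 1) * ln 2 \<le> real (card {p. prime p \<and> p \<le> n}) * ln (real n)"
        using n1 by (simp add: ln_realpow)
      also have "\<dots> \<le> (x + real k) * ln (real n)" using c' n1 by (intro mult_right_mono) auto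
      also have "\<dots> \<le> (x + real k) * ln (x powr (1 + \<delta>))"
        using n1 x by (intro mult_left_mono) (auto simp del: ln_powr)
      also have "\<dots> = (x + real k) * ((1 + \<delta>) * ln x)" using x by (simp add: ln_powr)
      also have "\<dots> < (x powr (1+\<delta>) - 2) * ln 2" using x by auto
      also have "\<dots> \<le> real (n - 1) * ln 2" using n1 by (intro mult_right_mono) auto
      finally show False by simp
    qed
    then obtain S where "S \<subseteq> ?T" "card S = k" "finite S"
      by (rule obtain_subset_with_card_n)
    then show "\<exists>S. finite S \<and> card S = k \<and>
           (\<forall>p\<in>S. prime (p::nat) \<and> x < real p \<and> real p \<le> x powr (1 + \<delta>))"
      using n1 by (intro exI[of _ S]) force
  qed
qed

section \<open>Plane curves over the integers\<close>

text \<open>A curve is stored as a polynomial in z whose coefficients are polynomials in t. A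
  polynomial \<rho> with \<open>poly \<Phi> \<rho> = 0\<close> is then a component z = \<rho>(t) of
  the curve.\<close>

abbreviation evT :: "int \<Rightarrow> int poly poly \<Rightarrow> int poly" where
  "evT t \<Phi> \<equiv> map_poly (\<lambda>c. poly c t) \<Phi>"

lemma poly_evT: "poly (evT t \<Phi>) (poly \<rho> t) = poly (poly \<Phi> \<rho>) t"
  by (induction \<Phi>) (simp_all add: map_poly_pCons)

lemma pderiv_evT: "pderiv (evT t \<Phi>) = evT t (pderiv \<Phi>)"
  by (rule poly_eqI) (simp add: coeff_pderiv)

lemma higher_pderiv_evT: "(pderiv ^^ m) (evT t \<Phi>) = evT t ((pderiv ^^ m) \<Phi>)"
  by (induction m) (simp_all add: pderiv_evT)

section \<open>Hensel's lemma on a residue class\<close>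

lemma diff_dvd_poly_diff:
  fixes x y :: "'a::comm_ring_1"
  shows "x - y dvd poly q x - poly q y"
proof (induction q)
  case (pCons c q)
  have "poly (pCons c q) x - poly (pCons c q) y = (x - y) * poly q x + y * (poly q x - poly q y)"
    by (simp add: algebra_simps)
  then show ?case using pCons.IH by simp
qed simp

text \<open>First-order Taylor expansion over the integers: the difference quotient is an integer
  polynomial in z and y, and at z = y = a it equals the derivative.\<close>

lemma poly_diff_factor:
  fixes q :: "int poly" and p :: int
  assumes "p dvd z - a" "p dvd y - a"
  shows "\<exists>D. poly q z - poly q y = (z - y) * D \<and> p dvd D - poly (pderiv q) a"
proof (induction q)
  case 0
  then show ?case by auto
next
  case (pCons c q)
  then obtain D where D: "poly q z - poly q y = (z - y) * D" "p dvd D - poly (pderiv q) a" by blast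
  obtain k where k: "z = a + p * k" using assms(1) by (metis add.commute diff_add_cancel dvd_def)
  obtain l where l: "y = a + p * l" using assms(2) by (metis add.commute diff_add_cancel dvd_def)
  obtain m where m: "D = poly (pderiv q) a + p * m" using D(2) by (metis add.commute diff_add_cancel dvd_def)
  have "p dvd (z - a)" by (rule assms)
  also have "z - a dvd poly q z - poly q a" by (rule diff_dvd_poly_diff)
  finally obtain r where r: "poly q z = poly q a + p * r" by (metis add.commute diff_add_cancel dvd_def)
  show ?case
  proof (intro exI conjI)
    show "poly (pCons c q) z - poly (pCons c q) y = (z - y) * (poly q z + y * D)"
    proof -
      have "poly (pCons c q) z - poly (pCons c q) y = (z - y) * poly q z + y * (poly q z - poly q y)"
        by (simp add: algebra_simps)
      then show ?thesis unfolding D(1) by (simp add: algebra_simps)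
    qed
    have "poly q z + y * D - poly (pderiv (pCons c q)) a
        = p * (r + l * poly (pderiv q) a + y * m)"
      by (simp add: pderiv_pCons r l m algebra_simps)
    then show "p dvd poly q z + y * D - poly (pderiv (pCons c q)) a" by simp
  qed
qed

text \<open>Newton's iteration, with a fixed inverse c of the derivative modulo p at the centre of
  the class. An iteration gains one factor p and is a polynomial operation in t, so a single g
  serves all points of the class. The degree of g grows without control, but as p divides t - t0
  only its low coefficients count at a given precision.\<close>

lemma hensel_poly:
  fixes \<Psi> :: "int poly poly" and p t0 z0 :: int
  assumes p: "prime p" and nd: "\<not> p dvd poly (evT t0 (pderiv \<Psi>)) z0" and "N \<ge> 1"
  shows "\<exists>g. \<forall>t z. p dvd t - t0 \<longrightarrow> p dvd z - z0 \<longrightarrow> poly (evT t \<Psi>) z = 0 \<longrightarrow>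
           p ^ N dvd z - poly g (t - t0)"
  using \<open>N \<ge> 1\<close>
proof (induction N rule: nat_induct_at_least)
  case base
  show ?case by (intro exI[of _ "[:z0:]"]) simp
next
  case (Suc N)
  then obtain g where g: "\<And>t z. p dvd t - t0 \<Longrightarrow> p dvd z - z0 \<Longrightarrow> poly (evT t \<Psi>) z = 0 \<Longrightarrow>
           p ^ N dvd z - poly g (t - t0)" by blast
  let ?d = "poly (evT t0 (pderiv \<Psi>)) z0"
  have "coprime ?d p" using p nd by (metis coprime_commute prime_imp_coprime)
  then obtain c k where "c * ?d + k * p = 1" using bezout_int[of ?d p] by auto
  then have "1 - c * ?d = p * k" by (simp add: algebra_simps)
  then have c: "p dvd 1 - c * ?d" by simp
  \<comment> \<open>This is g(w) - c \<Psi>(t0 + w, g(w)); the coefficients of \<Psi> are shifted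
    because g is a polynomial in w = t - t0.\<close>
  define g' where "g' = g - smult c (poly (map_poly (\<lambda>q. pcompose q [:t0, 1:]) \<Psi>) g)"
  show ?case
  proof (intro exI[of _ g'] allI impI)
    fix t z assume tz: "p dvd t - t0" "p dvd z - z0" "poly (evT t \<Psi>) z = 0"
    define y where "y = poly g (t - t0)"
    have zy: "p ^ N dvd z - y" unfolding y_def by (rule g[OF tz])
    have "p dvd z - y" using zy Suc.hyps by (metis dvd_power dvd_trans linorder_not_less less_one not_gr_zero order_le_less zero_less_iff_neq_zero)
    then have "p dvd (z - z0) - (z - y)" using tz(2) dvd_diff by blast
    then have py: "p dvd y - z0" by simp
    have comp: "poly (poly (map_poly (\<lambda>q. pcompose q [:t0, 1:]) \<Psi>) g) w = poly (evT (t0 + w) \<Psi>) (poly g w)" for w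
      by (induction \<Psi>) (simp_all add: map_poly_pCons poly_pcompose)
    have g'y: "poly g' (t - t0) = y - c * poly (evT t \<Psi>) y"
      unfolding g'_def y_def by (simp add: comp)
    obtain D where D: "poly (evT t \<Psi>) z - poly (evT t \<Psi>) y = (z - y) * D"
      and D': "p dvd D - poly (pderiv (evT t \<Psi>)) z0"
      using poly_diff_factor[OF tz(2) py] by blast
    have "t - t0 dvd poly (poly (pderiv \<Psi>) [:z0:]) t - poly (poly (pderiv \<Psi>) [:z0:]) t0"
      by (rule diff_dvd_poly_diff)
    then have "p dvd poly (evT t (pderiv \<Psi>)) z0 - ?d"
      using tz(1) poly_evT[of t "pderiv \<Psi>" "[:z0:]"] poly_evT[of t0 "pderiv \<Psi>" "[:z0:]"]
      by (simp del: poly_evT) (metis dvd_trans)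
    with D' have "p dvd (D - poly (pderiv (evT t \<Psi>)) z0) + (poly (evT t (pderiv \<Psi>)) z0 - ?d)"
      by (rule dvd_add)
    then have Dd: "p dvd D - ?d" unfolding pderiv_evT by simp
    \<comment> \<open>The new error is (z - y)(1 - c D) with D the difference quotient. Modulo p, D
      is the derivative at the centre, so the second factor supplies the extra p.\<close>
    have "p dvd (1 - c * ?d) - c * (D - ?d)" by (rule dvd_diff[OF c dvd_mult[OF Dd]])
    then have "p dvd 1 - c * D" by (simp add: algebra_simps)
    with zy have "p ^ N * p dvd (z - y) * (1 - c * D)" by (rule mult_dvd_mono)
    also have "(z - y) * (1 - c * D) = z - poly g' (t - t0)"
    proof -
      have "poly (evT t \<Psi>) y = - ((z - y) * D)" using D tz(3) by simp
      then show ?thesis unfolding g'y by (simp only:) (simp add: algebra_simps)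
    qed
    finally show "p ^ Suc N dvd z - poly g' (t - t0)" by (simp add: mult.commute)
  qed
qed

text \<open>Lagrange's bound over the field with p elements, kept in integer polynomials: division
  by X - a leaves a remainder divisible by p and preserves the leading coefficient 1.\<close>

lemma card_roots_mod_prime_le:
  fixes q :: "int poly" and p :: int
  assumes "prime p" "lead_coeff q = 1"
  shows "card {a\<in>{0..<p}. p dvd poly q a} \<le> degree q"
  using assms(2)
proof (induction "degree q" arbitrary: q rule: less_induct)
  case less
  let ?A = "\<lambda>q. {a\<in>{0..<p}. p dvd poly q a}"
  show ?case
  proof (cases "?A q = {}")
    case True
    then show ?thesis by (simp only: card.empty)
  next
    case False
    then obtain a where a: "0 \<le> a" "a < p" "p dvd poly q a" by auto
    have dq: "degree q \<noteq> 0"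
    proof
      assume "degree q = 0"
      then have "q = [:1:]" using less.prems by (auto elim!: degree_eq_zeroE)
      then show False using a assms(1) by (auto simp: prime_elem_not_unit)
    qed
    define q1 where "q1 = synthetic_div q a"
    have q: "q = [:- a, 1:] * q1 + [:poly q a:]"
      unfolding q1_def using synthetic_div_correct'[of a q] by simp
    have dq1: "degree q1 = degree q - 1" unfolding q1_def by (rule degree_synthetic_div)
    have nz1: "q1 \<noteq> 0" using arg_cong[OF q, of degree] dq by auto
    have "lead_coeff q = coeff ([:- a, 1:] * q1) (degree q) + coeff [:poly q a:] (degree q)"
      using arg_cong[OF q, of "\<lambda>r. coeff r (degree q)"] by (simp only: coeff_add)
    moreover have "coeff [:poly q a:] (degree q) = 0" using dq by (simp add: coeff_pCons split: nat.split)
    moreover have "degree ([:- a, 1:] * q1) = degree q" using nz1 dq1 dq by (subst degree_mult_eq) auto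
    ultimately have "lead_coeff q = lead_coeff ([:- a, 1:] * q1)" by (simp only: add_0_right)
    then have l1: "lead_coeff q1 = 1" using less.prems by (simp only: lead_coeff_mult) simp
    have fA: "finite (?A q1)" by (rule finite_subset[of _ "{0..<p}"]) auto
    have "?A q \<subseteq> insert a (?A q1)"
    proof
      fix b assume b: "b \<in> ?A q"
      have "poly q b = (b - a) * poly q1 b + poly q a" by (subst q) (simp add: algebra_simps)
      then have "p dvd (b - a) * poly q1 b" using a(3) b by (simp add: dvd_add_left_iff)
      then have "p dvd b - a \<or> p dvd poly q1 b" using assms(1) by (simp add: prime_dvd_mult_iff)
      then show "b \<in> insert a (?A q1)"
      proof
        assume "p dvd b - a"
        then have "b mod p = a mod p" by (simp add: mod_eq_dvd_iff)
        then have "b = a" using a b by simp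
        then show ?thesis by simp
      qed (use b in auto)
    qed
    then have "card (?A q) \<le> card (insert a (?A q1))" by (rule card_mono[OF finite.insertI[OF fA]])
    also have "\<dots> \<le> Suc (card (?A q1))" using fA by (simp add: card_insert_if del: atLeastLessThan_iff)
    also have "card (?A q1) \<le> degree q1" using less.hyps[of q1] dq1 dq l1 by simp
    finally show ?thesis using dq1 dq by simp
  qed
qed

text \<open>Siegel's lemma by pigeonhole: two pairs of coefficient vectors have the same residues,
  and A, B is their difference. Entries run from 0 to \<alpha> b, so differences stay within
  \<alpha> b in absolute value. The modulus \<open>p ^ (L - k)\<close> is enough at index k because
  the coefficient there is later multiplied by (t - t0)^k.\<close>

lemma siegel_congruences:
  fixes g :: "int poly" and p t0 :: int and \<alpha> \<beta> :: "nat \<Rightarrow> nat"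
  assumes p: "p > 0"
    and less: "(\<Prod>k<L. p ^ (L - k)) < int (\<Prod>b<M. (\<alpha> b + 1) * (\<beta> b + 1))"
  shows "\<exists>A B. (A \<noteq> 0 \<or> B \<noteq> 0) \<and> (\<forall>b\<ge>M. coeff A b = 0 \<and> coeff B b = 0) \<and>
           (\<forall>b. \<bar>coeff A b\<bar> \<le> int (\<alpha> b) \<and> \<bar>coeff B b\<bar> \<le> int (\<beta> b)) \<and>
           (\<forall>k<L. p ^ (L - k) dvd coeff (pcompose A [:t0, 1:] + g * pcompose B [:t0, 1:]) k)"
proof -
  define P where "P = (\<lambda>a::nat\<Rightarrow>nat. \<Sum>b<M. monom (int (a b)) b)"
  have cP: "coeff (P a) b = (if b < M then int (a b) else 0)" for a b
    unfolding P_def by (auto simp: coeff_sum sum.delta' if_distrib cong: if_cong)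
  define T where "T = (\<lambda>A B. pcompose A [:t0, 1:] + g * pcompose B [:t0, 1:])"
  have T_diff: "T (A - A') (B - B') = T A B - T A' B'" for A A' B B'
    unfolding T_def by (simp add: pcompose_diff algebra_simps)
  define box where "box = (\<Pi>\<^sub>E b\<in>{..<M}. {..\<alpha> b}) \<times> (\<Pi>\<^sub>E b\<in>{..<M}. {..\<beta> b})"
  define F where "F = (\<lambda>(a, b). restrict (\<lambda>k. coeff (T (P a) (P b)) k mod p ^ (L - k)) {..<L})"
  define res where "res = (\<Pi>\<^sub>E k\<in>{..<L}. {0..<p ^ (L - k)})"
  have fres: "finite res" unfolding res_def by (intro finite_PiE) auto
  have cb: "card box = (\<Prod>b<M. (\<alpha> b + 1) * (\<beta> b + 1))"
    unfolding box_def card_cartesian_product prod.distrib by (simp add: card_PiE)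
  have "int (card res) = (\<Prod>k<L. p ^ (L - k))"
    unfolding res_def using p by (simp add: card_PiE)
  then have "card res < card box" using less unfolding cb[symmetric] by linarith
  moreover have "F ` box \<subseteq> res" unfolding F_def res_def using p by (auto simp: restrict_PiE_iff split: if_splits)
  then have "card (F ` box) \<le> card res" by (rule card_mono[OF fres])
  ultimately have "\<not> inj_on F box" by (intro pigeonhole) simp
  then obtain a b a' b' where ab: "(a, b) \<in> box" "(a', b') \<in> box" "(a, b) \<noteq> (a', b')"
    and eq: "F (a, b) = F (a', b')" unfolding inj_on_def by (metis surj_pair)
  have inj: "u = v" if "P u = P v" "u \<in> Pi\<^sub>E {..<M} S" "v \<in> Pi\<^sub>E {..<M} S" for u v S
  proof (rule PiE_ext[OF that(2,3)])
    fix b assume "b \<in> {..<M}"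
    then show "u b = v b" using arg_cong[OF that(1), of "\<lambda>q. coeff q b"] by (simp add: cP)
  qed
  show ?thesis
  proof (rule exI[of _ "P a - P a'"], rule exI[of _ "P b - P b'"], intro conjI allI impI)
    show "P a - P a' \<noteq> 0 \<or> P b - P b' \<noteq> 0"
      using ab inj unfolding box_def by (metis eq_iff_diff_eq_0 mem_Sigma_iff)
    show "coeff (P a - P a') c = 0" if "c \<ge> M" for c using that by (simp add: cP)
    show "coeff (P b - P b') c = 0" if "c \<ge> M" for c using that by (simp add: cP)
    have bd: "int (u c) \<le> int (\<gamma> c)" if "u \<in> (\<Pi>\<^sub>E b\<in>{..<M}. {..\<gamma> b})" "c < M" for u \<gamma> c
      using PiE_mem[OF that(1), of c] that(2) by simp
    show "\<bar>coeff (P a - P a') c\<bar> \<le> int (\<alpha> c)" for c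
      using ab bd[of a \<alpha> c] bd[of a' \<alpha> c] unfolding box_def by (cases "c < M"; simp add: cP; linarith)
    show "\<bar>coeff (P b - P b') c\<bar> \<le> int (\<beta> c)" for c
      using ab bd[of b \<beta> c] bd[of b' \<beta> c] unfolding box_def by (cases "c < M"; simp add: cP; linarith)
    fix k assume k: "k < L"
    then have "coeff (T (P a) (P b)) k mod p ^ (L - k) = coeff (T (P a') (P b')) k mod p ^ (L - k)"
      using fun_cong[OF eq, of k] unfolding F_def by simp
    then have "p ^ (L - k) dvd coeff (T (P a - P a') (P b - P b')) k"
      unfolding T_diff coeff_diff by (simp only: mod_eq_dvd_iff)
    then show "p ^ (L - k) dvd coeff (pcompose (P a - P a') [:t0, 1:] + g * pcompose (P b - P b') [:t0, 1:]) k"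
      unfolding T_def .
  qed
qed

section \<open>Elimination of z and the count in one residue class\<close>

lemma poly_evT_sum: "poly (evT t \<Phi>) z = (\<Sum>k\<le>degree \<Phi>. poly (coeff \<Phi> k) t * z ^ k)"
proof -
  have "poly (evT t \<Phi>) z = poly (poly \<Phi> [:z:]) t" using poly_evT[of t \<Phi> "[:z:]"] by simp
  also have "\<dots> = (\<Sum>k\<le>degree \<Phi>. poly (coeff \<Phi> k) t * z ^ k)"
    by (simp add: poly_altdef[of \<Phi>] poly_sum)
  finally show ?thesis .
qed

text \<open>The sum is, up to sign, the resultant of \<Phi> and B z - A, so its vanishing makes A /
  B a root of \<Phi> in the field of fractions. By the rational root theorem over the factorial ring
  of integer polynomials, the reduced denominator of a root of a monic \<Phi> is a unit.\<close>

lemma monic_root_of_homogenization: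
  fixes \<Phi> :: "int poly poly"
  assumes monic: "lead_coeff \<Phi> = 1" and B: "B \<noteq> 0"
    and R: "(\<Sum>k\<le>degree \<Phi>. coeff \<Phi> k * A ^ k * B ^ (degree \<Phi> - k)) = 0"
  shows "\<exists>\<rho>. A = \<rho> * B \<and> poly \<Phi> \<rho> = 0"
proof -
  let ?d = "degree \<Phi>" and ?G = "gcd A B"
  have G: "?G \<noteq> 0" using B by simp
  then obtain A' B' where A': "A = A' * ?G" and B': "B = B' * ?G" and cop: "coprime A' B'"
    using gcd_coprime_exists by blast
  define S where "S = (\<lambda>U V. \<Sum>k\<le>?d. coeff \<Phi> k * U ^ k * V ^ (?d - k))"
  have S_scale: "S (U * W) (V * W) = W ^ ?d * S U V" for U V W
  proof -
    have "coeff \<Phi> k * (U * W) ^ k * (V * W) ^ (?d - k) = W ^ ?d * (coeff \<Phi> k * U ^ k * V ^ (?d - k))"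
      if "k \<le> ?d" for k
    proof -
      have "W ^ ?d = W ^ k * W ^ (?d - k)" using that by (simp add: power_add[symmetric])
      then show ?thesis by (simp add: power_mult_distrib)
    qed
    then show ?thesis unfolding S_def sum_distrib_left by (intro sum.cong) auto
  qed
  have S1: "S \<rho> 1 = poly \<Phi> \<rho>" for \<rho> unfolding S_def poly_altdef by simp
  have "?G ^ ?d * S A' B' = 0" using R S_scale[of A' ?G B'] A' B' unfolding S_def by simp
  then have S0: "S A' B' = 0" using G by (metis mult_eq_0_iff power_not_zero)
  have "S A' B' = A' ^ ?d + (\<Sum>k<?d. coeff \<Phi> k * A' ^ k * B' ^ (?d - k))"
    unfolding S_def using monic by (simp add: lessThan_Suc_atMost[symmetric] add.commute)
  then have e: "A' ^ ?d = - (\<Sum>k<?d. coeff \<Phi> k * A' ^ k * B' ^ (?d - k))"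
    using S0 by (simp add: add_eq_0_iff2)
  have "B' dvd (\<Sum>k<?d. coeff \<Phi> k * A' ^ k * B' ^ (?d - k))"
    by (intro dvd_sum dvd_mult dvd_power) auto
  then have "B' dvd A' ^ ?d" unfolding e by simp
  moreover have "coprime B' (A' ^ ?d)" using cop by (simp add: coprime_commute)
  ultimately have "B' dvd 1" using coprime_absorb_left by blast
  then obtain u where u: "1 = B' * u" by blast
  define \<rho> where "\<rho> = A' * u"
  have r: "A = \<rho> * B" unfolding \<rho>_def using A' B' u by (metis mult.assoc mult.commute mult_1)
  have "B ^ ?d * poly \<Phi> \<rho> = S (\<rho> * B) (1 * B)" unfolding S_scale S1 by simp
  also have "\<dots> = 0" using R r unfolding S_def by simp
  finally show ?thesis using B r by auto
qed

lemma poly_eq_sum_lessThan: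
  fixes A :: "'a::comm_ring_1 poly"
  assumes "\<forall>b\<ge>M. coeff A b = 0"
  shows "poly A x = (\<Sum>b<M. coeff A b * x ^ b)"
proof -
  have "(\<Sum>b<M. coeff A b * x ^ b) = (\<Sum>b\<le>degree A. coeff A b * x ^ b)"
    using assms by (intro sum.mono_neutral_cong) (auto simp: coeff_eq_0 not_le)
  then show ?thesis by (simp only: poly_altdef[of A x])
qed

lemma abs_poly_le_of_coeff_bounds:
  fixes A :: "int poly" and Y :: real
  assumes "\<forall>b\<ge>M. coeff A b = 0" and "\<And>b. \<bar>real_of_int (coeff A b)\<bar> * real N ^ b \<le> Y" and "\<bar>t\<bar> \<le> int N"
  shows "\<bar>real_of_int (poly A t)\<bar> \<le> real M * Y"
proof -
  have "\<bar>real_of_int (poly A t)\<bar> \<le> (\<Sum>b<M. \<bar>real_of_int (coeff A b) * real_of_int t ^ b\<bar>)"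
    unfolding poly_eq_sum_lessThan[OF assms(1)] of_int_sum by (rule order_trans[OF sum_abs]) simp
  also have "\<dots> \<le> (\<Sum>b<M. Y)"
  proof (intro sum_mono)
    fix b
    have "\<bar>real_of_int t\<bar> \<le> real N" using assms(3) by linarith
    then have "\<bar>real_of_int (coeff A b)\<bar> * \<bar>real_of_int t\<bar> ^ b \<le> \<bar>real_of_int (coeff A b)\<bar> * real N ^ b"
      by (intro mult_left_mono power_mono) auto
    also have "\<dots> \<le> Y" by (rule assms(2))
    finally show "\<bar>real_of_int (coeff A b) * real_of_int t ^ b\<bar> \<le> Y" by (simp add: abs_mult power_abs)
  qed
  finally show ?thesis by simp
qed

lemma prime_power_dvd_poly:
  fixes U :: "int poly"
  assumes "\<And>k. k < L \<Longrightarrow> p ^ (L - k) dvd coeff U k" "p dvd w"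
  shows "p ^ L dvd poly U w"
  unfolding poly_altdef
proof (rule dvd_sum)
  fix k
  show "p ^ L dvd coeff U k * w ^ k"
  proof (cases "k < L")
    case True
    then have "p ^ L = p ^ (L - k) * p ^ k" by (simp add: power_add[symmetric])
    then show ?thesis using assms True by (auto intro!: mult_dvd_mono dvd_power_same)
  next
    case False
    then have "p ^ L dvd p ^ k" by (intro le_imp_power_dvd) simp
    also have "p ^ k dvd w ^ k" using assms(2) by (rule dvd_power_same)
    finally show ?thesis by simp
  qed
qed

text \<open>The exponent of p in the product of the 2M moduli p^(2M-k).\<close>

lemma sum_descending: "(\<Sum>k<2*M. 2*M - k) = M * (2 * M + 1 :: nat)"
proof -
  have "(\<Sum>k<n. n - k) = (\<Sum>k\<le>n. k)" for n :: nat
    by (induction n) (simp_all add: sum.lessThan_Suc_shift del: sum.lessThan_Suc)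
  then have "2 * (\<Sum>k<2*M. 2*M - k) = 2 * (M * (2 * M + 1))" by (simp add: gauss_sum_nat atMost_atLeast0)
  then show ?thesis by simp
qed

text \<open>The exponent of N lost in the volume of the box, where A and B each lose N^b at the
  coefficient of index b.\<close>

lemma sum_twice: "(\<Sum>b<M. 2 * b) = M * (M - 1 :: nat)"
proof (induction M)
  case (Suc M)
  then show ?case by (cases M) simp_all
qed simp

text \<open>The polynomials \<open>A\<close>, \<open>B\<close> of the pigeonhole step are so small that \<open>A(t) + z B(t)\<close>, divisible
  by \<open>p\<^bsup>2M\<^esup>\<close> on the residue class, vanishes there; eliminating \<open>z\<close> from \<open>\<Phi>\<close> leaves few \<open>t\<close>, unless
  \<open>z = - A / B\<close> is a root of \<open>\<Phi>\<close>. The role of \<open>\<Psi>\<close> is played by a derivative of \<open>\<Phi>\<close> of which the root is simple.\<close>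

lemma class_card_le:
  fixes \<Phi> \<Psi> :: "int poly poly" and p t0 z0 :: int and M N Zb E :: nat
  assumes monic: "lead_coeff \<Phi> = 1" and degE: "\<And>k. degree (coeff \<Phi> k) \<le> E"
    and p: "prime p" and nd: "\<not> p dvd poly (evT t0 (pderiv \<Psi>)) z0"
    and M: "M \<ge> 1" and N: "N \<ge> 1" and Zb: "Zb \<ge> 1"
    and big: "16 * real M ^ 2 * real Zb * real N ^ (M - 1) < real_of_int p ^ (2 * M - 1)"
  defines "K \<equiv> {t. \<bar>t\<bar> \<le> int N \<and> p dvd t - t0 \<and>
       (\<exists>z. \<bar>z\<bar> \<le> int Zb \<and> p dvd z - z0 \<and> poly (evT t \<Phi>) z = 0 \<and> poly (evT t \<Psi>) z = 0 \<and>
          (\<forall>\<rho>. poly \<Phi> \<rho> = 0 \<longrightarrow> z \<noteq> poly \<rho> t))}"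
  shows "finite K \<and> card K \<le> E + degree \<Phi> * M + M"
proof -
  have p0: "p > 0" using p by (simp add: prime_gt_0_int)
  obtain g where g: "\<And>t z. p dvd t - t0 \<Longrightarrow> p dvd z - z0 \<Longrightarrow> poly (evT t \<Psi>) z = 0 \<Longrightarrow>
      p ^ (2*M) dvd z - poly g (t - t0)"
    using hensel_poly[OF p nd, of "2*M"] M by auto
  \<comment> \<open>Every monomial of A(t) and of z B(t) will be at most Y, so that the 2M monomials
    add up to at most half of p^(2M).\<close>
  define Y where "Y = real_of_int p ^ (2*M) / (4 * real M)"
  have Y0: "Y > 0" unfolding Y_def using p0 M by simp
  define \<alpha> \<beta> where "\<alpha> b = nat \<lfloor>Y / real N ^ b\<rfloor>" and "\<beta> b = nat \<lfloor>Y / (real Zb * real N ^ b)\<rfloor>" for b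
  have a1: "Y / real N ^ b \<le> real (\<alpha> b + 1)" "real (\<alpha> b) \<le> Y / real N ^ b" for b
    unfolding \<alpha>_def using Y0 by (auto intro!: of_nat_floor) linarith
  have b1: "Y / (real Zb * real N ^ b) \<le> real (\<beta> b + 1)" "real (\<beta> b) \<le> Y / (real Zb * real N ^ b)" for b
    unfolding \<beta>_def using Y0 by (auto intro!: of_nat_floor) linarith
  have "(\<Prod>k<2*M. p ^ (2*M - k)) < int (\<Prod>b<M. (\<alpha> b + 1) * (\<beta> b + 1))"
  proof -
    have "(\<Prod>k<2*M. p ^ (2*M - k)) = p ^ (M * (2*M+1))"
      by (simp only: power_sum[symmetric] sum_descending)
    then have "real_of_int (\<Prod>k<2*M. p ^ (2*M - k)) = (real_of_int p ^ (2*M+1)) ^ M"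
      by (simp only: of_int_power power_mult[symmetric] mult.commute)
    \<comment> \<open>Both sides are M-th powers. Without the exponent M the inequality is p^(2M+1)
      < Y^2 / (Zb N^(M-1)), which is the hypothesis \<open>big\<close> since Y^2 = p^(4M) / (16
      M^2).\<close>
    also have "\<dots> < (Y\<^sup>2 / (real Zb * real N ^ (M - 1))) ^ M"
    proof (rule power_strict_mono)
      have e: "real_of_int p ^ (2*M) * real_of_int p ^ (2*M) = real_of_int p ^ (2*M+1) * real_of_int p ^ (2*M-1)"
        unfolding power_add[symmetric] using M by (intro arg_cong[of _ _ "\<lambda>n. _ ^ n"]) simp
      have "real_of_int p ^ (2*M+1) * (16 * real M ^ 2 * real Zb * real N ^ (M - 1)) < real_of_int p ^ (2*M+1) * real_of_int p ^ (2 * M - 1)"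
        using p0 big by (intro mult_strict_left_mono) auto
      also have "\<dots> = Y\<^sup>2 * (16 * real M ^ 2)" unfolding Y_def e[symmetric] using M
        by (simp add: power2_eq_square field_simps)
      finally have "real_of_int p ^ (2*M+1) * (real Zb * real N ^ (M - 1)) < Y\<^sup>2"
        using M by (simp add: mult.assoc mult.left_commute)
      then show "real_of_int p ^ (2*M+1) < Y\<^sup>2 / (real Zb * real N ^ (M - 1))"
        using Zb N by (simp add: pos_less_divide_eq)
    qed (use p0 M in auto)
    also have "\<dots> = (\<Prod>b<M. (Y / real N ^ b) * (Y / (real Zb * real N ^ b)))"
    proof -
      have p1: "(\<Prod>b<M. real N ^ (2 * b)) = real N ^ (M * (M - 1))"
        by (simp only: power_sum[symmetric] sum_twice)
      have "(\<Prod>b<M. (Y / real N ^ b) * (Y / (real Zb * real N ^ b))) = (\<Prod>b<M. (Y\<^sup>2 / real Zb) / real N ^ (2 * b))"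
        by (intro prod.cong) (simp_all add: power2_eq_square mult_2 power_add)
      also have "\<dots> = (Y\<^sup>2 / real Zb) ^ M / (real N ^ (M - 1)) ^ M"
        unfolding prod_dividef p1
        by (simp only: prod_constant card_lessThan power_divide power_mult[symmetric] mult.commute)
      finally show ?thesis by (simp only: power_divide power_mult_distrib divide_divide_eq_left)
    qed
    also have "\<dots> \<le> (\<Prod>b<M. real (\<alpha> b + 1) * real (\<beta> b + 1))"
      using Y0 N Zb by (intro prod_mono conjI mult_mono a1 b1) auto
    also have "\<dots> = real_of_int (int (\<Prod>b<M. (\<alpha> b + 1) * (\<beta> b + 1)))"
      by (simp only: of_nat_mult of_nat_prod of_int_mult of_int_prod of_int_of_nat_eq)
    finally show ?thesis by (simp only: of_int_less_iff)
  qed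
  from siegel_congruences[OF p0 this, of t0 g]
  obtain A B where AB: "A \<noteq> 0 \<or> B \<noteq> 0" and A0: "\<forall>b\<ge>M. coeff A b = 0" and B0: "\<forall>b\<ge>M. coeff B b = 0"
    and Ab: "\<And>b. \<bar>coeff A b\<bar> \<le> int (\<alpha> b)" and Bb: "\<And>b. \<bar>coeff B b\<bar> \<le> int (\<beta> b)"
    and dvd: "\<And>k. k < 2*M \<Longrightarrow> p ^ (2*M - k) dvd coeff (pcompose A [:t0, 1:] + g * pcompose B [:t0, 1:]) k"
    by blast
  have zero: "- poly A t = z * poly B t"
    if "\<bar>t\<bar> \<le> int N" "p dvd t - t0" "\<bar>z\<bar> \<le> int Zb" "p dvd z - z0" "poly (evT t \<Psi>) z = 0" for t z
  proof -
    have "p ^ (2*M) dvd poly (pcompose A [:t0, 1:] + g * pcompose B [:t0, 1:]) (t - t0)"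
      by (rule prime_power_dvd_poly[OF dvd that(2)])
    then have d1: "p ^ (2*M) dvd poly A t + poly g (t - t0) * poly B t" by (simp add: poly_pcompose)
    have "p ^ (2*M) dvd (poly A t + poly g (t - t0) * poly B t) + (z - poly g (t - t0)) * poly B t"
      using g[OF that(2,4,5)] by (intro dvd_add d1 dvd_mult2)
    then have d: "p ^ (2*M) dvd poly A t + z * poly B t" by (simp add: algebra_simps)
    have "\<bar>real_of_int (coeff A b)\<bar> * real N ^ b \<le> Y" for b
    proof -
      have "\<bar>real_of_int (coeff A b)\<bar> \<le> Y / real N ^ b" using Ab[of b] a1(2)[of b] by linarith
      then show ?thesis using N by (simp add: pos_le_divide_eq)
    qed
    from abs_poly_le_of_coeff_bounds[OF A0 this that(1)]
    have Abd: "\<bar>real_of_int (poly A t)\<bar> \<le> real M * Y" .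
    have "\<bar>real_of_int (coeff B b)\<bar> * real N ^ b \<le> Y / real Zb" for b
    proof -
      have "\<bar>real_of_int (coeff B b)\<bar> \<le> Y / (real Zb * real N ^ b)" using Bb[of b] b1(2)[of b] by linarith
      then show ?thesis using N Zb by (simp add: field_simps)
    qed
    from abs_poly_le_of_coeff_bounds[OF B0 this that(1)]
    have "\<bar>real_of_int (poly B t)\<bar> \<le> real M * (Y / real Zb)" .
    then have "\<bar>real_of_int z\<bar> * \<bar>real_of_int (poly B t)\<bar> \<le> real Zb * (real M * (Y / real Zb))"
      using that(3) by (intro mult_mono) linarith+
    then have "\<bar>real_of_int z * real_of_int (poly B t)\<bar> \<le> real M * Y" using Zb by (simp add: abs_mult)
    then have "\<bar>real_of_int (poly A t + z * poly B t)\<bar> \<le> 2 * (real M * Y)" using Abd by simp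
    also have "\<dots> < real_of_int p ^ (2*M)" unfolding Y_def using M p0 by simp
    finally have "\<bar>poly A t + z * poly B t\<bar> < p ^ (2*M)"
      by (metis of_int_abs of_int_less_iff of_int_power)
    with d have "poly A t + z * poly B t = 0"
      by (metis dvd_imp_le_int linorder_not_less abs_of_pos p0 zero_less_power)
    then show ?thesis by simp
  qed
  define d where "d = degree \<Phi>"
  \<comment> \<open>R is B^d \<Phi>(- A / B) with denominators cleared, which makes sense also at
    the zeros of B.\<close>
  define R where "R = (\<Sum>k\<le>d. coeff \<Phi> k * (- A) ^ k * B ^ (d - k))"
  have Rt: "poly R t = poly B t ^ d * poly (evT t \<Phi>) z" if "- poly A t = z * poly B t" for t z
  proof -
    have termw: "poly (coeff \<Phi> k) t * (- poly A t) ^ k * poly B t ^ (d - k)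
        = poly B t ^ d * (poly (coeff \<Phi> k) t * z ^ k)" if "k \<le> d" for k
    proof -
      have "poly B t ^ d = poly B t ^ k * poly B t ^ (d - k)" using that by (simp add: power_add[symmetric])
      then show ?thesis unfolding \<open>- poly A t = z * poly B t\<close> by (simp add: power_mult_distrib)
    qed
    show ?thesis
      unfolding R_def poly_evT_sum d_def[symmetric] sum_distrib_left poly_sum poly_mult poly_power poly_minus
      by (rule sum.cong[OF refl], rule termw) simp
  qed
  have dA: "degree A \<le> M" "degree B \<le> M" using A0 B0 by (auto intro!: degree_le)
  have dR: "degree R \<le> E + d * M" unfolding R_def
  proof (rule degree_sum_le)
    fix k assume "k \<in> {..d}"
    have "degree (coeff \<Phi> k * (- A) ^ k * B ^ (d - k)) \<le> degree (coeff \<Phi> k) + degree ((- A) ^ k) + degree (B ^ (d - k))"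
      by (meson add_le_mono1 degree_mult_le order_trans)
    also have "\<dots> \<le> E + k * M + (d - k) * M"
      using dA by (intro add_mono degE order_trans[OF degree_power_le]) (simp_all add: mult.commute)
    also have "\<dots> = E + d * M" using \<open>k \<in> {..d}\<close> by (simp add: add.assoc distrib_right[symmetric])
    finally show "degree (coeff \<Phi> k * (- A) ^ k * B ^ (d - k)) \<le> E + d * M" .
  qed simp
  show ?thesis
  proof (cases "R = 0")
    case False
    have "K \<subseteq> {t. poly R t = 0}"
    proof
      fix t assume "t \<in> K"
      then obtain z where z: "- poly A t = z * poly B t" "poly (evT t \<Phi>) z = 0"
        unfolding K_def using zero by blast
      show "t \<in> {t. poly R t = 0}" using Rt[OF z(1)] z(2) by simp
    qed
    moreover have "finite {t. poly R t = 0}" using False by (rule poly_roots_finite)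
    moreover have "card {t. poly R t = 0} \<le> degree R" using False by (rule card_poly_roots_bound)
    ultimately show ?thesis using dR unfolding d_def
      by (meson card_mono finite_subset le_add1 order_trans)
  next
    case True
    \<comment> \<open>For B = 0 only the leading term (- A)^d of R would survive, and A is then
      nonzero.\<close>
    have B: "B \<noteq> 0"
    proof
      assume "B = 0"
      then have "R = (\<Sum>k\<in>{d}. coeff \<Phi> k * (- A) ^ k * B ^ (d - k))"
        unfolding R_def by (intro sum.mono_neutral_right) auto
      also have "\<dots> = (- A) ^ d" using monic unfolding d_def by simp
      finally show False using True AB \<open>B = 0\<close> by simp
    qed
    obtain \<rho> where rho: "- A = \<rho> * B" "poly \<Phi> \<rho> = 0"
      using monic_root_of_homogenization[OF monic B, of "- A"] True unfolding R_def d_def by blast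
    \<comment> \<open>Points of K avoid the component z = \<rho>(t), so at such a point the
      equations - A = z B and - A = \<rho> B can both hold only if B vanishes.\<close>
    have "K \<subseteq> {t. poly B t = 0}"
    proof
      fix t assume "t \<in> K"
      then obtain z where z: "- poly A t = z * poly B t" "z \<noteq> poly \<rho> t"
        unfolding K_def using zero rho(2) by blast
      moreover have "- poly A t = poly \<rho> t * poly B t" using arg_cong[OF rho(1), of "\<lambda>q. poly q t"] by simp
      ultimately show "t \<in> {t. poly B t = 0}" by simp
    qed
    moreover have "finite {t. poly B t = 0}" using B by (rule poly_roots_finite)
    moreover have "card {t. poly B t = 0} \<le> degree B" using B by (rule card_poly_roots_bound)
    ultimately show ?thesis using dA
      by (meson card_mono finite_subset le_add2 order_trans)
  qed
qed

section \<open>Sizes of roots and of derivatives\<close>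

lemma abs_root_le:
  fixes c :: "nat \<Rightarrow> int" and z :: int
  assumes "(\<Sum>k<d. c k * z ^ k) + z ^ d = 0"
  shows "\<bar>z\<bar> \<le> 1 + (\<Sum>k<d. \<bar>c k\<bar>)"
proof (rule ccontr)
  assume neg: "\<not> \<bar>z\<bar> \<le> 1 + (\<Sum>k<d. \<bar>c k\<bar>)"
  let ?S = "\<Sum>k<d. \<bar>c k\<bar>"
  have S0: "?S \<ge> 0" by (intro sum_nonneg) auto
  have d: "d > 0" using assms by (cases d) auto
  have z1: "\<bar>z\<bar> \<ge> 1" using neg S0 by linarith
  have "\<bar>z\<bar> ^ d = \<bar>\<Sum>k<d. c k * z ^ k\<bar>" using assms by (simp add: power_abs[symmetric] eq_neg_iff_add_eq_0[symmetric] add.commute)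
  also have "\<dots> \<le> (\<Sum>k<d. \<bar>c k\<bar> * \<bar>z\<bar> ^ k)"
    by (rule order_trans[OF sum_abs]) (simp add: abs_mult power_abs)
  also have "\<dots> \<le> (\<Sum>k<d. \<bar>c k\<bar> * \<bar>z\<bar> ^ (d - 1))"
    using z1 by (intro sum_mono mult_left_mono power_increasing) auto
  also have "\<dots> = ?S * \<bar>z\<bar> ^ (d - 1)" by (simp add: sum_distrib_right)
  also have "\<dots> < \<bar>z\<bar> * \<bar>z\<bar> ^ (d - 1)"
    using neg z1 by (intro mult_strict_right_mono zero_less_power) linarith+
  also have "\<dots> = \<bar>z\<bar> ^ d" using d by (cases d) auto
  finally show False by simp
qed

lemma degree_evT_monic:
  assumes "lead_coeff \<Phi> = 1"
  shows "degree (evT t \<Phi>) = degree \<Phi>" "lead_coeff (evT t \<Phi>) = 1"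
proof -
  have "degree (evT t \<Phi>) \<le> degree \<Phi>" by (rule degree_map_poly_le)
  moreover have "coeff (evT t \<Phi>) (degree \<Phi>) = 1" using assms by simp
  then have "degree \<Phi> \<le> degree (evT t \<Phi>)" by (intro le_degree) simp
  ultimately show e: "degree (evT t \<Phi>) = degree \<Phi>" by simp
  show "lead_coeff (evT t \<Phi>) = 1" unfolding e using assms by simp
qed

lemma abs_root_evT_le:
  assumes "lead_coeff \<Phi> = 1" "poly (evT t \<Phi>) z = 0"
  shows "\<bar>z\<bar> \<le> 1 + (\<Sum>k<degree \<Phi>. \<bar>poly (coeff \<Phi> k) t\<bar>)"
proof (rule abs_root_le)
  show "(\<Sum>k<degree \<Phi>. poly (coeff \<Phi> k) t * z ^ k) + z ^ degree \<Phi> = 0"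
    using assms unfolding poly_evT_sum by (simp add: lessThan_Suc_atMost[symmetric])
qed

lemma abs_poly_le_sum_coeffs:
  fixes q :: "int poly"
  assumes "degree q \<le> d" "\<bar>z\<bar> \<le> Z" "1 \<le> Z"
  shows "\<bar>poly q z\<bar> \<le> (\<Sum>k\<le>d. \<bar>coeff q k\<bar>) * Z ^ d"
proof -
  have "poly q z = (\<Sum>k\<le>d. coeff q k * z ^ k)"
    unfolding poly_altdef using assms(1) by (intro sum.mono_neutral_left) (auto simp: coeff_eq_0)
  then have "\<bar>poly q z\<bar> \<le> (\<Sum>k\<le>d. \<bar>coeff q k\<bar> * \<bar>z\<bar> ^ k)"
    using sum_abs[of "\<lambda>k. coeff q k * z ^ k" "{..d}"] by (simp add: abs_mult power_abs)
  also have "\<dots> \<le> (\<Sum>k\<le>d. \<bar>coeff q k\<bar> * Z ^ d)"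
  proof (intro sum_mono mult_left_mono)
    fix k assume "k \<in> {..d}"
    have "\<bar>z\<bar> ^ k \<le> Z ^ k" using assms by (intro power_mono) auto
    also have "\<dots> \<le> Z ^ d" using assms \<open>k \<in> {..d}\<close> by (intro power_increasing) auto
    finally show "\<bar>z\<bar> ^ k \<le> Z ^ d" .
  qed auto
  finally show ?thesis by (simp add: sum_distrib_right)
qed

lemma sum_abs_coeff_pderiv_le:
  fixes q :: "int poly"
  shows "(\<Sum>k\<le>d. \<bar>coeff (pderiv q) k\<bar>) \<le> int (Suc d) * (\<Sum>k\<le>Suc d. \<bar>coeff q k\<bar>)"
proof -
  have "(\<Sum>k\<le>d. \<bar>coeff (pderiv q) k\<bar>) \<le> (\<Sum>k\<le>d. int (Suc d) * \<bar>coeff q (Suc k)\<bar>)"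
    by (intro sum_mono) (auto simp: coeff_pderiv abs_mult intro!: mult_right_mono)
  also have "\<dots> = int (Suc d) * (\<Sum>k\<le>d. \<bar>coeff q (Suc k)\<bar>)" by (simp only: sum_distrib_left)
  also have "\<dots> \<le> int (Suc d) * (\<Sum>k\<le>Suc d. \<bar>coeff q k\<bar>)"
    by (intro mult_left_mono) (simp_all only: sum.atMost_Suc_shift of_nat_0_le_iff le_add_same_cancel2 abs_ge_zero)
  finally show ?thesis .
qed

text \<open>A crude bound is enough: a nonzero derivative at a root only has to be smaller than a
  product of boundedly many primes, hence at most a fixed power of N.\<close>

lemma sum_abs_coeff_higher_pderiv_le:
  fixes q :: "int poly"
  assumes "degree q \<le> d"
  shows "(\<Sum>k\<le>d. \<bar>coeff ((pderiv ^^ m) q) k\<bar>) \<le> int (Suc d) ^ m * (\<Sum>k\<le>d. \<bar>coeff q k\<bar>)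
     \<and> degree ((pderiv ^^ m) q) \<le> d"
proof (induction m)
  case (Suc m)
  let ?q = "(pderiv ^^ m) q"
  have dq: "degree ?q \<le> d" using Suc by simp
  have "(\<Sum>k\<le>Suc d. \<bar>coeff ?q k\<bar>) = (\<Sum>k\<le>d. \<bar>coeff ?q k\<bar>)"
    using dq by (simp add: coeff_eq_0)
  then have "(\<Sum>k\<le>d. \<bar>coeff (pderiv ?q) k\<bar>) \<le> int (Suc d) * (\<Sum>k\<le>d. \<bar>coeff ?q k\<bar>)"
    using sum_abs_coeff_pderiv_le[of ?q d] by simp
  also have "\<dots> \<le> int (Suc d) * (int (Suc d) ^ m * (\<Sum>k\<le>d. \<bar>coeff q k\<bar>))"
    using Suc by (intro mult_left_mono) auto
  finally have "(\<Sum>k\<le>d. \<bar>coeff ((pderiv ^^ Suc m) q) k\<bar>) \<le> int (Suc d) ^ Suc m * (\<Sum>k\<le>d. \<bar>coeff q k\<bar>)"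
    by (simp add: mult.assoc)
  moreover have "degree ((pderiv ^^ Suc m) q) \<le> d" using dq degree_pderiv[of ?q] by simp
  ultimately show ?case by blast
qed (use assms in simp)

text \<open>If z has multiplicity n, the (n-1)-st derivative has a simple root there. Hensel's lemma
  is applied to this derivative, which takes care of multiple components and of singular points
  alike.\<close>

lemma exists_simple_derivative:
  fixes q :: "int poly"
  assumes q: "q \<noteq> 0" and "poly q z = 0"
  shows "\<exists>m. m < degree q \<and> poly ((pderiv ^^ m) q) z = 0 \<and> poly (pderiv ((pderiv ^^ m) q)) z \<noteq> 0"
proof -
  have dd: "degree ((pderiv ^^ m) q) = degree q - m \<and> (m \<le> degree q \<longrightarrow> (pderiv ^^ m) q \<noteq> 0)" for m
  proof (induction m)
    case (Suc m)
    then show ?case by (auto simp: degree_pderiv pderiv_eq_0_iff)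
  qed (use q in simp)
  have "degree ((pderiv ^^ degree q) q) = 0" "(pderiv ^^ degree q) q \<noteq> 0" using dd[of "degree q"] by auto
  then have ex: "poly ((pderiv ^^ degree q) q) z \<noteq> 0" by (auto elim!: degree_eq_zeroE)
  define n where "n = (LEAST n. poly ((pderiv ^^ n) q) z \<noteq> 0)"
  have n: "poly ((pderiv ^^ n) q) z \<noteq> 0" unfolding n_def using ex by (rule LeastI)
  have nle: "n \<le> degree q" unfolding n_def using ex by (rule Least_le)
  obtain m where m: "n = Suc m" using n assms(2) by (cases n) auto
  have "poly ((pderiv ^^ m) q) z = 0" using not_less_Least[of m "\<lambda>n. poly ((pderiv ^^ n) q) z \<noteq> 0"] m n_def by auto
  then show ?thesis using n nle m by (intro exI[of _ m]) auto
qed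

section \<open>Choice of the prime and the count on a whole curve\<close>

lemma prod_primes_dvd:
  fixes a :: int and S :: "nat set"
  assumes "finite S" "\<And>p. p \<in> S \<Longrightarrow> prime p" "\<And>p. p \<in> S \<Longrightarrow> int p dvd a"
  shows "int (\<Prod>S) dvd a"
  using assms
proof (induction S rule: finite_induct)
  case (insert p S)
  have "coprime p (\<Prod>S)"
    using insert by (intro prod_coprime_right) (metis insertCI primes_coprime)
  then have "coprime (int p) (int (\<Prod>S))" by (simp only: coprime_int_iff)
  then have "int p * int (\<Prod>S) dvd a" using insert by (intro divides_mult) auto
  then show ?case using insert by simp
qed simp

text \<open>If all primes of S divided a, so would their product, which is at least
  \<open>P ^ card S\<close>.\<close>

lemma exists_prime_not_dvd:
  fixes a :: int and S :: "nat set" and P :: real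
  assumes "finite S" "\<And>p. p \<in> S \<Longrightarrow> prime p \<and> P < real p" "a \<noteq> 0"
    and "real_of_int \<bar>a\<bar> < P ^ card S" "P \<ge> 0"
  shows "\<exists>p\<in>S. \<not> int p dvd a"
proof (rule ccontr)
  assume "\<not> (\<exists>p\<in>S. \<not> int p dvd a)"
  then have "int (\<Prod>S) dvd a" using assms by (intro prod_primes_dvd) auto
  then have "int (\<Prod>S) \<le> \<bar>a\<bar>" using assms(3) by (intro zdvd_imp_le) auto
  then have "real (\<Prod>S) \<le> real_of_int \<bar>a\<bar>" by linarith
  moreover have "P ^ card S \<le> real (\<Prod>S)"
    using assms(2,5) prod_mono[of S "\<lambda>_. P" real] by (simp add: less_imp_le)
  ultimately show False using assms(4) by linarith
qed

text \<open>A point is sorted by the order m of a derivative of which it is a simple root, by a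
  prime p modulo which it stays simple, and by its residues. For given m and p there are p residues
  of t, and for each at most \<open>degree \<Phi>\<close> residues of z, because z reduces to a root
  modulo p. So O(Q) classes arise, each with boundedly many points.\<close>

lemma curve_count_large:
  fixes \<Phi> :: "int poly poly" and S :: "nat set" and P Q :: real and N Zb M E :: nat
  assumes monic: "lead_coeff \<Phi> = 1" and degE: "\<And>k. degree (coeff \<Phi> k) \<le> E"
    and S: "finite S" "\<And>p. p \<in> S \<Longrightarrow> prime p \<and> P < real p \<and> real p \<le> Q"
    and "M \<ge> 1" "N \<ge> 1" "Zb \<ge> 1" "P \<ge> 0"
    and big: "16 * real M ^ 2 * real Zb * real N ^ (M - 1) < P ^ (2 * M - 1)"
    and roots: "\<And>t z. \<bar>t\<bar> \<le> int N \<Longrightarrow> poly (evT t \<Phi>) z = 0 \<Longrightarrow> \<bar>z\<bar> \<le> int Zb"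
    and derivs: "\<And>t z m. \<bar>t\<bar> \<le> int N \<Longrightarrow> poly (evT t \<Phi>) z = 0 \<Longrightarrow> m \<le> degree \<Phi> \<Longrightarrow>
        real_of_int \<bar>poly ((pderiv ^^ m) (evT t \<Phi>)) z\<bar> < P ^ card S"
  shows "real (card {t. \<bar>t\<bar> \<le> int N \<and> (\<exists>z. poly (evT t \<Phi>) z = 0 \<and> (\<forall>\<rho>. poly \<Phi> \<rho> = 0 \<longrightarrow> z \<noteq> poly \<rho> t))})
     \<le> real (degree \<Phi> * card S * degree \<Phi> * (E + degree \<Phi> * M + M)) * Q"
proof -
  let ?d = "degree \<Phi>" and ?c = "E + degree \<Phi> * M + M"
  let ?T = "{t. \<bar>t\<bar> \<le> int N \<and> (\<exists>z. poly (evT t \<Phi>) z = 0 \<and> (\<forall>\<rho>. poly \<Phi> \<rho> = 0 \<longrightarrow> z \<noteq> poly \<rho> t))}"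
  define \<Psi> where "\<Psi> m = (pderiv ^^ m) \<Phi>" for m
  define good where "good m p t0 z0 \<longleftrightarrow> \<not> int p dvd poly (evT t0 (pderiv (\<Psi> m))) z0" for m p t0 z0
  \<comment> \<open>Classes at whose centre the derivative vanishes modulo p are declared empty. No
    point is assigned to them, and the bound on the cardinality then holds for all indices.\<close>
  define K where "K m p t0 z0 = (if good m p t0 z0 then {t. \<bar>t\<bar> \<le> int N \<and> int p dvd t - t0 \<and>
       (\<exists>z. \<bar>z\<bar> \<le> int Zb \<and> int p dvd z - z0 \<and> poly (evT t \<Phi>) z = 0 \<and> poly (evT t (\<Psi> m)) z = 0 \<and>
          (\<forall>\<rho>. poly \<Phi> \<rho> = 0 \<longrightarrow> z \<noteq> poly \<rho> t))} else {})" for m p t0 z0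
  define Rt where "Rt p t0 = {a\<in>{0..<int p}. int p dvd poly (evT t0 \<Phi>) a}" for p t0
  have finK: "finite (K m p t0 z0) \<and> card (K m p t0 z0) \<le> ?c" if "p \<in> S" for m p t0 z0
  proof (cases "good m p t0 z0")
    case True
    have P': "16 * real M ^ 2 * real Zb * real N ^ (M - 1) < real_of_int (int p) ^ (2 * M - 1)"
      using big S(2)[OF that] \<open>P \<ge> 0\<close> by (elim less_le_trans) (auto intro!: power_mono)
    have "prime (int p)" using S(2)[OF that] by simp
    from class_card_le[OF monic degE this _ \<open>M \<ge> 1\<close> \<open>N \<ge> 1\<close> \<open>Zb \<ge> 1\<close> P', of t0 "\<Psi> m" z0]
    show ?thesis using True unfolding K_def good_def by simp
  qed (simp add: K_def)
  have Rt: "card (Rt p t0) \<le> ?d" "finite (Rt p t0)" if "p \<in> S" for p t0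
  proof -
    have "prime (int p)" using S(2)[OF that] by simp
    from card_roots_mod_prime_le[OF this degree_evT_monic(2)[OF monic], of t0]
    show "card (Rt p t0) \<le> ?d" unfolding Rt_def degree_evT_monic(1)[OF monic] .
    show "finite (Rt p t0)" unfolding Rt_def by (rule finite_subset[of _ "{0..<int p}"]) auto
  qed
  have sub: "?T \<subseteq> (\<Union>m<?d. \<Union>p\<in>S. \<Union>t0\<in>{0..<int p}. \<Union>z0\<in>Rt p t0. K m p t0 z0)"
  proof
    fix t assume "t \<in> ?T"
    then obtain z where t: "\<bar>t\<bar> \<le> int N" and z: "poly (evT t \<Phi>) z = 0" and nr: "\<forall>\<rho>. poly \<Phi> \<rho> = 0 \<longrightarrow> z \<noteq> poly \<rho> t" by blast
    have "evT t \<Phi> \<noteq> 0"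
    proof
      assume "evT t \<Phi> = 0"
      then show False using degree_evT_monic(2)[OF monic, of t] by (simp only: coeff_0 degree_0)
    qed
    from exists_simple_derivative[OF this z] obtain m where m': "m < degree (evT t \<Phi>)"
      and m0: "poly ((pderiv ^^ m) (evT t \<Phi>)) z = 0" and m1': "poly (pderiv ((pderiv ^^ m) (evT t \<Phi>))) z \<noteq> 0"
      by blast
    have m: "m < ?d" using m' unfolding degree_evT_monic(1)[OF monic] .
    have m1: "poly ((pderiv ^^ Suc m) (evT t \<Phi>)) z \<noteq> 0" using m1' by (simp only: funpow.simps comp_apply) simp
    have "Suc m \<le> ?d" using m by simp
    from exists_prime_not_dvd[OF S(1) _ m1 derivs[OF t z this] \<open>P \<ge> 0\<close>]
    obtain p where p: "p \<in> S" and nd: "\<not> int p dvd poly ((pderiv ^^ Suc m) (evT t \<Phi>)) z"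
      using S(2) by blast
    have p0: "int p > 0" using S(2)[OF p] by (simp add: prime_gt_0_nat)
    define t0 z0 where "t0 = t mod int p" and "z0 = z mod int p"
    have tt: "int p dvd t - t0" "int p dvd z - z0" unfolding t0_def z0_def by simp_all
    have in0: "t0 \<in> {0..<int p}" "z0 \<in> {0..<int p}" unfolding t0_def z0_def using p0 by auto
    have cong: "int p dvd poly (evT t q) z - poly (evT t0 q) z0" for q
    proof -
      have "int p dvd poly (poly q [:z:]) t - poly (poly q [:z:]) t0" 
        by (rule dvd_trans[OF tt(1) diff_dvd_poly_diff])
      then have "int p dvd poly (evT t q) z - poly (evT t0 q) z"
        using poly_evT[of t q "[:z:]"] poly_evT[of t0 q "[:z:]"] by simp
      moreover have "int p dvd poly (evT t0 q) z - poly (evT t0 q) z0"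
        by (rule dvd_trans[OF tt(2) diff_dvd_poly_diff])
      ultimately have "int p dvd (poly (evT t q) z - poly (evT t0 q) z) + (poly (evT t0 q) z - poly (evT t0 q) z0)"
        by (rule dvd_add)
      then show ?thesis by simp
    qed
    have "z0 \<in> Rt p t0" unfolding Rt_def using in0 cong[of \<Phi>] z by simp
    moreover have "good m p t0 z0"
    proof -
      have "\<not> int p dvd poly (evT t (pderiv (\<Psi> m))) z"
        using nd unfolding \<Psi>_def higher_pderiv_evT by (simp only: funpow.simps comp_apply) simp
      moreover have "int p dvd poly (evT t (pderiv (\<Psi> m))) z" if "int p dvd poly (evT t0 (pderiv (\<Psi> m))) z0"
        using dvd_add[OF cong[of "pderiv (\<Psi> m)"] that] by simp
      ultimately show ?thesis unfolding good_def by blast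
    qed
    then have "t \<in> K m p t0 z0"
      using t z nr tt m0 roots[OF t z] unfolding K_def \<Psi>_def higher_pderiv_evT by auto
    ultimately show "t \<in> (\<Union>m<?d. \<Union>p\<in>S. \<Union>t0\<in>{0..<int p}. \<Union>z0\<in>Rt p t0. K m p t0 z0)"
      using m p in0 by blast
  qed
  have fin: "finite (\<Union>m<?d. \<Union>p\<in>S. \<Union>t0\<in>{0..<int p}. \<Union>z0\<in>Rt p t0. K m p t0 z0)"
    using S(1) finK Rt by (intro finite_UN_I) auto
  have "card ?T \<le> card (\<Union>m<?d. \<Union>p\<in>S. \<Union>t0\<in>{0..<int p}. \<Union>z0\<in>Rt p t0. K m p t0 z0)"
    by (rule card_mono[OF fin sub])
  also have "\<dots> \<le> (\<Sum>m<?d. card (\<Union>p\<in>S. \<Union>t0\<in>{0..<int p}. \<Union>z0\<in>Rt p t0. K m p t0 z0))"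
    by (rule card_UN_le) simp
  also have "\<dots> \<le> (\<Sum>m<?d. \<Sum>p\<in>S. p * (?d * ?c))"
  proof (rule sum_mono)
    fix m
    have "card (\<Union>p\<in>S. \<Union>t0\<in>{0..<int p}. \<Union>z0\<in>Rt p t0. K m p t0 z0)
        \<le> (\<Sum>p\<in>S. card (\<Union>t0\<in>{0..<int p}. \<Union>z0\<in>Rt p t0. K m p t0 z0))"
      using S(1) by (rule card_UN_le)
    also have "\<dots> \<le> (\<Sum>p\<in>S. p * (?d * ?c))"
    proof (rule sum_mono)
      fix p assume p: "p \<in> S"
      have "card (\<Union>t0\<in>{0..<int p}. \<Union>z0\<in>Rt p t0. K m p t0 z0)
          \<le> (\<Sum>t0\<in>{0..<int p}. card (\<Union>z0\<in>Rt p t0. K m p t0 z0))" by (rule card_UN_le) simp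
      also have "\<dots> \<le> (\<Sum>t0\<in>{0..<int p}. ?d * ?c)"
      proof (rule sum_mono)
        fix t0
        have "card (\<Union>z0\<in>Rt p t0. K m p t0 z0) \<le> (\<Sum>z0\<in>Rt p t0. card (K m p t0 z0))"
          by (rule card_UN_le[OF Rt(2)[OF p]])
        also have "\<dots> \<le> card (Rt p t0) * ?c" using finK[OF p] sum_bounded_above[of "Rt p t0" "\<lambda>z0. card (K m p t0 z0)" ?c] by simp
        also have "\<dots> \<le> ?d * ?c" using Rt(1)[OF p] by (rule mult_le_mono1)
        finally show "card (\<Union>z0\<in>Rt p t0. K m p t0 z0) \<le> ?d * ?c" .
      qed
      also have "\<dots> = p * (?d * ?c)" by simp
      finally show "card (\<Union>t0\<in>{0..<int p}. \<Union>z0\<in>Rt p t0. K m p t0 z0) \<le> p * (?d * ?c)" .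
    qed
    finally show "card (\<Union>p\<in>S. \<Union>t0\<in>{0..<int p}. \<Union>z0\<in>Rt p t0. K m p t0 z0) \<le> (\<Sum>p\<in>S. p * (?d * ?c))" .
  qed
  also have "\<dots> = (?d * (?d * ?c)) * (\<Sum>p\<in>S. p)" by (simp add: sum_distrib_right[symmetric])
  finally have "real (card ?T) \<le> real ((?d * (?d * ?c)) * (\<Sum>p\<in>S. p))" by (simp only: of_nat_le_iff)
  then have "real (card ?T) \<le> real (?d * (?d * ?c)) * (\<Sum>p\<in>S. real p)"
    by (simp only: of_nat_mult of_nat_sum)
  also have "\<dots> \<le> real (?d * (?d * ?c)) * (real (card S) * Q)"
    using S(2) sum_bounded_above[of S real Q] by (intro mult_left_mono) auto
  finally show ?thesis by (simp add: mult_ac)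
qed

text \<open>K depends on the degrees, on \<epsilon> and on the growth K0 N^C of the coefficients,
  but not on the curve. This uniformity is what allows the lemma to be applied on all lines of a
  box.\<close>

lemma curve_count:
  fixes d E C K0 :: nat and \<epsilon> :: real
  assumes "\<epsilon> > 0"
  shows "\<exists>K\<ge>0. \<forall>N\<ge>1. \<forall>\<Phi>. lead_coeff \<Phi> = 1 \<longrightarrow> degree \<Phi> = d \<longrightarrow> (\<forall>k. degree (coeff \<Phi> k) \<le> E) \<longrightarrow>
     (\<forall>k j. \<bar>coeff (coeff \<Phi> k) j\<bar> \<le> int (K0 * N ^ C)) \<longrightarrow>
     real (card {t. \<bar>t\<bar> \<le> int N \<and> (\<exists>z. poly (evT t \<Phi>) z = 0 \<and> (\<forall>\<rho>. poly \<Phi> \<rho> = 0 \<longrightarrow> z \<noteq> poly \<rho> t))})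
       \<le> K * real N powr (1/2 + \<epsilon>)"
proof -
  \<comment> \<open>The primes lie between P = N^(1/2+e) and P^(1+e), and (1/2+e)(1+e) \<le> 1/2 +
    4e when e \<le> 1/4.\<close>
  define e where "e = min \<epsilon> 1 / 4"
  have e: "e > 0" "e \<le> 1/4" "4 * e \<le> \<epsilon>" unfolding e_def using assms by auto
  define K1 where "K1 = 1 + d * (E + 1) * K0"
  \<comment> \<open>K2 N^C2 bounds the derivatives of \<open>evT t \<Phi>\<close> at its roots,
    because K1 N^(C+E) bounds both the roots and the sum of the coefficients. The number k of primes
    below makes P^k \<ge> N^(C2+1), which is larger once N > K2.\<close>
  define K2 where "K2 = Suc d ^ d * K1 ^ Suc d"
  define C2 where "C2 = (C + E) * Suc d"
  define k where "k = 2 * C2 + 2"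
  \<comment> \<open>This gives e(2M-1) \<ge> C + E + 1 and hence P^(2M-1) \<ge> N^(C+E+M). The
    quantity to beat, Zb N^(M-1), has order N^(C+E+M-1), and the spare factor N absorbs the
    constants.\<close>
  define M where "M = nat \<lceil>(real C + real E + 1) / e\<rceil> + 1"
  have M1: "M \<ge> 1" unfolding M_def by simp
  have "(real C + real E + 1) / e \<le> real M" unfolding M_def by linarith
  also have "\<dots> \<le> real (2 * M - 1)" using M1 by simp
  finally have "(real C + real E + 1) / e \<le> real (2 * M - 1)" .
  then have M2: "real C + real E + 1 \<le> e * real (2 * M - 1)"
    unfolding pos_divide_le_eq[OF e(1)] by (simp only: mult.commute)
  have M3: "real (2 * M - 1) = 2 * real M - 1" using M1 by (simp add: of_nat_diff)
  obtain x0 where x0: "\<And>x. x \<ge> x0 \<Longrightarrow> \<exists>S. finite S \<and> card S = k \<and>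
           (\<forall>p\<in>S. prime (p::nat) \<and> x < real p \<and> real p \<le> x powr (1 + e))"
    using exists_primes_between_powr[OF e(1), of k] by blast
  define N0 where "N0 = K2 + 16 * M ^ 2 * K1 + nat \<lceil>x0\<^sup>2\<rceil> + 1"
  \<comment> \<open>The first summand is the trivial count for N < N0, the second the count for all
    larger N.\<close>
  define K where "K = real (2 * N0 + 1) + real (d * k * d * (E + d * M + M))"
  show ?thesis
  proof (rule exI[of _ K], intro conjI allI impI)
    show "0 \<le> K" unfolding K_def by simp
    fix N :: nat and \<Phi> :: "int poly poly"
    assume N: "1 \<le> N" and monic: "lead_coeff \<Phi> = 1" and d: "degree \<Phi> = d"
      and degE: "\<forall>k. degree (coeff \<Phi> k) \<le> E" and ht: "\<forall>k j. \<bar>coeff (coeff \<Phi> k) j\<bar> \<le> int (K0 * N ^ C)"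
    let ?T = "{t. \<bar>t\<bar> \<le> int N \<and> (\<exists>z. poly (evT t \<Phi>) z = 0 \<and> (\<forall>\<rho>. poly \<Phi> \<rho> = 0 \<longrightarrow> z \<noteq> poly \<rho> t))}"
    have N1: "real N powr (1/2 + \<epsilon>) \<ge> 1" using N assms by (intro ge_one_powr_ge_zero) auto
    show "real (card ?T) \<le> K * real N powr (1/2 + \<epsilon>)"
    proof (cases "N < N0")
      case True
      have "card ?T \<le> card {- int N..int N}" by (intro card_mono) auto
      also have "\<dots> \<le> 2 * N0 + 1" using True by simp
      finally have "real (card ?T) \<le> K" unfolding K_def by linarith
      also have "K \<le> K * real N powr (1/2 + \<epsilon>)" using mult_left_mono[OF N1, of K] unfolding K_def by simp
      finally show ?thesis .
    next
      case False
      define P where "P = real N powr (1/2 + e)"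
      have P_pow: "P ^ j = real N powr ((1/2 + e) * real j)" for j
        unfolding P_def using N by (simp add: powr_powr powr_realpow[symmetric])
      have P0: "P \<ge> 0" unfolding P_def by simp
      have "x0\<^sup>2 \<le> real N" using False unfolding N0_def by linarith
      then have "x0 \<le> sqrt (real N)" by (simp add: real_le_rsqrt)
      also have "\<dots> = real N powr (1/2)" using N by (simp add: powr_half_sqrt)
      also have "\<dots> \<le> P" unfolding P_def using N e by (intro powr_mono) auto
      finally have "x0 \<le> P" .
      from x0[OF this] obtain S where S: "finite S" "card S = k"
        and pS: "\<And>p. p \<in> S \<Longrightarrow> prime p \<and> P < real p \<and> real p \<le> P powr (1 + e)"
        by blast
      define Zb where "Zb = K1 * N ^ (C + E)"
      have Zb1: "Zb \<ge> 1" unfolding Zb_def K1_def using N by (simp add: Suc_le_eq)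
      have cb: "\<bar>poly (coeff \<Phi> j) t\<bar> \<le> int ((E + 1) * K0 * N ^ (C + E))" if "\<bar>t\<bar> \<le> int N" for j t
      proof -
        have "\<bar>poly (coeff \<Phi> j) t\<bar> \<le> (\<Sum>i\<le>E. \<bar>coeff (coeff \<Phi> j) i\<bar>) * int N ^ E"
          using degE that N by (intro abs_poly_le_sum_coeffs) auto
        also have "(\<Sum>i\<le>E. \<bar>coeff (coeff \<Phi> j) i\<bar>) \<le> int (E + 1) * int (K0 * N ^ C)"
          using sum_bounded_above[of "{..E}" "\<lambda>i. \<bar>coeff (coeff \<Phi> j) i\<bar>" "int (K0 * N ^ C)"] ht by simp
        finally have "\<bar>poly (coeff \<Phi> j) t\<bar> \<le> (int (E + 1) * int (K0 * N ^ C)) * int N ^ E"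
          by (simp add: mult_right_mono)
        then show ?thesis by (simp add: power_add algebra_simps)
      qed
      have sb: "(\<Sum>j<d. \<bar>poly (coeff \<Phi> j) t\<bar>) + 1 \<le> int Zb" if "\<bar>t\<bar> \<le> int N" for t
      proof -
        have "(\<Sum>j<d. \<bar>poly (coeff \<Phi> j) t\<bar>) \<le> int d * int ((E + 1) * K0 * N ^ (C + E))"
          using sum_bounded_above[of "{..<d}" "\<lambda>i. \<bar>poly (coeff \<Phi> i) t\<bar>" "int ((E + 1) * K0 * N ^ (C + E))"] cb[OF that] by simp
        moreover have "1 \<le> int N ^ (C + E)" using N by simp
        ultimately have "(\<Sum>j<d. \<bar>poly (coeff \<Phi> j) t\<bar>) + 1 \<le> int d * int ((E + 1) * K0 * N ^ (C + E)) + int N ^ (C + E)"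
          by (rule add_mono)
        also have "\<dots> = int Zb" unfolding Zb_def K1_def by (simp add: algebra_simps)
        finally show ?thesis .
      qed
      have roots: "\<bar>z\<bar> \<le> int Zb" if "\<bar>t\<bar> \<le> int N" "poly (evT t \<Phi>) z = 0" for t z
        using abs_root_evT_le[OF monic that(2)] sb[OF that(1)] unfolding d by linarith
      have K2N: "real (K2 * N ^ C2) < P ^ k"
      proof -
        have "K2 < N" using False unfolding N0_def by simp
        then have "real (K2 * N ^ C2) < real N * real N ^ C2" using N by simp
        also have "\<dots> = real N powr (real C2 + 1)" using N by (simp add: powr_add powr_realpow)
        also have "\<dots> \<le> P ^ k" unfolding P_pow k_def using N e by (intro powr_mono) (auto simp: algebra_simps)
        finally show ?thesis .
      qed
      have derivs: "real_of_int \<bar>poly ((pderiv ^^ m) (evT t \<Phi>)) z\<bar> < P ^ card S"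
        if t: "\<bar>t\<bar> \<le> int N" and z: "poly (evT t \<Phi>) z = 0" and m: "m \<le> degree \<Phi>" for t z m
      proof -
        let ?q = "evT t \<Phi>"
        have dq: "degree ?q \<le> d" using degree_evT_monic(1)[OF monic] d by simp
        have S1: "(\<Sum>j\<le>d. \<bar>coeff ?q j\<bar>) \<le> int Zb"
          using sb[OF t] monic d by (simp add: lessThan_Suc_atMost[symmetric])
        have "\<bar>poly ((pderiv ^^ m) ?q) z\<bar> \<le> (\<Sum>j\<le>d. \<bar>coeff ((pderiv ^^ m) ?q) j\<bar>) * int Zb ^ d"
          using sum_abs_coeff_higher_pderiv_le[OF dq, of m] roots[OF t z] Zb1
          by (intro abs_poly_le_sum_coeffs) auto
        also have "\<dots> \<le> (int (Suc d) ^ d * int Zb) * int Zb ^ d"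
        proof (intro mult_right_mono)
          have "(\<Sum>j\<le>d. \<bar>coeff ((pderiv ^^ m) ?q) j\<bar>) \<le> int (Suc d) ^ m * (\<Sum>j\<le>d. \<bar>coeff ?q j\<bar>)"
            using sum_abs_coeff_higher_pderiv_le[OF dq, of m] by blast
          also have "\<dots> \<le> int (Suc d) ^ d * int Zb"
            using m d S1 by (intro mult_mono power_increasing sum_nonneg) auto
          finally show "(\<Sum>j\<le>d. \<bar>coeff ((pderiv ^^ m) ?q) j\<bar>) \<le> int (Suc d) ^ d * int Zb" .
        qed simp
        also have "\<dots> = int (K2 * N ^ C2)"
        proof -
          have "int (K2 * N ^ C2) = int (Suc d) ^ d * (int K1 ^ Suc d * (int N ^ (C + E)) ^ Suc d)"
            unfolding K2_def C2_def by (simp only: of_nat_mult of_nat_power power_mult mult.assoc)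
          also have "\<dots> = int (Suc d) ^ d * (int Zb) ^ Suc d"
            unfolding Zb_def by (simp only: of_nat_mult of_nat_power power_mult_distrib)
          finally show ?thesis by (simp only: power_Suc mult_ac)
        qed
        finally have "real_of_int \<bar>poly ((pderiv ^^ m) ?q) z\<bar> \<le> real (K2 * N ^ C2)" by linarith
        with K2N S show ?thesis by simp
      qed
      have big: "16 * real M ^ 2 * real Zb * real N ^ (M - 1) < P ^ (2 * M - 1)"
      proof -
        have "16 * M ^ 2 * K1 < N" using False unfolding N0_def by simp
        then have "real (16 * M ^ 2 * K1) < real N" by (simp only: of_nat_less_iff)
        then have "real (16 * M ^ 2 * K1) * real N ^ (C + E + (M - 1)) < real N * real N ^ (C + E + (M - 1))"
          using N by (intro mult_strict_right_mono) auto
        moreover have "16 * real M ^ 2 * real Zb * real N ^ (M - 1) = real (16 * M ^ 2 * K1) * real N ^ (C + E + (M - 1))"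
          unfolding Zb_def by (simp add: power_add mult_ac)
        moreover have "real N * real N ^ (C + E + (M - 1)) = real N powr (real (C + E + (M - 1)) + 1)"
          using N by (simp add: powr_add powr_realpow del: of_nat_add)
        moreover have "\<dots> \<le> P ^ (2 * M - 1)"
        proof -
          have "real (C + E + (M - 1)) + 1 = real C + real E + real M" using M1 by simp
          also have "\<dots> \<le> (1/2 + e) * real (2 * M - 1)" using M2 unfolding M3 by (simp add: algebra_simps)
          finally have le: "real (C + E + (M - 1)) + 1 \<le> (1/2 + e) * real (2 * M - 1)" .
          show ?thesis unfolding P_pow by (rule powr_mono[OF le]) (use N in simp)
        qed
        ultimately show ?thesis by linarith
      qed
      have "real (card ?T) \<le> real (degree \<Phi> * card S * degree \<Phi> * (E + degree \<Phi> * M + M)) * P powr (1 + e)"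
        using pS degE by (intro curve_count_large[OF monic _ S(1) _ M1 N Zb1 P0 big roots derivs]) auto
      also have "\<dots> \<le> K * real N powr (1/2 + \<epsilon>)"
      proof (intro mult_mono)
        show "real (degree \<Phi> * card S * degree \<Phi> * (E + degree \<Phi> * M + M)) \<le> K" unfolding K_def d S(2) by simp
        have "P powr (1 + e) = real N powr ((1/2 + e) * (1 + e))" unfolding P_def by (simp add: powr_powr)
        also have "(1/2 + e) * (1 + e) \<le> 1/2 + \<epsilon>"
        proof -
          have "e * e \<le> e * (1/4)" using e by (intro mult_left_mono) auto
          moreover have "(1/2 + e) * (1 + e) = 1/2 + 1/2 * e + (e + e * e)"
            by (simp only: distrib_left distrib_right mult_1_right)
          ultimately show ?thesis using e by linarith
        qed
        then have "real N powr ((1/2 + e) * (1 + e)) \<le> real N powr (1/2 + \<epsilon>)" using N by (intro powr_mono) auto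
        finally show "P powr (1 + e) \<le> real N powr (1/2 + \<epsilon>)" .
        show "0 \<le> K" unfolding K_def by simp
      qed simp
      finally show ?thesis .
    qed
  qed
qed

section \<open>Multivariate polynomials\<close>

instance var :: (finite, finite) finite
proof
  have "(UNIV :: ('a, 'b) var set) \<subseteq> range XVar \<union> range TVar"
  proof
    fix x :: "('a, 'b) var" show "x \<in> range XVar \<union> range TVar" by (cases x) auto
  qed
  then show "finite (UNIV :: ('a, 'b) var set)" by (rule finite_subset) simp
qed

definition mon :: "('v \<Rightarrow> 'b::comm_ring_1) \<Rightarrow> ('v \<Rightarrow>\<^sub>0 nat) \<Rightarrow> 'b" where
  "mon x m = (\<Prod>v\<in>Poly_Mapping.keys m. x v ^ Poly_Mapping.lookup m v)"

text \<open>Coefficients pass through a map g of their own, because one polynomial is evaluated in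
  the integers, in polynomial rings over the rationals and in polynomials over polynomials.\<close>

definition meval :: "('a::comm_ring_1 \<Rightarrow> 'b::comm_ring_1) \<Rightarrow> ('v \<Rightarrow> 'b) \<Rightarrow> ('v, 'a) mpoly \<Rightarrow> 'b" where
  "meval g x p = (\<Sum>m\<in>Poly_Mapping.keys p. g (Poly_Mapping.lookup p m) * mon x m)"

abbreviation mconst :: "'a \<Rightarrow> ('v, 'a::comm_ring_1) mpoly" where
  "mconst \<equiv> Poly_Mapping.single 0"

lemma mpoly_eval_eq_meval: "mpoly_eval x p = meval of_int x p"
  unfolding mpoly_eval_def meval_def mon_def ..

lemma mon_superset:
  assumes "finite S" "Poly_Mapping.keys m \<subseteq> S"
  shows "mon x m = (\<Prod>v\<in>S. x v ^ Poly_Mapping.lookup m v)"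
  unfolding mon_def using assms by (intro prod.mono_neutral_left) (auto simp: in_keys_iff)

lemma mon_add: "mon x (m + n) = mon x m * mon x n"
proof -
  let ?S = "Poly_Mapping.keys m \<union> Poly_Mapping.keys n"
  have "mon x (m + n) = (\<Prod>v\<in>?S. x v ^ Poly_Mapping.lookup (m + n) v)"
    by (rule mon_superset) (use keys_add[of m n] in auto)
  also have "\<dots> = (\<Prod>v\<in>?S. x v ^ Poly_Mapping.lookup m v) * (\<Prod>v\<in>?S. x v ^ Poly_Mapping.lookup n v)"
    by (simp add: lookup_add power_add prod.distrib)
  also have "\<dots> = mon x m * mon x n"
    by (subst (1 2) mon_superset[of ?S]) auto
  finally show ?thesis .
qed

lemma mon_0 [simp]: "mon x 0 = 1" by (simp add: mon_def)

lemma mon_single [simp]: "mon x (Poly_Mapping.single v k) = x v ^ k"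
  by (cases "k = 0") (simp_all add: mon_def)

lemma mpoly_induct [case_names single add]:
  fixes p :: "('v, 'a::comm_ring_1) mpoly"
  assumes "\<And>m c. P (Poly_Mapping.single m c)" "\<And>p q. P p \<Longrightarrow> P q \<Longrightarrow> P (p + q)"
  shows "P p"
proof -
  have "P (\<Sum>m\<in>S. Poly_Mapping.single m (f m))" if "finite S" for S :: "('v \<Rightarrow>\<^sub>0 nat) set" and f
    using that
  proof (induction S rule: finite_induct)
    case empty
    have "P (Poly_Mapping.single 0 0)" by (rule assms(1))
    then show ?case by simp
  next
    case (insert m S)
    then show ?case using assms by simp
  qed
  from this[of "Poly_Mapping.keys p" "Poly_Mapping.lookup p"]
  have "P (\<Sum>m\<in>Poly_Mapping.keys p. Poly_Mapping.single m (Poly_Mapping.lookup p m))" by simp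
  also have "(\<Sum>m\<in>Poly_Mapping.keys p. Poly_Mapping.single m (Poly_Mapping.lookup p m)) = p"
    by (rule poly_mapping_eqI) (simp add: lookup_sum lookup_single when_def in_keys_iff)
  finally show ?thesis .
qed

locale mpoly_hom = g: comm_ring_hom g for g :: "'a::comm_ring_1 \<Rightarrow> 'b::comm_ring_1"
begin

lemma meval_superset:
  assumes "finite S" "Poly_Mapping.keys p \<subseteq> S"
  shows "meval g x p = (\<Sum>m\<in>S. g (Poly_Mapping.lookup p m) * mon x m)"
  unfolding meval_def using assms by (intro sum.mono_neutral_left) (auto simp: in_keys_iff)

lemma meval_add: "meval g x (p + q) = meval g x p + meval g x q"
proof -
  let ?S = "Poly_Mapping.keys p \<union> Poly_Mapping.keys q"
  have "meval g x (p + q) = (\<Sum>m\<in>?S. g (Poly_Mapping.lookup (p + q) m) * mon x m)"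
    by (rule meval_superset) (use keys_add[of p q] in auto)
  also have "\<dots> = (\<Sum>m\<in>?S. g (Poly_Mapping.lookup p m) * mon x m) + (\<Sum>m\<in>?S. g (Poly_Mapping.lookup q m) * mon x m)"
    by (simp add: lookup_add g.hom_add distrib_right sum.distrib)
  also have "\<dots> = meval g x p + meval g x q"
    by (subst (1 2) meval_superset[of ?S]) auto
  finally show ?thesis .
qed

lemma meval_single [simp]: "meval g x (Poly_Mapping.single m c) = g c * mon x m"
  by (cases "c = 0") (simp_all add: meval_def)

lemma meval_0 [simp]: "meval g x 0 = 0" by (simp add: meval_def)

lemma meval_1 [simp]: "meval g x 1 = 1"
  using meval_single[of x 0 1] by simp

lemma meval_mult: "meval g x (p * q) = meval g x p * meval g x q"
proof (induction p rule: mpoly_induct)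
  case (single m c)
  show ?case
  proof (induction q rule: mpoly_induct)
    case (single n d)
    show ?case by (simp add: mult_single mon_add g.hom_mult mult_ac)
  next
    case (add p q)
    show ?case by (subst distrib_left, (subst meval_add)+, (subst add)+, subst distrib_left, rule refl)
  qed
next
  case (add p q)
  show ?case by (subst distrib_right, (subst meval_add)+, (subst add)+, subst distrib_right, rule refl)
qed

sublocale meval: comm_ring_hom "meval g x" for x
  by unfold_locales (simp_all add: meval_add meval_mult)

lemma meval_mvar [simp]: "meval g x (mvar v) = x v"
  by (simp add: mvar_def)

end

lemma mpoly_hom_meval: "comm_ring_hom g \<Longrightarrow> comm_ring_hom (meval g x)"
proof -
  assume "comm_ring_hom g"
  then interpret mpoly_hom g by (simp add: mpoly_hom_def)
  show ?thesis by (rule meval.comm_ring_hom_axioms)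
qed

lemma mon_mvar: "mon mvar m = (Poly_Mapping.single m 1 :: ('v, 'a::comm_ring_1) mpoly)"
proof -
  have pw: "(mvar v :: ('v, 'a) mpoly) ^ k = Poly_Mapping.single (Poly_Mapping.single v k) 1" for v k
    by (induction k) (simp_all add: mvar_def mult_single single_add[symmetric])
  have "(\<Prod>v\<in>S. Poly_Mapping.single (f v) 1) = (Poly_Mapping.single (sum f S) 1 :: ('v, 'a) mpoly)"
    if "finite S" for S :: "'v set" and f
    using that by (induction S rule: finite_induct) (simp_all add: mult_single)
  then have "mon mvar m = (Poly_Mapping.single (\<Sum>v\<in>Poly_Mapping.keys m. Poly_Mapping.single v (Poly_Mapping.lookup m v)) 1 :: ('v, 'a) mpoly)"
    unfolding mon_def pw by simp
  also have "(\<Sum>v\<in>Poly_Mapping.keys m. Poly_Mapping.single v (Poly_Mapping.lookup m v)) = m"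
    by (rule poly_mapping_eqI) (simp add: lookup_sum lookup_single when_def in_keys_iff)
  finally show ?thesis .
qed

lemma comm_ring_hom_eq_meval:
  fixes F :: "('v, 'a::comm_ring_1) mpoly \<Rightarrow> 'b::comm_ring_1"
  assumes "comm_ring_hom F"
  shows "F p = meval (\<lambda>c. F (mconst c)) (\<lambda>v. F (mvar v)) p"
proof -
  interpret F: comm_ring_hom F by fact
  interpret mpoly_hom "\<lambda>c. F (mconst c)"
    by unfold_locales (simp_all add: single_add F.hom_add F.hom_mult[symmetric] mult_single)
  have m: "F (mon mvar m) = mon (\<lambda>v. F (mvar v)) m" for m
    by (simp add: mon_def F.hom_prod F.hom_power)
  show ?thesis
  proof (induction p rule: mpoly_induct)
    case (single m c)
    have e: "Poly_Mapping.single m c = mconst c * (mon mvar m :: ('v, 'a) mpoly)"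
      by (simp add: mon_mvar mult_single)
    have "F (Poly_Mapping.single m c) = F (mconst c) * mon (\<lambda>v. F (mvar v)) m"
      unfolding e by (simp add: F.hom_mult m)
    then show ?case by simp
  qed (simp add: F.hom_add meval_add)
qed

text \<open>The universal property of the polynomial ring. Later identities between composed
  substitutions are checked on constants and variables only.\<close>

lemma mpoly_hom_ext:
  fixes F G :: "('v, 'a::comm_ring_1) mpoly \<Rightarrow> 'b::comm_ring_1"
  assumes "comm_ring_hom F" "comm_ring_hom G" "\<And>c. F (mconst c) = G (mconst c)" "\<And>v. F (mvar v) = G (mvar v)"
  shows "F p = G p"
  using comm_ring_hom_eq_meval[OF assms(1), of p] comm_ring_hom_eq_meval[OF assms(2), of p] assms(3,4) by simp

lemma comm_ring_hom_comp: "comm_ring_hom f \<Longrightarrow> comm_ring_hom g \<Longrightarrow> comm_ring_hom (\<lambda>x. f (g x))"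
proof -
  assume "comm_ring_hom f" "comm_ring_hom g"
  then interpret f: comm_ring_hom f + g: comm_ring_hom g by auto
  show ?thesis by unfold_locales (simp_all add: f.hom_add f.hom_mult g.hom_add g.hom_mult)
qed

lemma comm_ring_hom_id: "comm_ring_hom (\<lambda>x::'a::comm_ring_1. x)"
  by unfold_locales auto

lemma comm_ring_hom_mconst: "comm_ring_hom (mconst :: 'a::comm_ring_1 \<Rightarrow> ('v, 'a) mpoly)"
  by unfold_locales (simp_all add: single_add mult_single)

lemma comm_ring_hom_const_poly: "comm_ring_hom (\<lambda>x::'a::comm_ring_1. [:x:])"
  by unfold_locales (auto simp: one_pCons)

lemma comm_ring_hom_poly: "comm_ring_hom (\<lambda>p. poly p (a::'a::comm_ring_1))"
  by unfold_locales auto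

lemma comm_ring_hom_map_poly: "comm_ring_hom f \<Longrightarrow> comm_ring_hom (map_poly f)"
proof -
  assume "comm_ring_hom f"
  then interpret f: map_poly_comm_ring_hom f by (simp add: map_poly_comm_ring_hom_def)
  show ?thesis by (rule f.comm_ring_hom_axioms)
qed

lemma comm_ring_hom_of_int: "comm_ring_hom (of_int :: int \<Rightarrow> 'a::comm_ring_1)"
  by unfold_locales auto

lemma hom_meval:
  assumes "comm_ring_hom f" "comm_ring_hom g"
  shows "f (meval g x p) = meval (\<lambda>c. f (g c)) (\<lambda>v. f (x v)) p"
proof -
  interpret f: comm_ring_hom f by fact
  show ?thesis unfolding meval_def mon_def by (simp add: f.hom_sum f.hom_mult f.hom_prod f.hom_power)
qed

subsection \<open>The variables of a polynomial\<close>

lemma mvars_0 [simp]: "mvars 0 = {}" by (simp add: mvars_def)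

lemma mvars_mconst [simp]: "mvars (mconst c) = {}"
  by (cases "c = 0") (simp_all add: mvars_def)

lemma mvars_1 [simp]: "mvars (1 :: ('v, 'a::comm_ring_1) mpoly) = {}"
  using mvars_mconst[of "1::'a"] by simp

lemma mvars_mvar [simp]: "mvars (mvar v :: ('v, 'a::comm_ring_1) mpoly) = {v}"
  by (simp add: mvars_def mvar_def)

lemma mvars_add: "mvars (p + q) \<subseteq> mvars p \<union> mvars q"
  unfolding mvars_def using keys_add[of p q] by blast

lemma mvars_uminus [simp]: "mvars (- p :: ('v, 'a::comm_ring_1) mpoly) = mvars p"
proof -
  have "Poly_Mapping.keys (- p) = Poly_Mapping.keys p" by (auto simp: in_keys_iff)
  then show ?thesis unfolding mvars_def by simp
qed

lemma mvars_mult: "mvars (p * q) \<subseteq> mvars p \<union> mvars (q :: ('v, 'a::comm_ring_1) mpoly)"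
proof
  fix v assume "v \<in> mvars (p * q)"
  then obtain m where m: "m \<in> Poly_Mapping.keys (p * q)" "v \<in> Poly_Mapping.keys m" unfolding mvars_def by auto
  then obtain a b where "a \<in> Poly_Mapping.keys p" "b \<in> Poly_Mapping.keys q" "m = a + b"
    using keys_mult[of p q] by blast
  then show "v \<in> mvars p \<union> mvars q" using m(2) keys_add[of a b] unfolding mvars_def by blast
qed

lemma mvars_power: "mvars (p ^ k) \<subseteq> mvars (p :: ('v, 'a::comm_ring_1) mpoly)"
proof (induction k)
  case (Suc k)
  then show ?case using mvars_mult[of p "p ^ k"] by auto
qed simp

lemma mvars_sum: "(\<And>i. i \<in> S \<Longrightarrow> mvars (f i) \<subseteq> W) \<Longrightarrow> mvars (sum f S) \<subseteq> W"
proof (induction S rule: infinite_finite_induct)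
  case (insert a S)
  then show ?case using mvars_add[of "f a" "sum f S"] by auto
qed auto

lemma meval_cong:
  assumes "\<And>v. v \<in> mvars p \<Longrightarrow> x v = y v"
  shows "meval g x p = meval g y p"
  unfolding meval_def mon_def
proof (intro sum.cong prod.cong arg_cong2[of _ _ _ _ "(*)"] refl)
  fix m v assume "m \<in> Poly_Mapping.keys p" "v \<in> Poly_Mapping.keys m"
  then have "v \<in> mvars p" unfolding mvars_def by auto
  then show "x v ^ Poly_Mapping.lookup m v = y v ^ Poly_Mapping.lookup m v" using assms by simp
qed

lemma meval_closed:
  fixes p :: "('v, 'a::comm_ring_1) mpoly" and P :: "'b::comm_ring_1 \<Rightarrow> bool"
  assumes "P 0" "P 1" "\<And>a b. P a \<Longrightarrow> P b \<Longrightarrow> P (a + b)" "\<And>a b. P a \<Longrightarrow> P b \<Longrightarrow> P (a * b)"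
    and "\<And>c. P (g c)" "\<And>v. v \<in> mvars p \<Longrightarrow> P (x v)"
  shows "P (meval g x p)"
proof -
  have pw: "P (a ^ k)" if "P a" for a k using that by (induction k) (auto intro: assms)
  have pr: "P (prod f S)" if "\<And>i. i \<in> S \<Longrightarrow> P (f i)" for f and S :: "'v set"
    using that by (induction S rule: infinite_finite_induct) (auto intro: assms)
  have su: "P (sum f S)" if "\<And>i. i \<in> S \<Longrightarrow> P (f i)" for f and S :: "('v \<Rightarrow>\<^sub>0 nat) set"
    using that by (induction S rule: infinite_finite_induct) (auto intro: assms)
  show ?thesis unfolding meval_def mon_def
    by (intro su assms(4) pr pw assms(5,6)) (auto simp: mvars_def)
qed

lemma meval_mconst_mvar [simp]: "meval mconst mvar p = p"
  using comm_ring_hom_eq_meval[OF comm_ring_hom_id, of p] by simp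

subsection \<open>One variable singled out\<close>

text \<open>The coefficients keep the type of polynomials in all variables although they do not
  involve v. Substituting v back is a left inverse, and a right inverse on polynomials with
  coefficients free of v.\<close>

definition toP :: "'v \<Rightarrow> ('v, 'a::comm_ring_1) mpoly \<Rightarrow> ('v, 'a) mpoly poly" where
  "toP v = meval (\<lambda>c. [:mconst c:]) (\<lambda>w. if w = v then [:0, 1:] else [:mvar w:])"

lemma poly_in_eq_toP:
  fixes f :: "('v, int) mpoly"
  shows "poly_in v f = toP v f"
proof -
  have "(of_int c :: ('v, int) mpoly poly) = [:mconst c:]" for c
  proof -
    have "mconst (of_int c :: int) = (of_int c :: ('v, int) mpoly)" by (rule single_of_int)
    then show ?thesis by (simp add: of_int_poly)
  qed
  then have "(of_int :: int \<Rightarrow> ('v, int) mpoly poly) = (\<lambda>c. [:mconst c:])" by (rule ext)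
  then show ?thesis unfolding poly_in_def toP_def mpoly_eval_eq_meval by simp
qed

lemma comm_ring_hom_toP: "comm_ring_hom (toP v)"
  unfolding toP_def
  by (intro mpoly_hom_meval comm_ring_hom_comp[OF comm_ring_hom_const_poly comm_ring_hom_mconst])

interpretation toP: comm_ring_hom "toP v" for v by (rule comm_ring_hom_toP)

interpretation toPc: mpoly_hom "\<lambda>c. [:mconst c:]"
  unfolding mpoly_hom_def by (rule comm_ring_hom_comp[OF comm_ring_hom_const_poly comm_ring_hom_mconst])

lemma toP_mconst [simp]: "toP v (mconst c) = [:mconst c:]"
  by (simp add: toP_def)

lemma toP_mvar: "toP v (mvar w) = (if w = v then [:0, 1:] else [:mvar w:])"
  by (simp add: toP_def)

lemma poly_toP [simp]: "poly (toP v p) (mvar v) = p"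
  by (rule mpoly_hom_ext[OF comm_ring_hom_comp[OF comm_ring_hom_poly comm_ring_hom_toP] comm_ring_hom_id])
     (simp_all add: toP_mvar)

lemma toP_inject [simp]: "toP v p = toP v q \<longleftrightarrow> p = q"
  by (metis poly_toP)

lemma toP_eq_0_iff [simp]: "toP v p = 0 \<longleftrightarrow> p = 0"
  using toP_inject[of v p 0] by simp

lemma toP_no_var:
  assumes "v \<notin> mvars p"
  shows "toP v p = [:p:]"
proof -
  have "toP v p = meval (\<lambda>c. [:mconst c:]) (\<lambda>w. [:mvar w:]) p"
    unfolding toP_def using assms by (intro meval_cong) auto
  also have "\<dots> = [:meval mconst mvar p:]"
    by (rule hom_meval[OF comm_ring_hom_const_poly comm_ring_hom_mconst, symmetric])
  finally show ?thesis by simp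
qed

lemma mvars_coeff_toP:
  fixes p :: "('v, 'a::comm_ring_1) mpoly"
  shows "mvars (coeff (toP v p) k) \<subseteq> mvars p - {v}"
proof -
  have "\<forall>k. mvars (coeff (toP v p) k) \<subseteq> mvars p - {v}"
    unfolding toP_def
  proof (rule meval_closed)
    fix a b :: "('v, 'a) mpoly poly"
    assume ab: "\<forall>k. mvars (coeff a k) \<subseteq> mvars p - {v}" "\<forall>k. mvars (coeff b k) \<subseteq> mvars p - {v}"
    show "\<forall>k. mvars (coeff (a + b) k) \<subseteq> mvars p - {v}"
    proof
      fix k show "mvars (coeff (a + b) k) \<subseteq> mvars p - {v}"
        using ab mvars_add[of "coeff a k" "coeff b k"] unfolding coeff_add by blast
    qed
    show "\<forall>k. mvars (coeff (a * b) k) \<subseteq> mvars p - {v}"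
    proof
      fix k show "mvars (coeff (a * b) k) \<subseteq> mvars p - {v}"
        unfolding coeff_mult using ab by (intro mvars_sum order_trans[OF mvars_mult] Un_least) blast+
    qed
  qed (auto simp: coeff_pCons one_pCons split: nat.splits)
  then show ?thesis by blast
qed

lemma toP_poly:
  assumes "\<And>k. v \<notin> mvars (coeff P k)"
  shows "toP v (poly P (mvar v)) = P"
  using assms
proof (induction P)
  case (pCons c P)
  have "v \<notin> mvars c" using pCons.prems[of 0] by simp
  moreover have "v \<notin> mvars (coeff P k)" for k using pCons.prems[of "Suc k"] by simp
  ultimately show ?case
    using pCons.IH by (simp add: toP.hom_add toP.hom_mult toP_no_var toP_mvar)
qed simp

definition vdeg :: "'v \<Rightarrow> ('v, 'a::comm_ring_1) mpoly \<Rightarrow> nat" where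
  "vdeg v p = degree (toP v p)"

lemma vdeg_eq_0_iff: "vdeg v p = 0 \<longleftrightarrow> v \<notin> mvars p"
proof
  assume "vdeg v p = 0"
  then obtain c where c: "toP v p = [:c:]" unfolding vdeg_def by (auto elim: degree_eq_zeroE)
  then have "p = c" using poly_toP[of v p] by simp
  then show "v \<notin> mvars p" using mvars_coeff_toP[of v p 0] c by auto
qed (simp add: vdeg_def toP_no_var)

lemma vdeg_mult:
  fixes p q :: "('v::linorder, 'a::idom) mpoly"
  assumes "p \<noteq> 0" "q \<noteq> 0"
  shows "vdeg v (p * q) = vdeg v p + vdeg v q"
  unfolding vdeg_def toP.hom_mult using assms by (intro degree_mult_eq) auto

text \<open>Degrees in each single variable add up, so no variable of a factor can cancel. Divisors
  therefore stay within the variables of the product.\<close>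

lemma mvars_mult_eq:
  fixes p q :: "('v::linorder, 'a::idom) mpoly"
  assumes "p \<noteq> 0" "q \<noteq> 0"
  shows "mvars (p * q) = mvars p \<union> mvars q"
proof -
  have k: "v \<in> mvars r \<longleftrightarrow> vdeg v r \<noteq> 0" for v and r :: "('v, 'a) mpoly"
    by (simp add: vdeg_eq_0_iff)
  show ?thesis by (rule Set.set_eqI) (simp add: k vdeg_mult[OF assms])
qed

lemma map_poly_const: "f 0 = 0 \<Longrightarrow> map_poly f [:a:] = [:f a:]"
  by (rule poly_eqI) (simp add: coeff_map_poly coeff_pCons split: nat.split)

lemma map_poly_linear: "f 0 = 0 \<Longrightarrow> map_poly f [:a, b:] = [:f a, f b:]"
  by (rule poly_eqI) (simp add: coeff_map_poly coeff_pCons split: nat.split)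

lemma meval_eq_poly_toP:
  assumes "comm_ring_hom g"
  shows "meval g x p = poly (map_poly (meval g x) (toP v p)) (x v)"
proof -
  interpret mpoly_hom g using assms by (simp add: mpoly_hom_def)
  show ?thesis
    by (rule mpoly_hom_ext[OF meval.comm_ring_hom_axioms
          comm_ring_hom_comp[OF comm_ring_hom_poly comm_ring_hom_comp[OF comm_ring_hom_map_poly[OF meval.comm_ring_hom_axioms] comm_ring_hom_toP]]])
       (simp_all add: toP_mvar map_poly_const map_poly_linear)
qed

lemma meval_upd_eq_poly_toP:
  assumes "comm_ring_hom g"
  shows "meval g (x(v := a)) p = poly (map_poly (meval g x) (toP v p)) a"
proof -
  interpret mpoly_hom g using assms by (simp add: mpoly_hom_def)
  have "meval g (x(v := a)) (coeff (toP v p) k) = meval g x (coeff (toP v p) k)" for k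
    using mvars_coeff_toP[of v p k] by (intro meval_cong) auto
  then have "map_poly (meval g (x(v := a))) (toP v p) = map_poly (meval g x) (toP v p)"
    by (intro poly_eqI) (simp add: coeff_map_poly)
  then show ?thesis using meval_eq_poly_toP[OF assms, of "x(v := a)" p v] by simp
qed

subsection \<open>Counting integer points in boxes\<close>

definition ev :: "('v \<Rightarrow> int) \<Rightarrow> ('v, int) mpoly \<Rightarrow> int" where
  "ev x p = meval (\<lambda>c. c) x p"

lemma comm_ring_hom_ev: "comm_ring_hom (ev x)"
  unfolding ev_def by (rule mpoly_hom_meval[OF comm_ring_hom_id])

interpretation ev: comm_ring_hom "ev x" for x by (rule comm_ring_hom_ev)

lemma ev_single: "ev x (Poly_Mapping.single m c) = c * mon x m"
  unfolding ev_def by (rule mpoly_hom.meval_single) (simp add: mpoly_hom_def comm_ring_hom_id)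

lemma ev_mconst [simp]: "ev x (mconst c) = c"
  by (simp add: ev_single)

lemma ev_mvar [simp]: "ev x (mvar v) = x v"
  unfolding mvar_def by (simp add: ev_single)

lemma ev_cong: "(\<And>v. v \<in> mvars p \<Longrightarrow> x v = y v) \<Longrightarrow> ev x p = ev y p"
  unfolding ev_def by (rule meval_cong)

lemma ev_upd_eq_poly_toP: "ev (x(v := a)) p = poly (map_poly (ev x) (toP v p)) a"
proof -
  have "ev x = meval (\<lambda>c. c) x" by (rule ext) (rule ev_def)
  then show ?thesis using meval_upd_eq_poly_toP[OF comm_ring_hom_id, of x v a p] by (simp only: ev_def)
qed

abbreviation evP :: "('v \<Rightarrow> int) \<Rightarrow> ('v, int) mpoly poly \<Rightarrow> int poly" where
  "evP x \<Phi> \<equiv> map_poly (ev x) \<Phi>"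

text \<open>Points are functions on all variables. Fixing the value 0 off V makes the box finite for
  finite V and lets V grow by one variable within a single type.\<close>

definition ibox :: "'v set \<Rightarrow> nat \<Rightarrow> ('v \<Rightarrow> int) set" where
  "ibox V N = {x. (\<forall>v\<in>V. \<bar>x v\<bar> \<le> int N) \<and> (\<forall>v. v \<notin> V \<longrightarrow> x v = 0)}"

lemma ibox_empty [simp]: "ibox {} N = {\<lambda>_. 0}"
  unfolding ibox_def by (auto simp: fun_eq_iff)

lemma ibox_insert:
  assumes "v \<notin> V"
  shows "ibox (insert v V) N = (\<lambda>(u, t). u(v := t)) ` (ibox V N \<times> {- int N..int N})"
proof
  show "ibox (insert v V) N \<subseteq> (\<lambda>(u, t). u(v := t)) ` (ibox V N \<times> {- int N..int N})"
  proof
    fix x assume x: "x \<in> ibox (insert v V) N"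
    have "x(v := 0) \<in> ibox V N" using x assms unfolding ibox_def by auto
    moreover have "x v \<in> {- int N..int N}" using x unfolding ibox_def by (auto simp: abs_le_iff)
    ultimately show "x \<in> (\<lambda>(u, t). u(v := t)) ` (ibox V N \<times> {- int N..int N})"
      by (intro image_eqI[of _ _ "(x(v := 0), x v)"]) auto
  qed
qed (use assms in \<open>auto simp: ibox_def abs_le_iff\<close>)

lemma finite_ibox: "finite V \<Longrightarrow> finite (ibox V N)"
  by (induction V rule: finite_induct) (auto simp: ibox_insert)

lemma card_ibox_le: "finite V \<Longrightarrow> card (ibox V N) \<le> (2 * N + 1) ^ card V"
proof (induction V rule: finite_induct)
  case (insert v V)
  have "card (ibox (insert v V) N) \<le> card (ibox V N \<times> {- int N..int N})"
    unfolding ibox_insert[OF insert(2)] by (intro card_image_le finite_cartesian_product finite_ibox insert) auto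
  also have "\<dots> = card (ibox V N) * (2 * N + 1)"
  proof -
    have "card {- int N..int N} = 2 * N + 1" by simp
    then show ?thesis by (simp only: card_cartesian_product)
  qed
  also have "\<dots> \<le> (2 * N + 1) ^ card V * (2 * N + 1)" using insert(3) by (rule mult_le_mono1)
  finally show ?case using insert by (simp add: mult.commute)
qed simp

lemma card_ibox_le_powr:
  assumes "finite V" "N \<ge> 1"
  shows "real (card (ibox V N)) \<le> 3 ^ card V * real N powr real (card V)"
proof -
  have "real (card (ibox V N)) \<le> real ((2 * N + 1) ^ card V)"
    using card_ibox_le[OF assms(1), of N] by (simp only: of_nat_le_iff)
  also have "\<dots> = real (2 * N + 1) ^ card V" by (rule of_nat_power)
  also have "\<dots> \<le> (3 * real N) ^ card V" using assms by (intro power_mono) auto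
  finally show ?thesis using assms by (simp add: power_mult_distrib powr_realpow)
qed

lemma card_ibox_insert_le:
  assumes "v \<notin> V" "finite V"
  shows "card {x \<in> ibox (insert v V) N. Q x} \<le> (\<Sum>u\<in>ibox V N. card {t. \<bar>t\<bar> \<le> int N \<and> Q (u(v := t))})"
proof -
  have fin: "finite {t. \<bar>t\<bar> \<le> int N \<and> Q (u(v := t))}" for u
    by (rule finite_subset[of _ "{- int N..int N}"]) auto
  have "{x \<in> ibox (insert v V) N. Q x} \<subseteq> (\<Union>u\<in>ibox V N. (\<lambda>t. u(v := t)) ` {t. \<bar>t\<bar> \<le> int N \<and> Q (u(v := t))})"
    unfolding ibox_insert[OF assms(1)] by (auto simp: abs_le_iff)
  then have "card {x \<in> ibox (insert v V) N. Q x} \<le> card (\<Union>u\<in>ibox V N. (\<lambda>t. u(v := t)) ` {t. \<bar>t\<bar> \<le> int N \<and> Q (u(v := t))})"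
    by (rule card_mono[rotated]) (intro finite_UN_I finite_ibox assms finite_imageI fin)
  also have "\<dots> \<le> (\<Sum>u\<in>ibox V N. card ((\<lambda>t. u(v := t)) ` {t. \<bar>t\<bar> \<le> int N \<and> Q (u(v := t))}))"
    by (rule card_UN_le[OF finite_ibox[OF assms(2)]])
  also have "\<dots> \<le> (\<Sum>u\<in>ibox V N. card {t. \<bar>t\<bar> \<le> int N \<and> Q (u(v := t))})"
    by (intro sum_mono card_image_le fin)
  finally show ?thesis .
qed

text \<open>Counting along the lines in direction v: a bad base point may spoil its whole line of 2N
  + 1 \<le> 3N points, any other line contributes at most b.\<close>

lemma card_slices_le:
  assumes "v \<notin> V" "finite V" "N \<ge> 1" "b \<ge> 0"
    and slice: "\<And>u. u \<in> ibox V N \<Longrightarrow> \<not> Bad u \<Longrightarrow> real (card {t. \<bar>t\<bar> \<le> int N \<and> Q (u(v := t))}) \<le> b"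
  shows "real (card {x \<in> ibox (insert v V) N. Q x})
       \<le> 3 * real N * real (card {u \<in> ibox V N. Bad u}) + 3 ^ card V * real N powr real (card V) * b"
proof -
  have fin: "finite (ibox V N)" by (rule finite_ibox[OF assms(2)])
  have triv: "real (card {t. \<bar>t\<bar> \<le> int N \<and> Q (u(v := t))}) \<le> 3 * real N" for u
  proof -
    have "card {t. \<bar>t\<bar> \<le> int N \<and> Q (u(v := t))} \<le> card {- int N..int N}" by (intro card_mono) auto
    also have "\<dots> = 2 * N + 1" by simp
    finally show ?thesis using assms(3) by linarith
  qed
  have "real (card {x \<in> ibox (insert v V) N. Q x}) \<le> real (\<Sum>u\<in>ibox V N. card {t. \<bar>t\<bar> \<le> int N \<and> Q (u(v := t))})"
    using card_ibox_insert_le[OF assms(1,2), of N Q] by (simp only: of_nat_le_iff)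
  also have "\<dots> = (\<Sum>u\<in>ibox V N. real (card {t. \<bar>t\<bar> \<le> int N \<and> Q (u(v := t))}))" by simp
  also have "\<dots> \<le> (\<Sum>u\<in>ibox V N. (if Bad u then 3 * real N else 0) + b)"
    using triv slice assms(4) by (intro sum_mono) (simp add: add_increasing2)
  also have "\<dots> = (\<Sum>u\<in>ibox V N. if Bad u then 3 * real N else 0) + real (card (ibox V N)) * b"
    by (simp add: sum.distrib)
  also have "(\<Sum>u\<in>ibox V N. if Bad u then 3 * real N else 0) = 3 * real N * real (card {u \<in> ibox V N. Bad u})"
    using sum.inter_filter[OF fin, of "\<lambda>_. 3 * real N" Bad, symmetric] by (simp add: mult.commute)
  also have "real (card (ibox V N)) * b \<le> 3 ^ card V * real N powr real (card V) * b"
    by (intro mult_right_mono card_ibox_le_powr assms)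
  finally show ?thesis by simp
qed

lemma mvars_empty_imp_mconst:
  assumes "mvars p = {}"
  shows "p = mconst (Poly_Mapping.lookup p 0)"
proof (rule poly_mapping_eqI)
  fix m
  have "m = 0" if "m \<in> Poly_Mapping.keys p"
  proof -
    have "Poly_Mapping.keys m = {}" using that assms unfolding mvars_def by auto
    then show ?thesis by simp
  qed
  then show "Poly_Mapping.lookup p m = Poly_Mapping.lookup (mconst (Poly_Mapping.lookup p 0)) m"
    by (auto simp: lookup_single when_def in_keys_iff)
qed

text \<open>A line on which the leading coefficient in v survives carries at most as many zeros as
  the degree; the base points where it vanishes are counted by induction.\<close>

lemma zeros_count:
  assumes "finite V" "mvars p \<subseteq> V" "p \<noteq> 0"
  shows "\<exists>C\<ge>0. \<forall>N\<ge>1. real (card {x \<in> ibox V N. ev x p = 0}) \<le> C * real N powr (real (card V) - 1)"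
  using assms
proof (induction V arbitrary: p rule: finite_induct)
  case empty
  then have "p = mconst (Poly_Mapping.lookup p 0)" by (intro mvars_empty_imp_mconst) auto
  moreover have "Poly_Mapping.lookup p 0 \<noteq> 0" using empty calculation by auto
  ultimately have "ev x p \<noteq> 0" for x using ev_single[of x 0 "Poly_Mapping.lookup p 0"] by simp
  then have "{x \<in> ibox {} N. ev x p = 0} = {}" for N by blast
  then show ?case by (intro exI[of _ 0]) simp
next
  case (insert v V)
  define c where "c = lead_coeff (toP v p)"
  define d where "d = degree (toP v p)"
  have c0: "c \<noteq> 0" unfolding c_def using insert.prems by simp
  have "mvars c \<subseteq> V" using mvars_coeff_toP[of v p] insert.prems unfolding c_def by blast
  from insert.IH[OF this c0] obtain C where C: "C \<ge> 0"
    "\<And>N. N \<ge> 1 \<Longrightarrow> real (card {x \<in> ibox V N. ev x c = 0}) \<le> C * real N powr (real (card V) - 1)" by auto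
  let ?k = "card V"
  show ?case
  proof (intro exI[of _ "3 * C + 3 ^ ?k * real d"] conjI allI impI)
    show "0 \<le> 3 * C + 3 ^ ?k * real d" using C by simp
    fix N :: nat assume N: "N \<ge> 1"
    have "real (card {x \<in> ibox (insert v V) N. ev x p = 0})
       \<le> 3 * real N * real (card {u \<in> ibox V N. ev u c = 0}) + 3 ^ ?k * real N powr real ?k * real d"
    proof (rule card_slices_le[OF insert(2,1) N])
      fix u assume u: "u \<in> ibox V N" "\<not> ev u c = 0"
      let ?q = "map_poly (ev u) (toP v p)"
      have "coeff ?q d \<noteq> 0" using u(2) unfolding c_def d_def by (simp add: coeff_map_poly)
      then have q0: "?q \<noteq> 0" by (intro notI) (simp only: coeff_0)
      have "{t. \<bar>t\<bar> \<le> int N \<and> ev (u(v := t)) p = 0} \<subseteq> {t. poly ?q t = 0}"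
        using ev_upd_eq_poly_toP[of u v _ p] by auto
      then have "card {t. \<bar>t\<bar> \<le> int N \<and> ev (u(v := t)) p = 0} \<le> card {t. poly ?q t = 0}"
        by (intro card_mono poly_roots_finite q0)
      also have "\<dots> \<le> degree ?q" by (rule card_poly_roots_bound[OF q0])
      also have "\<dots> \<le> d" unfolding d_def by (rule degree_map_poly_le)
      finally show "real (card {t. \<bar>t\<bar> \<le> int N \<and> ev (u(v := t)) p = 0}) \<le> real d" by simp
    qed simp
    also have "3 * real N * real (card {u \<in> ibox V N. ev u c = 0}) \<le> 3 * real N * (C * real N powr (real ?k - 1))"
      by (intro mult_left_mono C(2) N) simp
    also have "\<dots> = 3 * C * (real N powr 1 * real N powr (real ?k - 1))" using N by simp
    also have "\<dots> = 3 * C * real N powr real ?k" unfolding powr_add[symmetric] by simp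
    finally show "real (card {x \<in> ibox (insert v V) N. ev x p = 0})
        \<le> (3 * C + 3 ^ ?k * real d) * real N powr (real (card (insert v V)) - 1)"
      using insert by (simp add: algebra_simps)
  qed
qed

lemma abs_ev_le:
  shows "\<exists>K C. \<forall>N\<ge>1. \<forall>u. (\<forall>v. \<bar>u v\<bar> \<le> int N) \<longrightarrow> \<bar>ev u p\<bar> \<le> int (K * N ^ C)"
proof (induction p rule: mpoly_induct)
  case (single m c)
  show ?case
  proof (rule exI[of _ "nat \<bar>c\<bar>"], rule exI[of _ "\<Sum>v\<in>Poly_Mapping.keys m. Poly_Mapping.lookup m v"], intro allI impI)
    fix N :: nat and u :: "'a \<Rightarrow> int" assume N: "N \<ge> 1" and u: "\<forall>v. \<bar>u v\<bar> \<le> int N"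
    have "\<bar>mon u m\<bar> \<le> (\<Prod>v\<in>Poly_Mapping.keys m. int N ^ Poly_Mapping.lookup m v)"
      unfolding mon_def abs_prod using u by (intro prod_mono) (auto simp: power_abs intro!: power_mono)
    also have "\<dots> = int N ^ (\<Sum>v\<in>Poly_Mapping.keys m. Poly_Mapping.lookup m v)" by (simp add: power_sum)
    finally have "\<bar>c\<bar> * \<bar>mon u m\<bar> \<le> \<bar>c\<bar> * int N ^ (\<Sum>v\<in>Poly_Mapping.keys m. Poly_Mapping.lookup m v)"
      by (rule mult_left_mono) simp
    then show "\<bar>ev u (Poly_Mapping.single m c)\<bar> \<le> int (nat \<bar>c\<bar> * N ^ (\<Sum>v\<in>Poly_Mapping.keys m. Poly_Mapping.lookup m v))"
      by (simp add: abs_mult ev_single)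
  qed
next
  case (add p q)
  then obtain K1 C1 K2 C2 where
    1: "\<And>N u. N \<ge> 1 \<Longrightarrow> (\<forall>v. \<bar>u v\<bar> \<le> int N) \<Longrightarrow> \<bar>ev u p\<bar> \<le> int (K1 * N ^ C1)" and
    2: "\<And>N u. N \<ge> 1 \<Longrightarrow> (\<forall>v. \<bar>u v\<bar> \<le> int N) \<Longrightarrow> \<bar>ev u q\<bar> \<le> int (K2 * N ^ C2)" by blast
  show ?case
  proof (rule exI[of _ "K1 + K2"], rule exI[of _ "C1 + C2"], intro allI impI)
    fix N :: nat and u :: "'a \<Rightarrow> int" assume N: "N \<ge> 1" and u: "\<forall>v. \<bar>u v\<bar> \<le> int N"
    have "K1 * N ^ C1 \<le> K1 * N ^ (C1 + C2)" "K2 * N ^ C2 \<le> K2 * N ^ (C1 + C2)"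
      using N by (auto intro!: mult_left_mono power_increasing)
    then have "K1 * N ^ C1 + K2 * N ^ C2 \<le> (K1 + K2) * N ^ (C1 + C2)"
      unfolding distrib_right by (rule add_mono)
    then have "int (K1 * N ^ C1) + int (K2 * N ^ C2) \<le> int ((K1 + K2) * N ^ (C1 + C2))"
      unfolding of_nat_add[symmetric] by (simp only: of_nat_le_iff)
    then show "\<bar>ev u (p + q)\<bar> \<le> int ((K1 + K2) * N ^ (C1 + C2))"
      using 1[OF N u] 2[OF N u] unfolding ev.hom_add by linarith
  qed
qed

lemma abs_ev_le_finite:
  assumes "finite S"
  shows "\<exists>K C. \<forall>p\<in>S. \<forall>N\<ge>1. \<forall>u. (\<forall>v. \<bar>u v\<bar> \<le> int N) \<longrightarrow> \<bar>ev u p\<bar> \<le> int (K * N ^ C)"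
  using assms
proof (induction S rule: finite_induct)
  case (insert p S)
  obtain K1 C1 where
    1: "\<And>N u. N \<ge> 1 \<Longrightarrow> (\<forall>v. \<bar>u v\<bar> \<le> int N) \<Longrightarrow> \<bar>ev u p\<bar> \<le> int (K1 * N ^ C1)" using abs_ev_le[of p] by blast
  obtain K2 C2 where
    2: "\<And>q N u. q \<in> S \<Longrightarrow> N \<ge> 1 \<Longrightarrow> (\<forall>v. \<bar>u v\<bar> \<le> int N) \<Longrightarrow> \<bar>ev u q\<bar> \<le> int (K2 * N ^ C2)" using insert.IH by blast
  show ?case
  proof (rule exI[of _ "K1 + K2"], rule exI[of _ "C1 + C2"], intro ballI allI impI)
    fix q and N :: nat and u :: "'a \<Rightarrow> int"
    assume q: "q \<in> insert p S" and N: "N \<ge> 1" and u: "\<forall>v. \<bar>u v\<bar> \<le> int N"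
    have "K1 * N ^ C1 \<le> (K1 + K2) * N ^ (C1 + C2)" "K2 * N ^ C2 \<le> (K1 + K2) * N ^ (C1 + C2)"
      using N by (auto intro!: mult_mono power_increasing)
    then have "int (K1 * N ^ C1) \<le> int ((K1 + K2) * N ^ (C1 + C2))" "int (K2 * N ^ C2) \<le> int ((K1 + K2) * N ^ (C1 + C2))"
      by (simp_all only: of_nat_le_iff)
    then show "\<bar>ev u q\<bar> \<le> int ((K1 + K2) * N ^ (C1 + C2))"
      using q 1[OF N u] 2[OF _ N u, of q] by (metis insertE order_trans)
  qed
qed simp

subsection \<open>Integer roots of monic polynomials over a polynomial ring\<close>

lemma monic_nonzero: "lead_coeff p = (1::'a::comm_ring_1) \<Longrightarrow> p \<noteq> 0"
  by auto

text \<open>If deg \<rho> exceeded E, the leading term \<rho>^d of the monic equation would have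
  larger degree than all other terms.\<close>

lemma degree_root_le:
  fixes \<Phi> :: "int poly poly"
  assumes monic: "lead_coeff \<Phi> = 1" and E: "\<And>k. degree (coeff \<Phi> k) \<le> E" and root: "poly \<Phi> \<rho> = 0"
  shows "degree \<rho> \<le> E"
proof (rule ccontr)
  assume gt: "\<not> degree \<rho> \<le> E"
  let ?d = "degree \<Phi>"
  have "poly \<Phi> \<rho> = (\<Sum>k<?d. coeff \<Phi> k * \<rho> ^ k) + \<rho> ^ ?d"
    using monic by (simp add: poly_altdef lessThan_Suc_atMost[symmetric])
  then have e: "\<rho> ^ ?d = - (\<Sum>k<?d. coeff \<Phi> k * \<rho> ^ k)" using root by (simp add: eq_neg_iff_add_eq_0 add.commute)
  have d0: "?d > 0"
  proof (rule ccontr)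
    assume "\<not> ?d > 0"
    then show False using e by simp
  qed
  have "?d * degree \<rho> = degree (\<rho> ^ ?d)" using gt by (subst degree_power_eq) auto
  also have "\<dots> = degree (\<Sum>k<?d. coeff \<Phi> k * \<rho> ^ k)" unfolding e by simp
  also have "\<dots> \<le> E + (?d - 1) * degree \<rho>"
  proof (rule degree_sum_le)
    fix k assume "k \<in> {..<?d}"
    have "degree (coeff \<Phi> k * \<rho> ^ k) \<le> degree (coeff \<Phi> k) + degree (\<rho> ^ k)" by (rule degree_mult_le)
    also have "\<dots> \<le> E + degree \<rho> * k" by (intro add_mono E degree_power_le)
    also have "\<dots> \<le> E + (?d - 1) * degree \<rho>"     proof -
      have "k \<le> ?d - 1" using \<open>k \<in> {..<?d}\<close> by auto
      then show ?thesis by (simp add: mult.commute mult_le_mono)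
    qed
    finally show "degree (coeff \<Phi> k * \<rho> ^ k) \<le> E + (?d - 1) * degree \<rho>" .
  qed simp
  also have "\<dots> < degree \<rho> + (?d - 1) * degree \<rho>" using gt by simp
  also have "\<dots> = ?d * degree \<rho>" using d0 by (cases ?d) auto
  finally show False by simp
qed

text \<open>Lagrange's basis for the nodes 0, ..., E without its denominators. The omitted
  denominator is \<open>lagr_c\<close>, the value at the node j itself.\<close>

definition lagr :: "nat \<Rightarrow> nat \<Rightarrow> int poly" where
  "lagr E j = (\<Prod>i\<in>{..E} - {j}. [:- int i, 1:])"

definition lagr_c :: "nat \<Rightarrow> nat \<Rightarrow> int" where
  "lagr_c E j = (\<Prod>i\<in>{..E} - {j}. int j - int i)"

lemma lagr_c_nonzero: "lagr_c E j \<noteq> 0"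
  unfolding lagr_c_def by auto

lemma lagrange_interpolation:
  fixes \<rho> :: "int poly"
  assumes "degree \<rho> \<le> E"
  shows "smult (\<Prod>i\<le>E. lagr_c E i) \<rho>
     = (\<Sum>j\<le>E. smult ((\<Prod>i\<in>{..E} - {j}. lagr_c E i) * poly \<rho> (int j)) (lagr E j))"
proof -
  let ?c = "\<Prod>i\<le>E. lagr_c E i"
  let ?P = "smult ?c \<rho> - (\<Sum>j\<le>E. smult ((\<Prod>i\<in>{..E} - {j}. lagr_c E i) * poly \<rho> (int j)) (lagr E j))"
  have dl: "degree (lagr E j) \<le> E" if "j \<le> E" for j
  proof -
    have "degree (lagr E j) \<le> sum (degree \<circ> (\<lambda>i. [:- int i, 1:])) ({..E} - {j})"
      unfolding lagr_def by (rule degree_prod_sum_le) simp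
    also have "\<dots> = card ({..E} - {j})" by simp
    also have "\<dots> = E" using that by (simp add: card_Diff_singleton)
    finally show ?thesis .
  qed
  have deg: "degree ?P \<le> E"
    by (intro degree_diff_le degree_sum_le order_trans[OF degree_smult_le] assms dl) auto
  have at: "poly (lagr E j) (int k) = (if j = k then lagr_c E j else 0)" if "k \<le> E" for j k
  proof (cases "j = k")
    case True
    then show ?thesis unfolding lagr_def lagr_c_def by (simp add: poly_prod)
  next
    case False
    then have "\<exists>i\<in>{..E} - {j}. poly [:- int i, 1:] (int k) = 0" using that by (intro bexI[of _ k]) auto
    then have "poly (lagr E j) (int k) = 0" unfolding lagr_def poly_prod by (intro prod_zero) auto
    then show ?thesis using False by simp
  qed
  have zero: "poly ?P (int k) = 0" if "k \<le> E" for k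
  proof -
    have "(\<Sum>j\<le>E. ((\<Prod>i\<in>{..E} - {j}. lagr_c E i) * poly \<rho> (int j)) * poly (lagr E j) (int k))
        = (\<Sum>j\<in>{k}. ((\<Prod>i\<in>{..E} - {j}. lagr_c E i) * poly \<rho> (int j)) * poly (lagr E j) (int k))"
      using that at by (intro sum.mono_neutral_right) auto
    also have "\<dots> = (lagr_c E k * (\<Prod>i\<in>{..E} - {k}. lagr_c E i)) * poly \<rho> (int k)" using at[OF that, of k] by simp
    also have "lagr_c E k * (\<Prod>i\<in>{..E} - {k}. lagr_c E i) = ?c" using that by (intro prod.remove[symmetric]) auto
    finally show ?thesis by (simp add: poly_sum)
  qed
  have "?P = 0"
  proof (rule ccontr)
    assume "?P \<noteq> 0"
    have "card (int ` {..E}) \<le> card {x. poly ?P x = 0}"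
      using zero by (intro card_mono poly_roots_finite[OF \<open>?P \<noteq> 0\<close>]) auto
    also have "\<dots> \<le> degree ?P" by (rule card_poly_roots_bound[OF \<open>?P \<noteq> 0\<close>])
    also have "\<dots> \<le> E" by (rule deg)
    finally show False by (simp add: card_image)
  qed
  then show ?thesis by simp
qed

definition subst_var :: "'v \<Rightarrow> int \<Rightarrow> ('v, int) mpoly \<Rightarrow> ('v, int) mpoly" where
  "subst_var v j = meval mconst (mvar(v := mconst j))"

lemma comm_ring_hom_subst_var: "comm_ring_hom (subst_var v j)"
  unfolding subst_var_def by (intro mpoly_hom_meval comm_ring_hom_mconst)

interpretation subst_var: comm_ring_hom "subst_var v j" for v j by (rule comm_ring_hom_subst_var)

lemma subst_var_mconst: "subst_var v j (mconst c) = mconst c"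
  unfolding subst_var_def using mpoly_hom.meval_single[of mconst "mvar(v := mconst j)" 0 c]
  by (simp add: mpoly_hom_def comm_ring_hom_mconst)

lemma subst_var_mvar: "subst_var v j (mvar w) = (if w = v then mconst j else mvar w)"
  unfolding subst_var_def using mpoly_hom.meval_mvar[of mconst "mvar(v := mconst j)" w]
  by (simp add: mpoly_hom_def comm_ring_hom_mconst)

lemma mvars_subst_var: "mvars (subst_var v j p) \<subseteq> mvars p - {v}"
  unfolding subst_var_def
proof (rule meval_closed)
  fix a b :: "('a, int) mpoly"
  assume "mvars a \<subseteq> mvars p - {v}" "mvars b \<subseteq> mvars p - {v}"
  then show "mvars (a + b) \<subseteq> mvars p - {v}" "mvars (a * b) \<subseteq> mvars p - {v}"
    using mvars_add[of a b] mvars_mult[of a b] by blast+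
qed auto

lemma ev_subst_var: "ev u (subst_var v j p) = ev (u(v := j)) p"
  by (rule mpoly_hom_ext[OF comm_ring_hom_comp[OF comm_ring_hom_ev comm_ring_hom_subst_var] comm_ring_hom_ev])
     (simp_all add: subst_var_mconst subst_var_mvar)

lemma monic_map_poly:
  assumes "lead_coeff \<Phi> = 1" "f 0 = 0" "f 1 = 1"
  shows "degree (map_poly f \<Phi>) = degree \<Phi>" "lead_coeff (map_poly f \<Phi>) = (1::'a::comm_ring_1)"
proof -
  have "coeff (map_poly f \<Phi>) (degree \<Phi>) = 1" using assms by (simp add: coeff_map_poly)
  then have "degree \<Phi> \<le> degree (map_poly f \<Phi>)" by (intro le_degree) simp
  then show e: "degree (map_poly f \<Phi>) = degree \<Phi>" using degree_map_poly_le[of f \<Phi>] by simp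
  show "lead_coeff (map_poly f \<Phi>) = 1" unfolding e by fact
qed

text \<open>For most points, the integer roots of a monic polynomial over \<open>\<int>[V]\<close> are values of finitely many
  polynomials. The induction specializes a variable to \<open>0, \<dots>, E\<close>; on a line, a root is given by a
  polynomial of degree at most \<open>E\<close> by the count on curves, which interpolation recovers.\<close>

lemma integer_roots_covered:
  fixes \<Phi> :: "('v, int) mpoly poly" and \<epsilon> :: real
  assumes "finite V" "lead_coeff \<Phi> = 1" "\<And>k. mvars (coeff \<Phi> k) \<subseteq> V" "\<epsilon> > 0"
  shows "\<exists>q R C. q \<noteq> 0 \<and> finite R \<and> (\<forall>r\<in>R. mvars r \<subseteq> V) \<and> C \<ge> 0 \<and>
     (\<forall>N\<ge>1. real (card {x \<in> ibox V N. \<exists>z. poly (evP x \<Phi>) z = 0 \<and> (\<forall>r\<in>R. q * z \<noteq> ev x r)})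
        \<le> C * real N powr (real (card V) - 1/2 + \<epsilon>))"
  using assms(1-3)
proof (induction V arbitrary: \<Phi> rule: finite_induct)
  case empty
  let ?S = "{z. poly (evP (\<lambda>_. 0) \<Phi>) z = 0}"
  have "evP (\<lambda>_. 0) \<Phi> \<noteq> 0"
    by (rule monic_nonzero, rule monic_map_poly(2)[OF empty(1)]) auto
  then have "finite ?S" by (rule poly_roots_finite)
  moreover have "{x \<in> ibox {} N. \<exists>z. poly (evP x \<Phi>) z = 0 \<and> (\<forall>r\<in>mconst ` ?S. 1 * z \<noteq> ev x r)} = {}" for N
    by auto
  ultimately show ?case
    by (intro exI[of _ 1] exI[of _ "mconst ` ?S"] exI[of _ 0]) auto
next
  case (insert v V)
  note monic = insert.prems(1)
  define d where "d = degree \<Phi>"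
  define E where "E = Max ((\<lambda>k. degree (toP v (coeff \<Phi> k))) ` {..d})"
  have degE: "degree (toP v (coeff \<Phi> k)) \<le> E" for k
  proof (cases "k \<le> d")
    case True
    then show ?thesis unfolding E_def by (intro Max_ge) auto
  qed (simp add: coeff_eq_0 d_def)
  define \<Phi>j where "\<Phi>j j = map_poly (subst_var v (int j)) \<Phi>" for j :: nat
  have m1: "lead_coeff (\<Phi>j j) = 1" for j
    unfolding \<Phi>j_def by (rule monic_map_poly[OF monic]) auto
  have m2: "mvars (coeff (\<Phi>j j) k) \<subseteq> V" for j k
    using mvars_subst_var[of v "int j" "coeff \<Phi> k"] insert.prems(2)[of k] unfolding \<Phi>j_def
    by (auto simp: coeff_map_poly)
  define IHP where "IHP j T \<longleftrightarrow> fst T \<noteq> 0 \<and> finite (fst (snd T)) \<and> (\<forall>r\<in>fst (snd T). mvars r \<subseteq> V) \<and> snd (snd T) \<ge> 0 \<and>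
     (\<forall>N\<ge>1. real (card {x \<in> ibox V N. \<exists>z. poly (evP x (\<Phi>j j)) z = 0 \<and> (\<forall>r\<in>fst (snd T). fst T * z \<noteq> ev x r)})
        \<le> snd (snd T) * real N powr (real (card V) - 1/2 + \<epsilon>))" for j and T :: "int \<times> ('v, int) mpoly set \<times> real"
  have "\<exists>T. IHP j T" for j
  proof -
    from insert.IH[OF m1 m2, of j] obtain q R C where "IHP j (q, R, C)" unfolding IHP_def fst_conv snd_conv by blast
    then show ?thesis by blast
  qed
  note ex = this
  define T where "T j = (SOME T. IHP j T)" for j
  have T: "IHP j (T j)" for j unfolding T_def by (rule someI_ex[OF ex])
  define q R C where "q j = fst (T j)" and "R j = fst (snd (T j))" and "C j = snd (snd (T j))" for j
  note T' = T[unfolded IHP_def, folded q_def R_def C_def]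
  have q0: "q j \<noteq> 0" for j by (rule T'[THEN conjunct1])
  have finR: "finite (R j)" for j by (rule T'[THEN conjunct2, THEN conjunct1])
  have RV: "r \<in> R j \<Longrightarrow> mvars r \<subseteq> V" for j r
    by (rule T'[THEN conjunct2, THEN conjunct2, THEN conjunct1, rule_format])
  have C0: "C j \<ge> 0" for j by (rule T'[THEN conjunct2, THEN conjunct2, THEN conjunct2, THEN conjunct1])
  have IH: "N \<ge> 1 \<Longrightarrow> real (card {x \<in> ibox V N. \<exists>z. poly (evP x (\<Phi>j j)) z = 0 \<and> (\<forall>r\<in>R j. q j * z \<noteq> ev x r)})
        \<le> C j * real N powr (real (card V) - 1/2 + \<epsilon>)" for j N
    by (rule T'[THEN conjunct2, THEN conjunct2, THEN conjunct2, THEN conjunct2, rule_format])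
  \<comment> \<open>The plane curve over the line through u in direction v: the outer variable is z,
    the inner one is the value of v.\<close>
  define Sl where "Sl u = map_poly (\<lambda>p. map_poly (ev u) (toP v p)) \<Phi>" for u :: "'v \<Rightarrow> int"
  have Sl_coeff: "coeff (Sl u) k = map_poly (ev u) (toP v (coeff \<Phi> k))" for u k
    unfolding Sl_def by (simp add: coeff_map_poly)
  have Sl_monic: "lead_coeff (Sl u) = 1" "degree (Sl u) = d" for u
    unfolding Sl_def d_def by (rule monic_map_poly[OF monic]; simp)+
  have Sl_ev: "evT t (Sl u) = evP (u(v := t)) \<Phi>" for u t
    by (rule poly_eqI) (simp add: coeff_map_poly Sl_coeff ev_upd_eq_poly_toP)
  have Sl_deg: "degree (coeff (Sl u) k) \<le> E" for u k
    unfolding Sl_coeff using degE[of k] degree_map_poly_le[of "ev u" "toP v (coeff \<Phi> k)"] by linarith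
  \<comment> \<open>There are infinitely many slices, but their coefficients are values at u of
    these finitely many polynomials, hence bounded by K0 N^Ce uniformly in u.\<close>
  define cs where "cs = (\<lambda>(k, j). coeff (toP v (coeff \<Phi> k)) j) ` ({..d} \<times> {..E})"
  have "finite cs" unfolding cs_def by simp
  from abs_ev_le_finite[OF this] obtain K0 Ce where
    K0: "\<And>p N u. p \<in> cs \<Longrightarrow> N \<ge> 1 \<Longrightarrow> (\<forall>v. \<bar>u v\<bar> \<le> int N) \<Longrightarrow> \<bar>ev u p\<bar> \<le> int (K0 * N ^ Ce)" by blast
  have Sl_ht: "\<bar>coeff (coeff (Sl u) k) j\<bar> \<le> int (K0 * N ^ Ce)" if "N \<ge> 1" "u \<in> ibox V N" for u N k j
  proof (cases "k \<le> d \<and> j \<le> E")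
    case True
    then have "coeff (toP v (coeff \<Phi> k)) j \<in> cs" unfolding cs_def by force
    moreover have "\<forall>v. \<bar>u v\<bar> \<le> int N"
    proof
      fix w show "\<bar>u w\<bar> \<le> int N" using that(2) unfolding ibox_def by (cases "w \<in> V") auto
    qed
    ultimately show ?thesis using K0[of _ N u] that(1) by (simp add: Sl_coeff coeff_map_poly)
  next
    case False
    then have "coeff (coeff (Sl u) k) j = 0"
      using Sl_deg[of u k] Sl_monic(2)[of u] by (auto simp: coeff_eq_0 not_le)
    then show ?thesis by simp
  qed
  obtain K where K0': "K \<ge> 0" and K: "\<And>N \<Phi>. N \<ge> 1 \<Longrightarrow> lead_coeff \<Phi> = 1 \<Longrightarrow> degree \<Phi> = d \<Longrightarrow> (\<And>k. degree (coeff \<Phi> k) \<le> E) \<Longrightarrow>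
     (\<And>k j. \<bar>coeff (coeff \<Phi> k) j\<bar> \<le> int (K0 * N ^ Ce)) \<Longrightarrow>
     real (card {t. \<bar>t\<bar> \<le> int N \<and> (\<exists>z. poly (evT t \<Phi>) z = 0 \<and> (\<forall>\<rho>. poly \<Phi> \<rho> = 0 \<longrightarrow> z \<noteq> poly \<rho> t))})
       \<le> K * real N powr (1/2 + \<epsilon>)"
    using curve_count[OF assms(4), of d E K0 Ce] by blast
  \<comment> \<open>Two kinds of denominators are cleared together: those of the interpolation and
    the q j of the covers at the nodes. The j-th of each kind is left out because
    \<open>lagr E j\<close> and the value q j \<rho>(j) already carry it.\<close>
  define e where "e j = (\<Prod>i\<in>{..E} - {j}. lagr_c E i) * (\<Prod>i\<in>{..E} - {j}. q i)" for j
  define Q where "Q = (\<Prod>i\<le>E. lagr_c E i) * (\<Prod>i\<le>E. q i)"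
  define L where "L j = poly (map_poly mconst (lagr E j)) (mvar v)" for j
  \<comment> \<open>One candidate for each choice of a covering polynomial at every node: Q times
    the interpolation of the chosen values.\<close>
  define RR where "RR = (\<lambda>c. \<Sum>j\<le>E. mconst (e j) * c j * L j) ` (\<Pi>\<^sub>E j\<in>{..E}. R j)"
  have evL: "ev (u(v := t)) (L j) = poly (lagr E j) t" for u t j
  proof -
    interpret mc: map_poly_comm_ring_hom "mconst :: int \<Rightarrow> ('v, int) mpoly"
      by (simp add: map_poly_comm_ring_hom_def comm_ring_hom_mconst)
    have "ev x (poly (map_poly mconst P) (mvar v)) = poly P (x v)" for P and x :: "'v \<Rightarrow> int"
      by (induction P) (simp_all add: mc.base.map_poly_pCons_hom ev.hom_add ev.hom_mult)
    then show ?thesis unfolding L_def by simp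
  qed
  have mL: "mvars (L j) \<subseteq> insert v V" for j
  proof -
    have "mvars (poly (map_poly mconst P) (mvar v)) \<subseteq> {v}" for P :: "int poly"
    proof -
      have "mvars (coeff (map_poly mconst P) k * mvar v ^ k) \<subseteq> {v}" for k
        using mvars_mult[of "coeff (map_poly mconst P) k" "mvar v ^ k"] mvars_power[of "mvar v :: ('v, int) mpoly" k]
        by (auto simp: coeff_map_poly)
      then show ?thesis unfolding poly_altdef by (intro mvars_sum)
    qed
    then show ?thesis unfolding L_def by blast
  qed
  define bad where "bad j u \<longleftrightarrow> (\<exists>z. poly (evP u (\<Phi>j j)) z = 0 \<and> (\<forall>r\<in>R j. q j * z \<noteq> ev u r))" for j u
  let ?Bad = "\<lambda>x. \<exists>z. poly (evP x \<Phi>) z = 0 \<and> (\<forall>r\<in>RR. Q * z \<noteq> ev x r)"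
  \<comment> \<open>Over a base point that is good at all nodes, a root on a component z = \<rho>(t)
    is covered: the integers \<rho>(j) are roots at the nodes, hence covered there, and
    interpolation yields Q z. So an uncovered root lies on no polynomial component, which is the
    situation counted by \<open>curve_count\<close>.\<close>
  have slice: "{t. \<bar>t\<bar> \<le> int N \<and> ?Bad (u(v := t))}
      \<subseteq> {t. \<bar>t\<bar> \<le> int N \<and> (\<exists>z. poly (evT t (Sl u)) z = 0 \<and> (\<forall>\<rho>. poly (Sl u) \<rho> = 0 \<longrightarrow> z \<noteq> poly \<rho> t))}"
    if u: "u \<in> ibox V N" and nb: "\<not> (\<exists>j\<in>{..E}. bad j u)" for u N
  proof
    fix t assume t: "t \<in> {t. \<bar>t\<bar> \<le> int N \<and> ?Bad (u(v := t))}"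
    then obtain z where z: "poly (evP (u(v := t)) \<Phi>) z = 0" and nz: "\<forall>r\<in>RR. Q * z \<noteq> ev (u(v := t)) r" by blast
    have "z \<noteq> poly \<rho> t" if rho: "poly (Sl u) \<rho> = 0" for \<rho>
    proof
      assume zr: "z = poly \<rho> t"
      have drho: "degree \<rho> \<le> E" by (rule degree_root_le[OF Sl_monic(1) Sl_deg rho])
      have "\<exists>r\<in>R j. q j * poly \<rho> (int j) = ev u r" if "j \<le> E" for j
      proof -
        have "evP u (\<Phi>j j) = evT (int j) (Sl u)" unfolding Sl_ev \<Phi>j_def
          by (rule poly_eqI) (simp add: coeff_map_poly ev_subst_var)
        then have "poly (evP u (\<Phi>j j)) (poly \<rho> (int j)) = 0" using rho by (simp add: poly_evT)
        then show ?thesis using nb that unfolding bad_def by blast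
      qed
      then obtain c where c: "\<And>j. j \<le> E \<Longrightarrow> c j \<in> R j \<and> q j * poly \<rho> (int j) = ev u (c j)"
        by (metis (no_types))
      define c' where "c' = restrict c {..E}"
      have c': "c' \<in> (\<Pi>\<^sub>E j\<in>{..E}. R j)" unfolding c'_def using c by auto
      have evc: "ev (u(v := t)) (c' j) = q j * poly \<rho> (int j)" if "j \<le> E" for j
      proof -
        have "v \<notin> mvars (c j)" using RV c[OF that] insert(2) by blast
        then have "ev (u(v := t)) (c j) = ev u (c j)" by (intro ev_cong) auto
        then show ?thesis using c[OF that] that unfolding c'_def by simp
      qed
      have "ev (u(v := t)) (\<Sum>j\<le>E. mconst (e j) * c' j * L j)
          = (\<Sum>j\<le>E. e j * (q j * poly \<rho> (int j)) * poly (lagr E j) t)"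
        by (simp add: ev.hom_sum ev.hom_mult evL evc)
      also have "\<dots> = (\<Sum>j\<le>E. (\<Prod>i\<le>E. q i) * (((\<Prod>i\<in>{..E} - {j}. lagr_c E i) * poly \<rho> (int j)) * poly (lagr E j) t))"
      proof (rule sum.cong[OF refl])
        fix j assume "j \<in> {..E}"
        then have "(\<Prod>i\<le>E. q i) = q j * (\<Prod>i\<in>{..E} - {j}. q i)" by (intro prod.remove) auto
        then show "e j * (q j * poly \<rho> (int j)) * poly (lagr E j) t
          = (\<Prod>i\<le>E. q i) * (((\<Prod>i\<in>{..E} - {j}. lagr_c E i) * poly \<rho> (int j)) * poly (lagr E j) t)"
          unfolding e_def by simp
      qed
      also have "\<dots> = (\<Prod>i\<le>E. q i) * poly (\<Sum>j\<le>E. smult ((\<Prod>i\<in>{..E} - {j}. lagr_c E i) * poly \<rho> (int j)) (lagr E j)) t"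
        by (simp add: poly_sum sum_distrib_left)
      also have "\<dots> = Q * z" unfolding lagrange_interpolation[OF drho, symmetric] Q_def zr by simp
      finally have "Q * z = ev (u(v := t)) (\<Sum>j\<le>E. mconst (e j) * c' j * L j)" ..
      moreover have "(\<Sum>j\<le>E. mconst (e j) * c' j * L j) \<in> RR" unfolding RR_def using c' by blast
      ultimately show False using nz by blast
    qed
    then show "t \<in> {t. \<bar>t\<bar> \<le> int N \<and> (\<exists>z. poly (evT t (Sl u)) z = 0 \<and> (\<forall>\<rho>. poly (Sl u) \<rho> = 0 \<longrightarrow> z \<noteq> poly \<rho> t))}"
      using t z unfolding Sl_ev by blast
  qed
  let ?k = "card V"
  show ?case
  proof (intro exI conjI ballI allI impI)
    show "Q \<noteq> 0" unfolding Q_def using q0 lagr_c_nonzero by (simp add: prod_zero_iff)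
    show "finite RR" unfolding RR_def by (intro finite_imageI finite_PiE finR) auto
    show "mvars r \<subseteq> insert v V" if r: "r \<in> RR" for r
    proof -
      obtain c where c: "c \<in> (\<Pi>\<^sub>E j\<in>{..E}. R j)" and r: "r = (\<Sum>j\<le>E. mconst (e j) * c j * L j)" using r unfolding RR_def by blast
      show ?thesis unfolding r
      proof (rule mvars_sum)
        fix j assume "j \<in> {..E}"
        then have "mvars (c j) \<subseteq> V" using c RV by blast
        then show "mvars (mconst (e j) * c j * L j) \<subseteq> insert v V"
          using mvars_mult[of "mconst (e j) * c j" "L j"] mvars_mult[of "mconst (e j)" "c j"] mL[of j] by auto
      qed
    qed
    show "0 \<le> 3 * (\<Sum>j\<le>E. C j) + 3 ^ ?k * K" using C0 K0' by (intro add_nonneg_nonneg mult_nonneg_nonneg sum_nonneg) auto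
    fix N :: nat assume N: "N \<ge> 1"
    have Nb: "K * real N powr (1/2 + \<epsilon>) \<ge> 0" using K0' by simp
    \<comment> \<open>Both contributions have order N^(k+1/2+\<epsilon>) with k = card V: full lines
      over the N^(k-1/2+\<epsilon>) bad base points, and N^(1/2+\<epsilon>) points on each of the
      other lines.\<close>
    have "real (card {x \<in> ibox (insert v V) N. ?Bad x})
        \<le> 3 * real N * real (card {u \<in> ibox V N. \<exists>j\<in>{..E}. bad j u}) + 3 ^ ?k * real N powr real ?k * (K * real N powr (1/2 + \<epsilon>))"
    proof (rule card_slices_le[OF insert(2,1) N Nb])
      fix u assume u: "u \<in> ibox V N" "\<not> (\<exists>j\<in>{..E}. bad j u)"
      have "card {t. \<bar>t\<bar> \<le> int N \<and> ?Bad (u(v := t))} \<le> card {t. \<bar>t\<bar> \<le> int N \<and> (\<exists>z. poly (evT t (Sl u)) z = 0 \<and> (\<forall>\<rho>. poly (Sl u) \<rho> = 0 \<longrightarrow> z \<noteq> poly \<rho> t))}"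
        by (rule card_mono[OF _ slice[OF u]]) (rule finite_subset[of _ "{- int N..int N}"], auto)
      then have "real (card {t. \<bar>t\<bar> \<le> int N \<and> ?Bad (u(v := t))}) \<le> real (card {t. \<bar>t\<bar> \<le> int N \<and> (\<exists>z. poly (evT t (Sl u)) z = 0 \<and> (\<forall>\<rho>. poly (Sl u) \<rho> = 0 \<longrightarrow> z \<noteq> poly \<rho> t))})"
        by (simp only: of_nat_le_iff)
      also have "\<dots> \<le> K * real N powr (1/2 + \<epsilon>)"
        by (rule K[OF N Sl_monic Sl_deg Sl_ht[OF N u(1)]])
      finally show "real (card {t. \<bar>t\<bar> \<le> int N \<and> ?Bad (u(v := t))}) \<le> K * real N powr (1/2 + \<epsilon>)" .
    qed
    also have "real (card {u \<in> ibox V N. \<exists>j\<in>{..E}. bad j u}) \<le> (\<Sum>j\<le>E. C j) * real N powr (real ?k - 1/2 + \<epsilon>)"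
    proof -
      have "{u \<in> ibox V N. \<exists>j\<in>{..E}. bad j u} = (\<Union>j\<in>{..E}. {u \<in> ibox V N. bad j u})" by blast
      then have "card {u \<in> ibox V N. \<exists>j\<in>{..E}. bad j u} \<le> (\<Sum>j\<le>E. card {u \<in> ibox V N. bad j u})"
        using card_UN_le[of "{..E}" "\<lambda>j. {u \<in> ibox V N. bad j u}"] by simp
      then have "real (card {u \<in> ibox V N. \<exists>j\<in>{..E}. bad j u}) \<le> (\<Sum>j\<le>E. real (card {u \<in> ibox V N. bad j u}))"
        unfolding of_nat_sum[symmetric] of_nat_le_iff .
      also have "\<dots> \<le> (\<Sum>j\<le>E. C j * real N powr (real ?k - 1/2 + \<epsilon>))"
        unfolding bad_def by (intro sum_mono IH N)
      finally show ?thesis by (simp only: sum_distrib_right)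
    qed
    then have "3 * real N * real (card {u \<in> ibox V N. \<exists>j\<in>{..E}. bad j u}) \<le> 3 * real N * ((\<Sum>j\<le>E. C j) * real N powr (real ?k - 1/2 + \<epsilon>))"
      by (rule mult_left_mono) simp
    also have "\<dots> = 3 * (\<Sum>j\<le>E. C j) * (real N powr 1 * real N powr (real ?k - 1/2 + \<epsilon>))" using N by simp
    also have "\<dots> = 3 * (\<Sum>j\<le>E. C j) * real N powr (real ?k + 1/2 + \<epsilon>)" unfolding powr_add[symmetric] by (simp add: algebra_simps)
    also have "3 ^ ?k * real N powr real ?k * (K * real N powr (1/2 + \<epsilon>)) = 3 ^ ?k * K * (real N powr real ?k * real N powr (1/2 + \<epsilon>))"
      by simp
    also have "\<dots> = 3 ^ ?k * K * real N powr (real ?k + 1/2 + \<epsilon>)" unfolding powr_add[symmetric] by (simp add: algebra_simps)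
    finally show "real (card {x \<in> ibox (insert v V) N. ?Bad x})
        \<le> (3 * (\<Sum>j\<le>E. C j) + 3 ^ ?k * K) * real N powr (real (card (insert v V)) - 1/2 + \<epsilon>)"
      using insert(1,2) by (simp add: algebra_simps)
  qed
qed

section \<open>Unique factorization\<close>

text \<open>P stands for membership in a subring that contains all coefficients. With it, quotient
  and remainder acquire no new variables, and the same statement serves for polynomials over a
  subfield.\<close>

lemma pseudo_division:
  fixes F G :: "'a::idom poly"
  assumes P: "P 0" "P 1" "\<And>a b. P a \<Longrightarrow> P b \<Longrightarrow> P (a + b)" "\<And>a b. P a \<Longrightarrow> P b \<Longrightarrow> P (a - b)" "\<And>a b. P a \<Longrightarrow> P b \<Longrightarrow> P (a * b)"
    and G: "G \<noteq> 0" "\<And>k. P (coeff G k)" and F: "\<And>k. P (coeff F k)"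
  shows "\<exists>e Q R. (\<forall>k. P (coeff Q k)) \<and> (\<forall>k. P (coeff R k)) \<and>
     smult (lead_coeff G ^ e) F = G * Q + R \<and> (R = 0 \<or> degree R < degree G)"
  using F
proof (induction "degree F" arbitrary: F rule: less_induct)
  case less
  have psum: "P (sum f A)" if "\<And>i. i \<in> A \<Longrightarrow> P (f i)" for f and A :: "nat set"
    using that by (induction A rule: infinite_finite_induct) (auto intro: P)
  show ?case
  proof (cases "F = 0 \<or> degree F < degree G")
    case True
    then show ?thesis using less.prems P by (intro exI[of _ 0] exI[of _ 0] exI[of _ F]) auto
  next
    case False
    define c where "c = lead_coeff G"
    define M where "M = monom (lead_coeff F) (degree F - degree G)"
    define F' where "F' = smult c F - G * M"
    have PM: "P (coeff M k)" for k unfolding M_def using less.prems P by (simp add: coeff_monom)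
    have PF': "P (coeff F' k)" for k
      unfolding F'_def coeff_diff coeff_smult coeff_mult c_def using PM G(2) less.prems by (intro P psum) auto
    have dM: "degree (G * M) = degree F"
      using False G(1) unfolding M_def by (subst degree_mult_eq) (auto simp: degree_monom_eq monom_eq_0_iff)
    have "coeff F' (degree F) = c * lead_coeff F - lead_coeff (G * M)"
      unfolding F'_def dM by simp
    also have "lead_coeff (G * M) = c * lead_coeff F"
    proof -
      have "lead_coeff F \<noteq> 0" using False by simp
      then have "lead_coeff M = lead_coeff F" unfolding M_def by (simp add: degree_monom_eq)
      then show ?thesis unfolding lead_coeff_mult c_def by simp
    qed
    finally have z: "coeff F' (degree F) = 0" by simp
    have le: "degree F' \<le> degree F"
      unfolding F'_def by (intro degree_diff_le order_trans[OF degree_smult_le]) (auto simp: dM)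
    have "\<exists>e Q R. (\<forall>k. P (coeff Q k)) \<and> (\<forall>k. P (coeff R k)) \<and>
     smult (lead_coeff G ^ e) F' = G * Q + R \<and> (R = 0 \<or> degree R < degree G)"
    proof (cases "degree F' < degree F")
      case True
      then show ?thesis using less.hyps[of F'] PF' by blast
    next
      case False
      then have "degree F' = degree F" using le by simp
      then have "F' = 0" using z by (metis leading_coeff_0_iff)
      then show ?thesis using P by (intro exI[of _ 0]) auto
    qed
    then obtain e Q R where QR: "\<And>k. P (coeff Q k)" "\<And>k. P (coeff R k)"
      "smult (c ^ e) F' = G * Q + R" "R = 0 \<or> degree R < degree G" unfolding c_def by blast
    have Pc: "P (c ^ e)" unfolding c_def using G(2) by (induction e) (auto intro: P)
    show ?thesis
    proof (rule exI[of _ "Suc e"], rule exI[of _ "Q + smult (c ^ e) M"], rule exI[of _ R], intro conjI allI)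
      show "P (coeff (Q + smult (c ^ e) M) k)" for k using QR(1) PM Pc by (auto intro!: P)
      show "P (coeff R k)" for k by (rule QR(2))
      have "smult (c ^ Suc e) F = smult (c ^ e) (F' + G * M)" unfolding F'_def by (simp add: mult.commute)
      also have "\<dots> = smult (c ^ e) F' + G * smult (c ^ e) M" by (simp add: smult_add_right)
      also have "\<dots> = G * (Q + smult (c ^ e) M) + R" unfolding QR(3) by (simp add: algebra_simps)
      finally show "smult (lead_coeff G ^ Suc e) F = G * (Q + smult (c ^ e) M) + R" unfolding c_def .
    qed (rule QR(4))
  qed
qed

lemma mvars_diff: "mvars (p - q) \<subseteq> mvars p \<union> mvars (q :: ('v, 'a::comm_ring_1) mpoly)"
  using mvars_add[of p "- q"] by simp

lemma mvars_poly_mvar: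
  assumes "\<And>k. mvars (coeff P k) \<subseteq> W"
  shows "mvars (poly P (mvar w)) \<subseteq> insert w (W :: 'v set)"
  unfolding poly_altdef
proof (rule mvars_sum)
  fix k
  show "mvars (coeff P k * mvar w ^ k) \<subseteq> insert w W"
    using assms[of k] mvars_mult[of "coeff P k" "mvar w ^ k"] mvars_power[of "mvar w" k] by auto
qed

lemma mpoly_pseudo_division:
  fixes f g :: "('v::linorder, 'a::idom) mpoly"
  assumes "g \<noteq> 0" "mvars f \<subseteq> insert w W" "mvars g \<subseteq> insert w W" "w \<notin> W"
  shows "\<exists>l q r. l \<noteq> 0 \<and> mvars l \<subseteq> W \<and> mvars q \<subseteq> insert w W \<and> l * f = g * q + r \<and> (r = 0 \<or> vdeg w r < vdeg w g)"
proof -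
  have cf: "mvars (coeff (toP w f) k) \<subseteq> W" and cg: "mvars (coeff (toP w g) k) \<subseteq> W" for k
    using mvars_coeff_toP[of w f k] mvars_coeff_toP[of w g k] assms by blast+
  have "\<exists>e Q R. (\<forall>k. mvars (coeff Q k) \<subseteq> W) \<and> (\<forall>k. mvars (coeff R k) \<subseteq> W) \<and>
     smult (lead_coeff (toP w g) ^ e) (toP w f) = toP w g * Q + R \<and> (R = 0 \<or> degree R < degree (toP w g))"
  proof (rule pseudo_division)
    fix a b :: "('v, 'a) mpoly" assume "mvars a \<subseteq> W" "mvars b \<subseteq> W"
    then show "mvars (a + b) \<subseteq> W" "mvars (a - b) \<subseteq> W" "mvars (a * b) \<subseteq> W"
      using mvars_add[of a b] mvars_diff[of a b] mvars_mult[of a b] by blast+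
  qed (use assms(1) cf cg in auto)
  then obtain e Q R where Q: "\<And>k. mvars (coeff Q k) \<subseteq> W" and R: "\<And>k. mvars (coeff R k) \<subseteq> W"
    and eq: "smult (lead_coeff (toP w g) ^ e) (toP w f) = toP w g * Q + R" and d: "R = 0 \<or> degree R < degree (toP w g)" by blast
  show ?thesis
  proof (intro exI conjI)
    show "lead_coeff (toP w g) ^ e \<noteq> 0" using assms(1) by simp
    show "mvars (lead_coeff (toP w g) ^ e) \<subseteq> W" using mvars_power[of "lead_coeff (toP w g)" e] cg by blast
    show "mvars (poly Q (mvar w)) \<subseteq> insert w W" using Q by (rule mvars_poly_mvar)
    show "lead_coeff (toP w g) ^ e * f = g * poly Q (mvar w) + poly R (mvar w)"
      using arg_cong[OF eq, of "\<lambda>p. poly p (mvar w)"] by simp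
    have "w \<notin> mvars (coeff R k)" for k using R[of k] assms(4) by blast
    then have "toP w (poly R (mvar w)) = R" by (rule toP_poly)
    then show "poly R (mvar w) = 0 \<or> vdeg w (poly R (mvar w)) < vdeg w g" using d unfolding vdeg_def by auto
  qed
qed

text \<open>Every nonzero element turns out to be primal, and irreducible primal elements are prime.
  Primality of the elements with variables in \<open>W\<close> plays the role of Gauss's lemma for adding a variable to \<open>W\<close>.\<close>

definition primal :: "'a::comm_ring_1 \<Rightarrow> bool" where
  "primal c \<longleftrightarrow> (\<forall>a b. c dvd a * b \<longrightarrow> (\<exists>c1 c2. c = c1 * c2 \<and> c1 dvd a \<and> c2 dvd b))"

lemma primalD: "primal c \<Longrightarrow> c dvd a * b \<Longrightarrow> \<exists>c1 c2. c = c1 * c2 \<and> c1 dvd a \<and> c2 dvd b"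
  unfolding primal_def by blast

lemma primal_unit:
  assumes "c dvd 1" shows "primal c"
  unfolding primal_def
proof (intro allI impI)
  fix a b :: 'a
  have "c dvd a" by (rule dvd_trans[OF assms one_dvd])
  then show "\<exists>c1 c2. c = c1 * c2 \<and> c1 dvd a \<and> c2 dvd b" by (intro exI[of _ c] exI[of _ 1]) auto
qed

text \<open>Split c first and cancel it; d then divides the product of the two cofactors and is
  split there.\<close>

lemma primal_mult:
  fixes c d :: "'a::idom"
  assumes "primal c" "primal d" "c \<noteq> 0"
  shows "primal (c * d)"
  unfolding primal_def
proof (intro allI impI)
  fix a b assume dv: "c * d dvd a * b"
  then have "c dvd a * b" by (rule dvd_mult_left)
  from primalD[OF assms(1) this] obtain c1 c2 a' b' where c: "c = c1 * c2" "a = c1 * a'" "b = c2 * b'"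
    by (auto elim!: dvdE)
  have "c * d dvd c * (a' * b')" using dv c by (simp add: mult_ac)
  then have "d dvd a' * b'" using assms(3) by simp
  from primalD[OF assms(2) this] obtain d1 d2 where d: "d = d1 * d2" "d1 dvd a'" "d2 dvd b'" by blast
  show "\<exists>e1 e2. c * d = e1 * e2 \<and> e1 dvd a \<and> e2 dvd b"
  proof (intro exI conjI)
    show "c * d = (c1 * d1) * (c2 * d2)" unfolding c d by (simp add: mult_ac)
    show "c1 * d1 dvd a" "c2 * d2 dvd b" unfolding c(2,3) using d by (auto intro: mult_dvd_mono)
  qed
qed

lemma primal_prime:
  assumes "\<And>a b. p dvd a * b \<Longrightarrow> p dvd a \<or> p dvd b"
  shows "primal p"
  unfolding primal_def
proof (intro allI impI)
  fix a b assume "p dvd a * b"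
  from assms[OF this] show "\<exists>c1 c2. p = c1 * c2 \<and> c1 dvd a \<and> c2 dvd b"
  proof
    assume "p dvd a" then show ?thesis by (intro exI[of _ p] exI[of _ 1]) auto
  next
    assume "p dvd b" then show ?thesis by (intro exI[of _ 1] exI[of _ p]) auto
  qed
qed

lemma irreducible_primal_dvd_mult:
  fixes p :: "'a::idom"
  assumes "irreducible p" "primal p" "p dvd a * b"
  shows "p dvd a \<or> p dvd b"
proof -
  obtain c1 c2 where c: "p = c1 * c2" "c1 dvd a" "c2 dvd b" using primalD[OF assms(2,3)] by blast
  then have "c1 dvd 1 \<or> c2 dvd 1" using assms(1) by (blast dest: irreducibleD)
  then show ?thesis
  proof
    assume "c1 dvd 1" then have "p dvd c2" unfolding c(1) by simp
    then show ?thesis using c(3) dvd_trans by blast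
  next
    assume "c2 dvd 1" then have "p dvd c1" unfolding c(1) by simp
    then show ?thesis using c(2) dvd_trans by blast
  qed
qed

lemma mpoly_dvd_one_iff:
  fixes p :: "('v::linorder, 'a::field) mpoly"
  shows "p dvd 1 \<longleftrightarrow> p \<noteq> 0 \<and> mvars p = {}"
proof
  assume "p dvd 1"
  then obtain q where q: "1 = p * q" by blast
  then have nz: "p \<noteq> 0" "q \<noteq> 0" by auto
  have "mvars p \<union> mvars q = {}" using mvars_mult_eq[OF nz] unfolding q[symmetric] by simp
  then show "p \<noteq> 0 \<and> mvars p = {}" using nz by simp
next
  assume p: "p \<noteq> 0 \<and> mvars p = {}"
  define c where "c = Poly_Mapping.lookup p 0"
  have pc: "p = mconst c" unfolding c_def using p by (intro mvars_empty_imp_mconst) simp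
  then have "c \<noteq> 0" using p by auto
  then have "p * mconst (inverse c) = 1" unfolding pc by (simp add: mult_single)
  then show "p dvd 1" by (metis dvd_triv_left)
qed

text \<open>Additive on products and positive off the constants, so it decreases whenever a
  polynomial is split into two non-units.\<close>

definition total_vdeg :: "('v::finite, 'a::comm_ring_1) mpoly \<Rightarrow> nat" where
  "total_vdeg p = (\<Sum>v\<in>UNIV. vdeg v p)"

lemma total_vdeg_mult:
  fixes p q :: "('v::{finite,linorder}, 'a::idom) mpoly"
  shows "p \<noteq> 0 \<Longrightarrow> q \<noteq> 0 \<Longrightarrow> total_vdeg (p * q) = total_vdeg p + total_vdeg q"
  unfolding total_vdeg_def by (simp add: vdeg_mult sum.distrib)

lemma total_vdeg_pos: "mvars p \<noteq> {} \<Longrightarrow> total_vdeg p > 0"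
proof -
  assume "mvars p \<noteq> {}"
  then obtain v where "v \<in> mvars p" by blast
  then have "vdeg v p \<noteq> 0" by (simp add: vdeg_eq_0_iff)
  moreover have "vdeg v p \<le> total_vdeg p" unfolding total_vdeg_def by (rule member_le_sum) auto
  ultimately show ?thesis by linarith
qed

text \<open>With s a = p e, the primal s splits into a divisor of p and a divisor of e. The former
  is free of w while p is not, so irreducibility makes it a unit; the latter cancels.\<close>

lemma irreducible_dvd_mult_cancel:
  fixes p :: "('v::linorder, 'a::field) mpoly"
  assumes p: "irreducible p" "w \<in> mvars p" and s: "primal s" "s \<noteq> 0" "w \<notin> mvars s" and dv: "p dvd s * a"
  shows "p dvd a"
proof -
  obtain e where e: "s * a = p * e" using dv by blast
  then have "s dvd p * e" by (metis dvd_triv_left)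
  from primalD[OF s(1) this] obtain s1 s2 p' e' where s12: "s = s1 * s2" "p = s1 * p'" "e = s2 * e'"
    by (auto elim!: dvdE)
  have p0: "p \<noteq> 0" using p(1) by auto
  have nz: "s1 \<noteq> 0" "s2 \<noteq> 0" "p' \<noteq> 0" using s12 s(2) p0 by auto
  have "w \<notin> mvars s1" using s(3) mvars_mult_eq[OF nz(1,2)] s12 by auto
  then have "\<not> p' dvd 1" using p(2) mvars_mult_eq[OF nz(1,3)] s12 by (auto simp: mpoly_dvd_one_iff)
  then have u: "s1 dvd 1" using irreducibleD[OF p(1) s12(2)] by blast
  have "s2 * (s1 * a) = s2 * (p * e')" using e unfolding s12(1,3) by (simp add: mult_ac)
  then have "s1 * a = p * e'" using nz by simp
  then have "p dvd s1 * a" by simp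
  then show ?thesis using u by (simp add: dvd_mult_unit_iff')
qed

text \<open>Euclid's algorithm as if polynomials in W were invertible: an element g of least degree
  in w in the ideal of p and a divides both, up to multipliers from W. If g still involved w, then p
  would divide g and therefore a.\<close>

lemma irreducible_bezout:
  fixes p a :: "('v::linorder, 'a::field) mpoly"
  assumes p: "irreducible p" "w \<in> mvars p" "mvars p \<subseteq> insert w W" and w: "w \<notin> W"
    and prim: "\<And>s :: ('v, 'a) mpoly. s \<noteq> 0 \<Longrightarrow> mvars s \<subseteq> W \<Longrightarrow> primal s"
    and a: "mvars a \<subseteq> insert w W" and nd: "\<not> p dvd a"
  shows "\<exists>s x y. s \<noteq> 0 \<and> mvars s \<subseteq> W \<and> s = x * p + y * a"
proof -
  define I where "I = {x * p + y * a | x y. mvars x \<subseteq> insert w W \<and> mvars y \<subseteq> insert w W}"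
  have p0: "p \<noteq> 0" using p(1) by auto
  have pI: "p \<in> I" unfolding I_def by (rule CollectI, rule exI[of _ 1], rule exI[of _ 0]) auto
  have aI: "a \<in> I" unfolding I_def by (rule CollectI, rule exI[of _ 0], rule exI[of _ 1]) auto
  have I_vars: "mvars g \<subseteq> insert w W" if gI: "g \<in> I" for g
  proof -
    obtain x y where "g = x * p + y * a" "mvars x \<subseteq> insert w W" "mvars y \<subseteq> insert w W" using gI unfolding I_def by blast
    then show ?thesis using mvars_add[of "x * p" "y * a"] mvars_mult[of x p] mvars_mult[of y a] p(3) a by blast
  qed
  have I_comb: "l * f - g * q \<in> I" if fI: "f \<in> I" and gI: "g \<in> I" and lq: "mvars l \<subseteq> insert w W" "mvars q \<subseteq> insert w W" for l f g q
  proof -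
    obtain x y where f: "f = x * p + y * a" "mvars x \<subseteq> insert w W" "mvars y \<subseteq> insert w W" using fI unfolding I_def by blast
    obtain x' y' where g: "g = x' * p + y' * a" "mvars x' \<subseteq> insert w W" "mvars y' \<subseteq> insert w W" using gI unfolding I_def by blast
    have "l * f - g * q = (l * x - q * x') * p + (l * y - q * y') * a" unfolding f g by (simp add: algebra_simps)
    moreover have "mvars (l * x - q * x') \<subseteq> insert w W"
      using mvars_diff[of "l * x" "q * x'"] mvars_mult[of l x] mvars_mult[of q x'] lq f g by blast
    moreover have "mvars (l * y - q * y') \<subseteq> insert w W"
      using mvars_diff[of "l * y" "q * y'"] mvars_mult[of l y] mvars_mult[of q y'] lq f g by blast
    ultimately show ?thesis unfolding I_def by blast
  qed
  have "\<exists>g. g \<in> I \<and> g \<noteq> 0" using pI p0 by blast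
  then obtain g where g: "g \<in> I" "g \<noteq> 0" and gmin: "\<And>h. h \<in> I \<Longrightarrow> h \<noteq> 0 \<Longrightarrow> vdeg w g \<le> vdeg w h"
    using ex_has_least_nat[of "\<lambda>g. g \<in> I \<and> g \<noteq> 0" _ "vdeg w"] by blast
  have divides: "\<exists>l q. l \<noteq> 0 \<and> mvars l \<subseteq> W \<and> l * f = g * q" if f: "f \<in> I" for f
  proof -
    obtain l q r where l: "l \<noteq> 0" "mvars l \<subseteq> W" "mvars q \<subseteq> insert w W" "l * f = g * q + r" "r = 0 \<or> vdeg w r < vdeg w g"
      using mpoly_pseudo_division[OF g(2) I_vars[OF f] I_vars[OF g(1)] w] by blast
    have "r = l * f - g * q" using l(4) by simp
    then have "r \<in> I" using I_comb[OF f g(1), of l q] l by auto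
    then have "r = 0" using gmin[of r] l(5) by (metis not_le)
    then show ?thesis using l by auto
  qed
  show ?thesis
  proof (cases "w \<in> mvars g")
    case False
    then have "mvars g \<subseteq> W" using I_vars[OF g(1)] by blast
    then show ?thesis using g unfolding I_def by blast
  next
    case True
    \<comment> \<open>The multiplier l is primal, so it can be distributed over g and q and
      cancelled. This leaves p = g' q' with w occurring in g', and q' must be a unit.\<close>
    obtain l q where l: "l \<noteq> 0" "mvars l \<subseteq> W" "l * p = g * q" using divides[OF pI] by blast
    then have "l dvd g * q" by (metis dvd_triv_left)
    from primalD[OF prim[OF l(1,2)] this] obtain l1 l2 g' q' where l12: "l = l1 * l2" "g = l1 * g'" "q = l2 * q'"
      by (auto elim!: dvdE)
    have nz: "l1 \<noteq> 0" "l2 \<noteq> 0" "g' \<noteq> 0" using l12 l g by auto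
    have "(l1 * l2) * p = (l1 * l2) * (g' * q')" using l(3) unfolding l12 by (simp add: mult_ac)
    then have pg: "p = g' * q'" using nz by simp
    have "w \<notin> mvars l1" using mvars_mult_eq[OF nz(1,2)] l(2) l12(1) w by auto
    then have "w \<in> mvars g'" using True mvars_mult_eq[OF nz(1,3)] l12(2) by auto
    then have "\<not> g' dvd 1" by (auto simp: mpoly_dvd_one_iff)
    then have "q' dvd 1" using irreducibleD[OF p(1) pg] by blast
    then have "p dvd g'" unfolding pg by simp
    then have pdg: "p dvd g" unfolding l12(2) by simp
    obtain la qa where la: "la \<noteq> 0" "mvars la \<subseteq> W" "la * a = g * qa" using divides[OF aI] by blast
    have "p dvd la * a" unfolding la(3) using pdg by simp
    moreover have "w \<notin> mvars la" using la(2) w by blast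
    ultimately have "p dvd a" using irreducible_dvd_mult_cancel[OF p(1,2) prim[OF la(1,2)] la(1)] by blast
    then show ?thesis using nd by blast
  qed
qed

section \<open>Gauss's lemma and primality in the full polynomial ring\<close>

lemma dvd_iff_dvd_coeff_toP:
  assumes "v \<notin> mvars p"
  shows "p dvd a \<longleftrightarrow> (\<forall>k. p dvd coeff (toP v a) k)"
proof
  assume "p dvd a"
  then obtain e where "a = p * e" by blast
  then have "toP v a = smult p (toP v e)" by (simp add: toP.hom_mult toP_no_var[OF assms])
  then show "\<forall>k. p dvd coeff (toP v a) k" by simp
next
  assume "\<forall>k. p dvd coeff (toP v a) k"
  then have "p dvd poly (toP v a) (mvar v)"
    unfolding poly_altdef by (intro dvd_sum dvd_mult2) auto
  then show "p dvd a" by simp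
qed

text \<open>Divisibility refers to the full ring; only the two factors are confined to V. The Bezout
  identity gives this relative form, and variables are then added one by one.\<close>

definition prime_over :: "'v set \<Rightarrow> ('v, 'a::comm_ring_1) mpoly \<Rightarrow> bool" where
  "prime_over V p \<longleftrightarrow> (\<forall>a b. mvars a \<subseteq> V \<longrightarrow> mvars b \<subseteq> V \<longrightarrow> p dvd a * b \<longrightarrow> p dvd a \<or> p dvd b)"

text \<open>Gauss's argument: take the first coefficients of a and b that p does not divide. In the
  coefficient of a b at the sum of their indices, every other term is divisible by p.\<close>

lemma prime_over_insert:
  fixes p :: "('v, 'a::comm_ring_1) mpoly"
  assumes "prime_over V p" "mvars p \<subseteq> V" "v \<notin> V"
  shows "prime_over (insert v V) p"
  unfolding prime_over_def
proof (intro allI impI)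
  fix a b :: "('v, 'a) mpoly"
  assume ab: "mvars a \<subseteq> insert v V" "mvars b \<subseteq> insert v V" "p dvd a * b"
  have vp: "v \<notin> mvars p" using assms by blast
  let ?A = "toP v a" and ?B = "toP v b"
  show "p dvd a \<or> p dvd b"
  proof (rule ccontr)
    assume "\<not> (p dvd a \<or> p dvd b)"
    then have ex: "\<exists>i. \<not> p dvd coeff ?A i" "\<exists>j. \<not> p dvd coeff ?B j"
      using dvd_iff_dvd_coeff_toP[OF vp, of a] dvd_iff_dvd_coeff_toP[OF vp, of b] by blast+
    define i j where "i = (LEAST i. \<not> p dvd coeff ?A i)" and "j = (LEAST j. \<not> p dvd coeff ?B j)"
    have i: "\<not> p dvd coeff ?A i" unfolding i_def by (rule LeastI_ex[OF ex(1)])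
    have ib: "p dvd coeff ?A k" if "k < i" for k
      using not_less_Least[OF that[unfolded i_def]] by blast
    have j: "\<not> p dvd coeff ?B j" unfolding j_def by (rule LeastI_ex[OF ex(2)])
    have jb: "p dvd coeff ?B k" if "k < j" for k
      using not_less_Least[OF that[unfolded j_def]] by blast
    have "p dvd coeff (?A * ?B) (i + j)"
      using ab(3) dvd_iff_dvd_coeff_toP[OF vp, of "a * b"] unfolding toP.hom_mult by blast
    also have "coeff (?A * ?B) (i + j) = (\<Sum>k\<le>i + j. coeff ?A k * coeff ?B (i + j - k))" by (rule coeff_mult)
    also have "\<dots> = coeff ?A i * coeff ?B j + (\<Sum>k\<in>{..i + j} - {i}. coeff ?A k * coeff ?B (i + j - k))"
      by (subst sum.remove[of _ i]) auto
    finally have d1: "p dvd coeff ?A i * coeff ?B j + (\<Sum>k\<in>{..i + j} - {i}. coeff ?A k * coeff ?B (i + j - k))" .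
    have d2: "p dvd (\<Sum>k\<in>{..i + j} - {i}. coeff ?A k * coeff ?B (i + j - k))"
    proof (rule dvd_sum)
      fix k assume k: "k \<in> {..i + j} - {i}"
      show "p dvd coeff ?A k * coeff ?B (i + j - k)"
      proof (cases "k < i")
        case True
        then show ?thesis using ib by simp
      next
        case False
        then have "i + j - k < j" using k by auto
        then show ?thesis using jb by simp
      qed
    qed
    have "p dvd coeff ?A i * coeff ?B j" using d1 d2 by (simp add: dvd_add_left_iff)
    moreover have "mvars (coeff ?A i) \<subseteq> V" "mvars (coeff ?B j) \<subseteq> V"
      using mvars_coeff_toP[of v a i] mvars_coeff_toP[of v b j] ab by blast+
    ultimately show False using assms(1) i j unfolding prime_over_def by blast
  qed
qed

lemma prime_over_superset:
  assumes "finite U" "prime_over V p" "mvars p \<subseteq> V"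
  shows "prime_over (V \<union> U) p"
  using assms(1)
proof (induction U rule: finite_induct)
  case (insert v U)
  show ?case
  proof (cases "v \<in> V")
    case True
    then show ?thesis using insert by (simp add: insert_absorb)
  next
    case False
    have "prime_over (insert v (V \<union> U)) p"
      using insert False assms(3) by (intro prime_over_insert) auto
    then show ?thesis by simp
  qed
qed (use assms in simp)

text \<open>Elements that split are reduced to their factors. An irreducible c involving w is prime:
  Bezout gives c dvd s * b with s free of w, and s can be cancelled because it is primal by the
  induction over W.\<close>

lemma mpoly_primal_aux:
  fixes c :: "('v::{finite,linorder}, 'a::field) mpoly"
  assumes "finite W" "c \<noteq> 0" "mvars c \<subseteq> W"
  shows "primal c"
  using assms
proof (induction W arbitrary: c rule: finite_induct)
  case empty
  then show ?case by (intro primal_unit) (simp add: mpoly_dvd_one_iff)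
next
  case (insert w W)
  note IH = insert.IH
  show ?case using insert.prems
  proof (induction "total_vdeg c" arbitrary: c rule: less_induct)
    case less
    consider "c dvd 1" | "irreducible c" | a b where "c = a * b" "\<not> a dvd 1" "\<not> b dvd 1"
      using less.prems(1) unfolding irreducible_def by blast
    then show ?case
    proof cases
      case 1
      then show ?thesis by (rule primal_unit)
    next
      case 3
      have nz: "a \<noteq> 0" "b \<noteq> 0" using 3 less.prems by auto
      have "total_vdeg a > 0" "total_vdeg b > 0" using 3 nz by (auto intro!: total_vdeg_pos simp: mpoly_dvd_one_iff)
      then have "total_vdeg a < total_vdeg c" "total_vdeg b < total_vdeg c" unfolding 3(1) total_vdeg_mult[OF nz] by auto
      moreover have "mvars a \<subseteq> insert w W" "mvars b \<subseteq> insert w W" using less.prems(2) mvars_mult_eq[OF nz] 3(1) by auto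
      ultimately have "primal a" "primal b" using less.hyps nz by blast+
      then show ?thesis unfolding 3(1) using nz by (intro primal_mult)
    next
      case 2
      show ?thesis
      proof (cases "w \<in> mvars c")
        case False
        then show ?thesis using IH[of c] less.prems by blast
      next
        case True
        have "prime_over (insert w W) c"
          unfolding prime_over_def
        proof (intro allI impI)
          fix a b :: "('v, 'a) mpoly"
          assume ab: "mvars a \<subseteq> insert w W" "mvars b \<subseteq> insert w W" "c dvd a * b"
          show "c dvd a \<or> c dvd b"
          proof (cases "c dvd a")
            case False
            obtain s x y where s: "s \<noteq> 0" "mvars s \<subseteq> W" "s = x * c + y * a"
              using irreducible_bezout[OF 2 True less.prems(2) insert.hyps(2) IH ab(1) False] by blast
            have "s * b = c * (x * b) + y * (a * b)" unfolding s(3) by (simp add: algebra_simps)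
            then have "c dvd s * b" using ab(3) by simp
            moreover have "w \<notin> mvars s" using s(2) insert.hyps(2) by blast
            ultimately have "c dvd b" using irreducible_dvd_mult_cancel[OF 2 True IH[OF s(1,2)] s(1)] by blast
            then show ?thesis by simp
          qed simp
        qed
        then have "prime_over (insert w W \<union> UNIV) c"
          using less.prems(2) by (intro prime_over_superset) auto
        then show ?thesis unfolding prime_over_def by (intro primal_prime) auto
      qed
    qed
  qed
qed

lemma mpoly_primal:
  fixes c :: "('v::{finite,linorder}, 'a::field) mpoly"
  shows "c \<noteq> 0 \<Longrightarrow> primal c"
  using mpoly_primal_aux[of UNIV c] by simp

lemma mpoly_irreducible_dvd_mult:
  fixes p :: "('v::{finite,linorder}, 'a::field) mpoly"
  assumes "irreducible p" "p dvd a * b"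
  shows "p dvd a \<or> p dvd b"
proof -
  have "p \<noteq> 0" using assms(1) by auto
  then show ?thesis by (rule irreducible_primal_dvd_mult[OF assms(1) mpoly_primal assms(2)])
qed

lemma mpoly_irreducible_bezout:
  fixes p a :: "('v::{finite,linorder}, 'a::field) mpoly"
  assumes "irreducible p" "w \<in> mvars p" "\<not> p dvd a"
  shows "\<exists>s x y. s \<noteq> 0 \<and> w \<notin> mvars s \<and> s = x * p + y * a"
proof -
  have "\<exists>s x y. s \<noteq> 0 \<and> mvars s \<subseteq> - {w} \<and> s = x * p + y * a"
    by (rule irreducible_bezout[OF assms(1,2)]) (use assms(3) mpoly_primal in auto)
  then show ?thesis by blast
qed

section \<open>Integral functions\<close>

text \<open>Complex functions on a set of parameters, integral over the ring of polynomial functions. The definition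
  exhibits a finitely generated module stable under multiplication; the characteristic polynomial of
  the matrix \<open>A\<close> is the equation of integral dependence.\<close>

definition integral_on :: "'s set \<Rightarrow> ('s \<Rightarrow> 'v \<Rightarrow> int) \<Rightarrow> ('s \<Rightarrow> complex) \<Rightarrow> bool" where
  "integral_on S u z \<longleftrightarrow> (\<exists>(I::nat set) w A. finite I \<and> (\<forall>s\<in>S. \<exists>i\<in>I. w i s \<noteq> 0) \<and>
     (\<forall>s\<in>S. \<forall>i\<in>I. z s * w i s = (\<Sum>j\<in>I. of_int (ev (u s) (A i j)) * w j s)))"

lemma integral_on_const: "integral_on S u (\<lambda>s. of_int (ev (u s) p))"
  unfolding integral_on_def by (intro exI[of _ "{0}"] exI[of _ "\<lambda>_ _. 1"] exI[of _ "\<lambda>_ _. p"]) simp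

text \<open>The products of generators of the two modules generate one that is stable under both
  functions. The matrices are the Kronecker product and the Kronecker sum; pairs of indices are
  coded as natural numbers because the definition fixes that index type.\<close>

lemma integral_on_add_mult:
  assumes "integral_on S u y" "integral_on S u z"
  shows "integral_on S u (\<lambda>s. y s + z s)" "integral_on S u (\<lambda>s. y s * z s)"
proof -
  from assms(1)[unfolded integral_on_def] obtain I1 :: "nat set" and w1 A1 where
    *: "finite I1 \<and> (\<forall>s\<in>S. \<exists>i\<in>I1. w1 i s \<noteq> 0) \<and>
     (\<forall>s\<in>S. \<forall>i\<in>I1. y s * w1 i s = (\<Sum>j\<in>I1. of_int (ev (u s) (A1 i j)) * w1 j s))"
    by (elim exE)
  note 1 = *[THEN conjunct1] *[THEN conjunct2, THEN conjunct1, rule_format]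
    *[THEN conjunct2, THEN conjunct2, rule_format]
  from assms(2)[unfolded integral_on_def] obtain I2 :: "nat set" and w2 A2 where
    *: "finite I2 \<and> (\<forall>s\<in>S. \<exists>i\<in>I2. w2 i s \<noteq> 0) \<and>
     (\<forall>s\<in>S. \<forall>i\<in>I2. z s * w2 i s = (\<Sum>j\<in>I2. of_int (ev (u s) (A2 i j)) * w2 j s))"
    by (elim exE)
  note 2 = *[THEN conjunct1] *[THEN conjunct2, THEN conjunct1, rule_format]
    *[THEN conjunct2, THEN conjunct2, rule_format]
  define I where "I = prod_encode ` (I1 \<times> I2)"
  define w where "w i s = w1 (fst (prod_decode i)) s * w2 (snd (prod_decode i)) s" for i s
  have fin: "finite I" unfolding I_def using 1 2 by simp
  have nz: "\<exists>i\<in>I. w i s \<noteq> 0" if s: "s \<in> S" for s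
  proof -
    obtain a b where "a \<in> I1" "w1 a s \<noteq> 0" "b \<in> I2" "w2 b s \<noteq> 0" using 1(2)[OF s] 2(2)[OF s] by blast
    then show ?thesis unfolding I_def w_def by (intro bexI[of _ "prod_encode (a, b)"]) auto
  qed
  have sumI: "(\<Sum>j\<in>I. f j) = (\<Sum>c\<in>I1. \<Sum>d\<in>I2. f (prod_encode (c, d)))" for f :: "nat \<Rightarrow> complex"
    unfolding I_def by (subst sum.reindex) (auto simp: sum.cartesian_product inj_on_def split_def)
  have I_cases: "\<exists>a\<in>I1. \<exists>b\<in>I2. i = prod_encode (a, b)" if "i \<in> I" for i using that unfolding I_def by auto
  define P where "P i j = A1 (fst (prod_decode i)) (fst (prod_decode j)) * A2 (snd (prod_decode i)) (snd (prod_decode j))" for i j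
  define Q where "Q i j = (if snd (prod_decode i) = snd (prod_decode j) then A1 (fst (prod_decode i)) (fst (prod_decode j)) else 0)
     + (if fst (prod_decode i) = fst (prod_decode j) then A2 (snd (prod_decode i)) (snd (prod_decode j)) else 0)" for i j
  have mult: "(y s * z s) * w i s = (\<Sum>j\<in>I. of_int (ev (u s) (P i j)) * w j s)" if s: "s \<in> S" and i: "i \<in> I" for s i
  proof -
    obtain a b where ab: "a \<in> I1" "b \<in> I2" "i = prod_encode (a, b)" using I_cases[OF i] by blast
    have "(y s * z s) * w i s = (y s * w1 a s) * (z s * w2 b s)" unfolding w_def ab by simp
    also have "\<dots> = (\<Sum>c\<in>I1. \<Sum>d\<in>I2. (of_int (ev (u s) (A1 a c)) * w1 c s) * (of_int (ev (u s) (A2 b d)) * w2 d s))"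
      unfolding 1(3)[OF s ab(1)] 2(3)[OF s ab(2)] by (rule sum_product)
    also have "\<dots> = (\<Sum>j\<in>I. of_int (ev (u s) (P i j)) * w j s)"
      unfolding sumI P_def w_def ab by (simp add: ev.hom_mult mult_ac)
    finally show ?thesis .
  qed
  show "integral_on S u (\<lambda>s. y s * z s)" unfolding integral_on_def using fin nz mult by blast
  have add: "(y s + z s) * w i s = (\<Sum>j\<in>I. of_int (ev (u s) (Q i j)) * w j s)" if s: "s \<in> S" and i: "i \<in> I" for s i
  proof -
    obtain a b where ab: "a \<in> I1" "b \<in> I2" "i = prod_encode (a, b)" using I_cases[OF i] by blast
    have e: "of_int (ev (u s) (Q i (prod_encode (c, d)))) * w (prod_encode (c, d)) s
       = (if b = d then of_int (ev (u s) (A1 a c)) * w1 c s * w2 d s else 0)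
       + (if a = c then of_int (ev (u s) (A2 b d)) * w2 d s * w1 c s else 0)" for c d
      unfolding Q_def w_def ab by (simp add: ev.hom_add algebra_simps)
    have "(\<Sum>j\<in>I. of_int (ev (u s) (Q i j)) * w j s)
        = (\<Sum>c\<in>I1. \<Sum>d\<in>I2. if b = d then of_int (ev (u s) (A1 a c)) * w1 c s * w2 d s else 0)
        + (\<Sum>c\<in>I1. \<Sum>d\<in>I2. if a = c then of_int (ev (u s) (A2 b d)) * w2 d s * w1 c s else 0)"
      unfolding sumI e sum.distrib ..
    also have "(\<Sum>c\<in>I1. \<Sum>d\<in>I2. if b = d then of_int (ev (u s) (A1 a c)) * w1 c s * w2 d s else 0)
        = (\<Sum>c\<in>I1. of_int (ev (u s) (A1 a c)) * w1 c s * w2 b s)"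
      using ab(2) 2(1) by (intro sum.cong refl) (simp add: sum.delta')
    also have "\<dots> = y s * w1 a s * w2 b s" unfolding 1(3)[OF s ab(1)] by (simp add: sum_distrib_right)
    also have "(\<Sum>c\<in>I1. \<Sum>d\<in>I2. if a = c then of_int (ev (u s) (A2 b d)) * w2 d s * w1 c s else 0)
        = (\<Sum>d\<in>I2. \<Sum>c\<in>I1. if a = c then of_int (ev (u s) (A2 b d)) * w2 d s * w1 c s else 0)" by (rule sum.swap)
    also have "\<dots> = (\<Sum>d\<in>I2. of_int (ev (u s) (A2 b d)) * w2 d s * w1 a s)"
      using ab(1) 1(1) by (intro sum.cong refl) (simp add: sum.delta')
    also have "\<dots> = z s * w2 b s * w1 a s" unfolding 2(3)[OF s ab(2)] by (simp add: sum_distrib_right)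
    finally show ?thesis unfolding w_def ab by (simp add: algebra_simps)
  qed
  show "integral_on S u (\<lambda>s. y s + z s)" unfolding integral_on_def using fin nz add by blast
qed

text \<open>The companion matrix of G acts on the vector 1, z, ..., z^(n-1), whose first entry is
  never 0.\<close>

lemma integral_on_root:
  assumes monic: "lead_coeff G = 1"
    and root: "\<And>s. s \<in> S \<Longrightarrow> poly (map_poly of_int (evP (u s) G)) (z s) = 0"
  shows "integral_on S u z"
proof -
  let ?n = "degree G"
  have deg: "degree (map_poly complex_of_int (evP x G)) = ?n" for x
  proof -
    have "degree (evP x G) = ?n" "lead_coeff (evP x G) = 1"
      by (rule monic_map_poly[OF monic]; simp)+
    then show ?thesis using monic_map_poly(1)[of "evP x G" complex_of_int] by simp
  qed
  have rt: "z s ^ ?n = - (\<Sum>j<?n. of_int (ev (u s) (coeff G j)) * z s ^ j)" if s: "s \<in> S" for s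
  proof -
    have "0 = (\<Sum>j\<le>?n. coeff (map_poly complex_of_int (evP (u s) G)) j * z s ^ j)"
      using root[OF s] unfolding poly_altdef deg by simp
    also have "\<dots> = (\<Sum>j<?n. of_int (ev (u s) (coeff G j)) * z s ^ j) + z s ^ ?n"
      using monic by (simp add: lessThan_Suc_atMost[symmetric] coeff_map_poly)
    finally show ?thesis by (simp add: eq_neg_iff_add_eq_0 add.commute)
  qed
  define A where "A i j = (if Suc i < ?n then (if j = Suc i then 1 else 0) else - coeff G j)" for i j
  show ?thesis unfolding integral_on_def
  proof (rule exI[of _ "{..<?n}"], rule exI[of _ "\<lambda>i s. z s ^ i"], rule exI[of _ A], intro conjI ballI)
    fix s assume s: "s \<in> S"
    have "?n \<noteq> 0" using rt[OF s] by (intro notI) simp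
    then show "\<exists>i\<in>{..<?n}. z s ^ i \<noteq> 0" by (intro bexI[of _ 0]) auto
    fix i assume i: "i \<in> {..<?n}"
    show "z s * z s ^ i = (\<Sum>j\<in>{..<?n}. of_int (ev (u s) (A i j)) * z s ^ j)"
    proof (cases "Suc i < ?n")
      case True
      have "(\<Sum>j\<in>{..<?n}. of_int (ev (u s) (A i j)) * z s ^ j) = (\<Sum>j\<in>{..<?n}. if j = Suc i then z s ^ Suc i else 0)"
        unfolding A_def using True by (intro sum.cong) auto
      then show ?thesis using True by simp
    next
      case False
      then have "?n = Suc i" using i by auto
      then have "z s * z s ^ i = z s ^ ?n" by simp
      also have "\<dots> = (\<Sum>j\<in>{..<?n}. of_int (ev (u s) (A i j)) * z s ^ j)"
        unfolding rt[OF s] A_def using False by (simp add: sum_negf ev.hom_uminus)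
      finally show ?thesis .
    qed
  qed simp
qed

text \<open>At each s the nonzero vector w is an eigenvector for z(s) of the matrix evaluated at
  u(s). The characteristic polynomial is formed before evaluation, so one monic equation serves all
  s.\<close>

lemma integral_on_equation:
  fixes u :: "'s \<Rightarrow> 'v::linorder \<Rightarrow> int"
  assumes "integral_on S u z"
  shows "\<exists>\<Phi>. lead_coeff \<Phi> = 1 \<and> (\<forall>s\<in>S. poly (map_poly of_int (evP (u s) \<Phi>)) (z s) = 0)"
proof -
  from assms[unfolded integral_on_def] obtain I :: "nat set" and w A where
    *: "finite I \<and> (\<forall>s\<in>S. \<exists>i\<in>I. w i s \<noteq> 0) \<and>
     (\<forall>s\<in>S. \<forall>i\<in>I. z s * w i s = (\<Sum>j\<in>I. of_int (ev (u s) (A i j)) * w j s))"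
    by (elim exE)
  note I = *[THEN conjunct1] *[THEN conjunct2, THEN conjunct1, rule_format]
    *[THEN conjunct2, THEN conjunct2, rule_format]
  note eq = I(3)
  define n where "n = card I"
  obtain f where f: "bij_betw f {..<n} I" using ex_bij_betw_nat_finite[OF I(1)] unfolding n_def lessThan_atLeast0 by blast
  define B :: "('v, int) mpoly mat" where "B = mat n n (\<lambda>(i, j). A (f i) (f j))"
  have B: "B \<in> carrier_mat n n" unfolding B_def by simp
  show ?thesis
  proof (intro exI[of _ "char_poly B"] conjI ballI)
    show "lead_coeff (char_poly B) = 1" using degree_monic_char_poly[OF B] by simp
    fix s assume s: "s \<in> S"
    interpret h: comm_ring_hom "\<lambda>p. complex_of_int (ev (u s) p)"
      by (rule comm_ring_hom_comp[OF comm_ring_hom_of_int comm_ring_hom_ev])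
    define Bs where "Bs = map_mat (\<lambda>p. complex_of_int (ev (u s) p)) B"
    have Bs: "Bs \<in> carrier_mat n n" unfolding Bs_def using B by simp
    define x where "x = vec n (\<lambda>i. w (f i) s)"
    have "eigenvector Bs x (z s)"
      unfolding eigenvector_def
    proof (intro conjI)
      show "x \<in> carrier_vec (dim_row Bs)" unfolding x_def using Bs by simp
      obtain i where "i \<in> I" "w i s \<noteq> 0" using I(2)[OF s] by blast
      then obtain i' where "i' < n" "w (f i') s \<noteq> 0" using f by (auto simp: bij_betw_def)
      then show "x \<noteq> 0\<^sub>v (dim_row Bs)" unfolding x_def using Bs by (auto simp: vec_eq_iff)
      show "Bs *\<^sub>v x = z s \<cdot>\<^sub>v x"
      proof (rule eq_vecI)
        fix i assume "i < dim_vec (z s \<cdot>\<^sub>v x)"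
        then have i: "i < n" unfolding x_def by simp
        then have fi: "f i \<in> I" using f by (auto simp: bij_betw_def)
        have "(Bs *\<^sub>v x) $ i = (\<Sum>j\<in>{..<n}. of_int (ev (u s) (A (f i) (f j))) * w (f j) s)"
          using i B unfolding Bs_def x_def B_def by (simp add: scalar_prod_def lessThan_atLeast0)
        also have "\<dots> = (\<Sum>j\<in>I. of_int (ev (u s) (A (f i) j)) * w j s)"
          by (rule sum.reindex_bij_betw[OF f])
        also have "\<dots> = (z s \<cdot>\<^sub>v x) $ i" unfolding eq[OF s fi, symmetric] x_def using i by simp
        finally show "(Bs *\<^sub>v x) $ i = (z s \<cdot>\<^sub>v x) $ i" .
      qed (use Bs in \<open>simp add: x_def\<close>)
    qed
    then have "eigenvalue Bs (z s)" unfolding eigenvalue_def by blast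
    then have "poly (char_poly Bs) (z s) = 0" using eigenvalue_root_char_poly[OF Bs] by simp
    also have "char_poly Bs = map_poly (\<lambda>p. complex_of_int (ev (u s) p)) (char_poly B)"
      unfolding Bs_def by (rule h.char_poly_hom[OF B])
    also have "\<dots> = map_poly of_int (evP (u s) (char_poly B))"
      by (rule poly_eqI) (simp add: coeff_map_poly)
    finally show "poly (map_poly of_int (evP (u s) (char_poly B))) (z s) = 0" .
  qed
qed

section \<open>Points where a polynomial factors\<close>

text \<open>The exceptional sets that the final bound tolerates, saving nearly 1/2 in the exponent
  over the full box. Zero sets of polynomials even save 1.\<close>

definition thin :: "'v set \<Rightarrow> real \<Rightarrow> (('v \<Rightarrow> int) \<Rightarrow> bool) \<Rightarrow> bool" where
  "thin V \<epsilon> A \<longleftrightarrow> (\<exists>C\<ge>0. \<forall>N\<ge>1. real (card {u \<in> ibox V N. A u}) \<le> C * real N powr (real (card V) - 1/2 + \<epsilon>))"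

lemma thin_mono:
  assumes "thin V \<epsilon> A" "finite V" "\<And>u. (\<And>v. v \<notin> V \<Longrightarrow> u v = 0) \<Longrightarrow> B u \<Longrightarrow> A u"
  shows "thin V \<epsilon> B"
proof -
  have "card {u \<in> ibox V N. B u} \<le> card {u \<in> ibox V N. A u}" for N
  proof (rule card_mono)
    show "finite {u \<in> ibox V N. A u}" using finite_ibox[OF assms(2), of N] by simp
    show "{u \<in> ibox V N. B u} \<subseteq> {u \<in> ibox V N. A u}" using assms(3) unfolding ibox_def by blast
  qed
  then have le: "real (card {u \<in> ibox V N. B u}) \<le> real (card {u \<in> ibox V N. A u})" for N
    by (simp only: of_nat_le_iff)
  obtain C where C: "C \<ge> 0" "\<And>N. N \<ge> 1 \<Longrightarrow> real (card {u \<in> ibox V N. A u}) \<le> C * real N powr (real (card V) - 1/2 + \<epsilon>)"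
    using assms(1) unfolding thin_def by blast
  show ?thesis unfolding thin_def
    by (intro exI[of _ C] conjI allI impI C(1) order_trans[OF le C(2)])
qed

lemma thin_disj:
  assumes "thin V \<epsilon> A" "thin V \<epsilon> B" "finite V"
  shows "thin V \<epsilon> (\<lambda>u. A u \<or> B u)"
proof -
  let ?g = "\<lambda>N. real N powr (real (card V) - 1/2 + \<epsilon>)"
  obtain C1 where 1: "C1 \<ge> 0" "\<And>N. N \<ge> 1 \<Longrightarrow> real (card {u \<in> ibox V N. A u}) \<le> C1 * ?g N"
    using assms(1) unfolding thin_def by blast
  obtain C2 where 2: "C2 \<ge> 0" "\<And>N. N \<ge> 1 \<Longrightarrow> real (card {u \<in> ibox V N. B u}) \<le> C2 * ?g N"
    using assms(2) unfolding thin_def by blast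
  show ?thesis unfolding thin_def
  proof (intro exI[of _ "C1 + C2"] conjI allI impI)
    fix N :: nat assume N: "N \<ge> 1"
    have "{u \<in> ibox V N. A u \<or> B u} = {u \<in> ibox V N. A u} \<union> {u \<in> ibox V N. B u}" by blast
    then have "card {u \<in> ibox V N. A u \<or> B u} \<le> card {u \<in> ibox V N. A u} + card {u \<in> ibox V N. B u}"
      by (simp add: card_Un_le)
    then have "real (card {u \<in> ibox V N. A u \<or> B u}) \<le> real (card {u \<in> ibox V N. A u}) + real (card {u \<in> ibox V N. B u})"
      by linarith
    also have "\<dots> \<le> C1 * ?g N + C2 * ?g N" by (intro add_mono 1 2 N)
    finally show "real (card {u \<in> ibox V N. A u \<or> B u}) \<le> (C1 + C2) * ?g N" by (simp only: distrib_right)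
  qed (use 1 2 in simp)
qed

lemma thin_False: "thin V \<epsilon> (\<lambda>_. False)"
  unfolding thin_def by (intro exI[of _ 0]) simp

lemma thin_finite_ex:
  assumes "finite I" "finite V" "\<And>i. i \<in> I \<Longrightarrow> thin V \<epsilon> (A i)"
  shows "thin V \<epsilon> (\<lambda>u. \<exists>i\<in>I. A i u)"
  using assms(1,3)
proof (induction I rule: finite_induct)
  case empty
  then show ?case using thin_False by simp
next
  case (insert i I)
  have "thin V \<epsilon> (\<lambda>u. A i u \<or> (\<exists>i\<in>I. A i u))"
    by (rule thin_disj[OF _ _ assms(2)]) (use insert in auto)
  then show ?case by simp
qed

lemma thin_zeros:
  assumes "finite V" "mvars p \<subseteq> V" "p \<noteq> 0" "\<epsilon> > 0"
  shows "thin V \<epsilon> (\<lambda>u. ev u p = 0)"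
proof -
  obtain C where C: "C \<ge> 0" "\<And>N. N \<ge> 1 \<Longrightarrow> real (card {x \<in> ibox V N. ev x p = 0}) \<le> C * real N powr (real (card V) - 1)"
    using zeros_count[OF assms(1-3)] by blast
  show ?thesis unfolding thin_def
  proof (intro exI[of _ C] conjI allI impI)
    fix N :: nat assume N: "N \<ge> 1"
    have "C * real N powr (real (card V) - 1) \<le> C * real N powr (real (card V) - 1/2 + \<epsilon>)"
      using C(1) N assms(4) by (intro mult_left_mono powr_mono) auto
    with C(2)[OF N] show "real (card {u \<in> ibox V N. ev u p = 0}) \<le> C * real N powr (real (card V) - 1/2 + \<epsilon>)" by linarith
  qed (rule C(1))
qed

text \<open>For P of degree n > 0 with leading coefficient h this is h^(n-1) P(Y / h); its roots are
  h times those of P.\<close>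

definition monicize :: "'a::comm_ring_1 poly \<Rightarrow> 'a poly" where
  "monicize P = (\<Sum>k<degree P. monom (coeff P k * lead_coeff P ^ (degree P - 1 - k)) k) + monom 1 (degree P)"

lemma coeff_sum_monom:
  "coeff (\<Sum>k<n. monom (f k) k) j = (if j < n then f j else (0::'a::comm_ring_1))"
  by (simp add: coeff_sum)

lemma coeff_monicize:
  "coeff (monicize P) k = (if k < degree P then coeff P k * lead_coeff P ^ (degree P - 1 - k) else if k = degree P then 1 else 0)"
  unfolding monicize_def coeff_add coeff_sum_monom by auto

lemma degree_monicize: "degree (monicize P) = degree P"
proof (rule antisym)
  show "degree (monicize P) \<le> degree P" by (rule degree_le) (simp add: coeff_monicize)
  show "degree P \<le> degree (monicize P)" by (rule le_degree) (simp add: coeff_monicize)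
qed

lemma lead_coeff_monicize: "lead_coeff (monicize P) = 1"
  unfolding degree_monicize by (simp add: coeff_monicize)

lemma poly_monicize:
  fixes \<phi> :: "'a::comm_ring_1 \<Rightarrow> 'b::comm_ring_1"
  assumes "comm_ring_hom \<phi>" "degree P > 0"
  shows "poly (map_poly \<phi> (monicize P)) (\<phi> (lead_coeff P) * x) = \<phi> (lead_coeff P) ^ (degree P - 1) * poly (map_poly \<phi> P) x"
proof -
  interpret h: comm_ring_hom \<phi> by fact
  let ?n = "degree P" and ?h = "\<phi> (lead_coeff P)"
  have "poly (map_poly \<phi> (monicize P)) (?h * x) = (\<Sum>k<Suc ?n. coeff (map_poly \<phi> (monicize P)) k * (?h * x) ^ k)"
    by (rule poly_eq_sum_lessThan) (auto simp: coeff_map_poly coeff_monicize)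
  also have "\<dots> = (\<Sum>k<Suc ?n. ?h ^ (?n - 1) * (coeff (map_poly \<phi> P) k * x ^ k))"
  proof (rule sum.cong[OF refl])
    fix k assume "k \<in> {..<Suc ?n}"
    then consider "k < ?n" | "k = ?n" by fastforce
    then show "coeff (map_poly \<phi> (monicize P)) k * (?h * x) ^ k = ?h ^ (?n - 1) * (coeff (map_poly \<phi> P) k * x ^ k)"
    proof cases
      case 1
      have "?h ^ (?n - 1) = ?h ^ (?n - 1 - k) * ?h ^ k" using 1 by (simp add: power_add[symmetric])
      then show ?thesis using 1
        by (simp add: coeff_map_poly coeff_monicize h.hom_mult h.hom_power power_mult_distrib mult_ac)
    next
      case 2
      have "?h ^ ?n = ?h ^ (?n - 1) * ?h" using assms(2) by (simp add: power_eq_if mult.commute)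
      then show ?thesis unfolding 2 by (simp add: coeff_map_poly coeff_monicize power_mult_distrib mult_ac)
    qed
  qed
  also have "\<dots> = ?h ^ (?n - 1) * poly (map_poly \<phi> P) x"
    unfolding sum_distrib_left[symmetric]
    by (subst poly_eq_sum_lessThan[of "Suc ?n" "map_poly \<phi> P"]) (auto simp: coeff_map_poly coeff_eq_0)
  finally show ?thesis .
qed

text \<open>The coefficients are polynomials in h and the y i. The factor h X - y is h (X - a) for a
  scaled root y = h a, so the product is h^m times the monic polynomial with roots a.\<close>

lemma integral_on_coeff_prod:
  fixes m :: nat
  assumes "\<And>i. i < m \<Longrightarrow> integral_on S u (y i)"
  shows "integral_on S u (\<lambda>s. coeff (\<Prod>i<m. [:- y i s, of_int (ev (u s) h):]) k)"
  using assms
proof (induction m arbitrary: k)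
  case 0
  show ?case
    using integral_on_const[of S u "mconst 0"] integral_on_const[of S u "mconst 1"] by (cases "k = 0") simp_all
next
  case (Suc m)
  let ?p = "\<lambda>s. \<Prod>i<m. [:- y i s, of_int (ev (u s) h):]"
  have IH: "integral_on S u (\<lambda>s. coeff (?p s) k)" for k using Suc by simp
  have m1: "integral_on S u (\<lambda>s. -1)" using integral_on_const[of S u "mconst (-1)"] by simp
  have a: "integral_on S u (\<lambda>s. -1 * y m s * coeff (?p s) k)"
    by (intro integral_on_add_mult(2) m1 IH Suc.prems) simp
  have b: "integral_on S u (\<lambda>s. of_int (ev (u s) h) * (if k = 0 then 0 else coeff (?p s) (k - 1)))"
  proof (cases k)
    case 0
    then show ?thesis using integral_on_const[of S u "mconst 0"] by simp
  next
    case (Suc k')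
    then show ?thesis using integral_on_add_mult(2)[OF integral_on_const[of S u h] IH[of k']] by simp
  qed
  have "coeff (\<Prod>i<Suc m. [:- y i s, of_int (ev (u s) h):]) k
      = -1 * y m s * coeff (?p s) k + of_int (ev (u s) h) * (if k = 0 then 0 else coeff (?p s) (k - 1))" for s
  proof -
    have "(\<Prod>i<Suc m. [:- y i s, of_int (ev (u s) h):]) = smult (- y m s) (?p s) + pCons 0 (smult (of_int (ev (u s) h)) (?p s))"
      by (simp add: mult.commute)
    then show ?thesis by (simp only: coeff_add coeff_smult coeff_pCons) (simp split: nat.split)
  qed
  then show ?case using integral_on_add_mult(1)[OF a b] by (simp only:)
qed

lemma map_poly_comp_of_int: "map_poly (\<lambda>p. complex_of_int (ev x p)) \<Phi> = map_poly of_int (evP x \<Phi>)"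
  by (rule poly_eqI) (simp add: coeff_map_poly)

text \<open>Since the factor is not known in advance, its roots become parameters: a parameter is a
  point u with any e roots of the monic polynomial over u. A single equation thus covers every u and
  every choice of roots.\<close>

lemma factor_coeff_equation:
  fixes P :: "('v::linorder, int) mpoly poly" and w :: 'v and e :: nat
  shows "\<exists>\<Phi>. lead_coeff \<Phi> = 1 \<and> (\<forall>j. mvars (coeff \<Phi> j) \<subseteq> - {w}) \<and>
    (\<forall>u ys. u w = 0 \<longrightarrow> (\<forall>i<e. poly (map_poly of_int (evP u (monicize P))) (ys i) = 0) \<longrightarrow>
       poly (map_poly of_int (evP u \<Phi>)) (coeff (\<Prod>i<e. [:- ys i, complex_of_int (ev u h):]) k) = 0)"
proof -
  define S where "S = {s :: ('v \<Rightarrow> int) \<times> (nat \<Rightarrow> complex). \<forall>i<e. poly (map_poly of_int (evP (fst s) (monicize P))) (snd s i) = 0}"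
  have "integral_on S fst (\<lambda>s. snd s i)" if "i < e" for i
    by (rule integral_on_root[OF lead_coeff_monicize[of P]]) (use that in \<open>auto simp: S_def\<close>)
  then have "integral_on S fst (\<lambda>s. coeff (\<Prod>i<e. [:- snd s i, of_int (ev (fst s) h):]) k)"
    by (rule integral_on_coeff_prod)
  from integral_on_equation[OF this] obtain \<Phi> where
    \<Phi>: "lead_coeff \<Phi> = 1" "\<And>s. s \<in> S \<Longrightarrow> poly (map_poly of_int (evP (fst s) \<Phi>)) (coeff (\<Prod>i<e. [:- snd s i, of_int (ev (fst s) h):]) k) = 0"
    by blast
  \<comment> \<open>The equation may involve all variables. Putting w = 0 removes w and changes
    nothing at points with u w = 0.\<close>
  define \<Phi>' where "\<Phi>' = map_poly (subst_var w 0) \<Phi>"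
  show ?thesis
  proof (intro exI[of _ \<Phi>'] conjI allI impI)
    show "lead_coeff \<Phi>' = 1" unfolding \<Phi>'_def by (rule monic_map_poly(2)[OF \<Phi>(1)]) auto
    show "mvars (coeff \<Phi>' j) \<subseteq> - {w}" for j
      unfolding \<Phi>'_def using mvars_subst_var[of w 0 "coeff \<Phi> j"] by (auto simp: coeff_map_poly)
    fix u :: "'v \<Rightarrow> int" and ys :: "nat \<Rightarrow> complex"
    assume u: "u w = 0" and ys: "\<forall>i<e. poly (map_poly of_int (evP u (monicize P))) (ys i) = 0"
    have uw: "u(w := 0) = u" using u by auto
    have "evP u \<Phi>' = evP u \<Phi>" unfolding \<Phi>'_def
      by (rule poly_eqI) (simp add: coeff_map_poly ev_subst_var uw)
    moreover have "(u, ys) \<in> S" unfolding S_def using ys by simp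
    ultimately show "poly (map_poly of_int (evP u \<Phi>')) (coeff (\<Prod>i<e. [:- ys i, complex_of_int (ev u h):]) k) = 0"
      using \<Phi>(2)[of "(u, ys)"] by simp
  qed
qed

lemma rational_root_of_monic_int:
  fixes \<Psi> :: "int poly"
  assumes "lead_coeff \<Psi> = 1" "poly (map_poly of_int \<Psi>) (of_rat r :: complex) = 0"
  shows "\<exists>z. r = of_int z \<and> poly \<Psi> z = 0"
proof -
  have "algebraic_int (of_rat r :: complex)"
  proof (rule algebraic_int.intros)
    show "lead_coeff (map_poly of_int \<Psi> :: complex poly) = 1" by (rule monic_map_poly(2)[OF assms(1)]) auto
    show "\<forall>i. coeff (map_poly of_int \<Psi> :: complex poly) i \<in> \<int>" by (simp add: coeff_map_poly)
    show "poly (map_poly of_int \<Psi>) (of_rat r :: complex) = 0" by fact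
  qed
  then have "(of_rat r :: complex) \<in> \<int>" by (rule rational_algebraic_int_is_int) simp
  then obtain z where z: "(of_rat r :: complex) = of_int z" by (elim Ints_cases)
  then have "(of_rat r :: complex) = of_rat (of_int z)" by simp
  then have r: "r = of_int z" by (simp only: of_rat_eq_iff)
  have "poly (map_poly of_int \<Psi>) (of_int z :: complex) = of_int (poly \<Psi> z)"
    by (induction \<Psi>) (simp_all add: map_poly_pCons)
  then have "poly \<Psi> z = 0" using assms(2) unfolding z by simp
  then show ?thesis using r by blast
qed

subsection \<open>Passing to rational coefficients\<close>

lemma rat_mpoly_eq_meval: "rat_mpoly p = meval of_int mvar p"
  unfolding rat_mpoly_def by (rule mpoly_eval_eq_meval)

lemma comm_ring_hom_rat_mpoly: "comm_ring_hom (rat_mpoly :: ('v, int) mpoly \<Rightarrow> _)"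
proof -
  have e: "(rat_mpoly :: ('v, int) mpoly \<Rightarrow> _) = meval of_int mvar" by (rule ext) (rule rat_mpoly_eq_meval)
  show ?thesis unfolding e by (rule mpoly_hom_meval[OF comm_ring_hom_of_int])
qed

interpretation rat_mpoly: comm_ring_hom rat_mpoly by (rule comm_ring_hom_rat_mpoly)

lemma lookup_rat_mpoly: "Poly_Mapping.lookup (rat_mpoly p) m = of_int (Poly_Mapping.lookup p m)"
proof (induction p rule: mpoly_induct)
  case (single k c)
  have "mpoly_hom (of_int :: int \<Rightarrow> ('a, rat) mpoly)" unfolding mpoly_hom_def by (rule comm_ring_hom_of_int)
  then have "rat_mpoly (Poly_Mapping.single k c) = of_int c * (mon mvar k :: ('a, rat) mpoly)"
    unfolding rat_mpoly_eq_meval by (rule mpoly_hom.meval_single)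
  also have "\<dots> = mconst (of_int c) * Poly_Mapping.single k 1" by (simp only: mon_mvar single_of_int)
  also have "\<dots> = Poly_Mapping.single k (of_int c)" by (simp add: mult_single del: single_of_int)
  finally show ?case by (simp add: lookup_single when_def)
qed (simp add: rat_mpoly.hom_add lookup_add)

lemma rat_mpoly_eq_0_iff [simp]: "rat_mpoly p = 0 \<longleftrightarrow> p = 0"
proof
  assume z: "rat_mpoly p = 0"
  show "p = 0"
  proof (rule poly_mapping_eqI)
    fix m
    have "Poly_Mapping.lookup (rat_mpoly p) m = 0" unfolding z by simp
    then show "Poly_Mapping.lookup p m = Poly_Mapping.lookup 0 m" unfolding lookup_rat_mpoly by simp
  qed
qed simp

lemma mvars_rat_mpoly [simp]: "mvars (rat_mpoly p) = mvars p"
proof -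
  have "Poly_Mapping.keys (rat_mpoly p) = Poly_Mapping.keys p" by (auto simp: in_keys_iff lookup_rat_mpoly)
  then show ?thesis unfolding mvars_def by simp
qed

lemma rat_mpoly_mconst: "rat_mpoly (mconst c) = mconst (of_int c)"
  by (rule poly_mapping_eqI) (simp add: lookup_rat_mpoly lookup_single when_def del: single_of_int)

lemma rat_mpoly_mvar [simp]: "rat_mpoly (mvar v) = mvar v"
  by (rule poly_mapping_eqI) (simp add: mvar_def lookup_rat_mpoly lookup_single when_def)

lemma toP_rat_mpoly: "toP v (rat_mpoly p) = map_poly rat_mpoly (toP v p)"
  by (rule mpoly_hom_ext[OF comm_ring_hom_comp[OF comm_ring_hom_toP comm_ring_hom_rat_mpoly]
        comm_ring_hom_comp[OF comm_ring_hom_map_poly[OF comm_ring_hom_rat_mpoly] comm_ring_hom_toP]])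
     (simp_all add: rat_mpoly_mconst toP_mvar map_poly_const map_poly_linear del: single_of_int)

lemma vdeg_rat_mpoly: "vdeg v (rat_mpoly p) = vdeg v p"
  unfolding vdeg_def toP_rat_mpoly by (rule degree_map_poly) simp

text \<open>Over the rationals F is prime and divides d q, but d and q both have smaller degree in w
  than F.\<close>

lemma clear_denominators_irreducible:
  fixes F :: "('v::{finite,linorder}, int) mpoly"
  assumes irr: "irreducible (rat_mpoly F)" and eq: "l * F = d * q"
    and l: "l \<noteq> 0" "vdeg w l = 0" and d: "0 < vdeg w d" "vdeg w d < vdeg w F"
  shows False
proof -
  let ?r = "rat_mpoly :: ('v, int) mpoly \<Rightarrow> ('v, rat) mpoly"
  have F0: "F \<noteq> 0" using irr by auto
  then have nz: "d \<noteq> 0" "q \<noteq> 0" using eq l by auto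
  have "vdeg w (l * F) = vdeg w (d * q)" using eq by simp
  then have deg: "vdeg w F = vdeg w d + vdeg w q"
    unfolding vdeg_mult[OF l(1) F0] vdeg_mult[OF nz] using l by simp
  have "?r l * ?r F = ?r d * ?r q" using eq by (simp add: rat_mpoly.hom_mult[symmetric])
  then have "?r F dvd ?r d * ?r q" by (metis dvd_triv_right)
  then have "?r F dvd ?r d \<or> ?r F dvd ?r q" by (rule mpoly_irreducible_dvd_mult[OF irr])
  moreover have "\<not> ?r F dvd ?r p" if "p \<noteq> 0" "vdeg w p < vdeg w F" for p
  proof
    assume "?r F dvd ?r p"
    then obtain e where e: "?r p = ?r F * e" by blast
    then have "e \<noteq> 0" using that(1) by auto
    then have "vdeg w (?r p) = vdeg w (?r F) + vdeg w e" unfolding e using F0 by (intro vdeg_mult) auto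
    then show False using that(2) unfolding vdeg_rat_mpoly by simp
  qed
  ultimately show False using nz d deg by auto
qed

lemma degree_split_thin:
  fixes F :: "('v::{finite,linorder}, int) mpoly"
  assumes irr: "irreducible (rat_mpoly F)" and \<epsilon>: "\<epsilon> > 0" and e: "0 < e" "e < vdeg w F"
  shows "thin (- {w}) \<epsilon> (\<lambda>u. ev u (lead_coeff (toP w F)) \<noteq> 0 \<and>
     (\<exists>D Q :: rat poly. map_poly of_int (evP u (toP w F)) = D * Q \<and> degree D = e))"
proof -
  define P where "P = toP w F"
  define n where "n = degree P"
  define h where "h = lead_coeff P"
  define V where "V = - {w}"
  have n: "n = vdeg w F" unfolding n_def P_def vdeg_def ..
  have F0: "F \<noteq> 0" using irr by auto
  have h0: "h \<noteq> 0" unfolding h_def P_def using F0 by simp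
  have PV: "mvars (coeff P k) \<subseteq> V" for k unfolding P_def V_def using mvars_coeff_toP[of w F k] by auto
  have finV: "finite V" by simp
  have "\<exists>\<Phi>. lead_coeff \<Phi> = 1 \<and> (\<forall>j. mvars (coeff \<Phi> j) \<subseteq> - {w}) \<and>
    (\<forall>u ys. u w = 0 \<longrightarrow> (\<forall>i<e. poly (map_poly of_int (evP u (monicize P))) (ys i) = 0) \<longrightarrow>
       poly (map_poly of_int (evP u \<Phi>)) (coeff (\<Prod>i<e. [:- ys i, complex_of_int (ev u h):]) k) = 0)" for k
    by (rule factor_coeff_equation)
  then obtain \<Phi> where \<Phi>1: "\<And>k. lead_coeff (\<Phi> k) = 1" and \<Phi>2: "\<And>k j. mvars (coeff (\<Phi> k) j) \<subseteq> V"
    and \<Phi>3: "\<And>k u ys. u w = 0 \<Longrightarrow> (\<And>i. i < e \<Longrightarrow> poly (map_poly of_int (evP u (monicize P))) (ys i) = 0) \<Longrightarrow>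
       poly (map_poly of_int (evP u (\<Phi> k))) (coeff (\<Prod>i<e. [:- ys i, complex_of_int (ev u h):]) k) = 0"
    unfolding V_def by metis
  define Pr where "Pr k T \<longleftrightarrow> fst T \<noteq> 0 \<and> finite (snd T) \<and> (\<forall>r\<in>snd T. mvars r \<subseteq> V) \<and>
      thin V \<epsilon> (\<lambda>u. \<exists>z. poly (evP u (\<Phi> k)) z = 0 \<and> (\<forall>r\<in>snd T. fst T * z \<noteq> ev u r))"
    for k and T :: "int \<times> ('v, int) mpoly set"
  have ex: "\<exists>T. Pr k T" for k
  proof -
    obtain q R C where *: "q \<noteq> 0" "finite R" "\<forall>r\<in>R. mvars r \<subseteq> V" "C \<ge> 0"
      "\<forall>N\<ge>1. real (card {x \<in> ibox V N. \<exists>z. poly (evP x (\<Phi> k)) z = 0 \<and> (\<forall>r\<in>R. q * z \<noteq> ev x r)})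
        \<le> C * real N powr (real (card V) - 1/2 + \<epsilon>)"
      using integer_roots_covered[OF finV \<Phi>1 \<Phi>2 \<epsilon>, of k] by blast
    have "thin V \<epsilon> (\<lambda>u. \<exists>z. poly (evP u (\<Phi> k)) z = 0 \<and> (\<forall>r\<in>R. q * z \<noteq> ev u r))"
      unfolding thin_def using *(4,5) by blast
    then have "Pr k (q, R)" unfolding Pr_def fst_conv snd_conv using *(1-3) by blast
    then show ?thesis by blast
  qed
  define T where "T k = (SOME T. Pr k T)" for k
  have T: "Pr k (T k)" for k unfolding T_def by (rule someI_ex[OF ex])
  define q R where "q k = fst (T k)" and "R k = snd (T k)" for k
  note T' = T[unfolded Pr_def, folded q_def R_def]
  have q0: "q k \<noteq> 0" for k by (rule T'[THEN conjunct1])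
  have finR: "finite (R k)" for k by (rule T'[THEN conjunct2, THEN conjunct1])
  have RV: "\<forall>r\<in>R k. mvars r \<subseteq> V" for k by (rule T'[THEN conjunct2, THEN conjunct2, THEN conjunct1])
  have exc: "thin V \<epsilon> (\<lambda>u. \<exists>z. poly (evP u (\<Phi> k)) z = 0 \<and> (\<forall>r\<in>R k. q k * z \<noteq> ev u r))" for k
    by (rule T'[THEN conjunct2, THEN conjunct2, THEN conjunct2])
  \<comment> \<open>The coefficients are covered with different denominators q k; their product
    makes all of them values of polynomials at once. The factor is scaled by h^e, so the top
    coefficient of \<open>Dc\<close> is Q0 h^e.\<close>
  define Q0 where "Q0 = (\<Prod>i<e. q i)"
  have Q0: "Q0 \<noteq> 0" unfolding Q0_def using q0 by simp
  define Dc where "Dc c = (\<Sum>k<e. monom (mconst (\<Prod>i\<in>{..<e} - {k}. q i) * c k) k) + monom (mconst Q0 * h ^ e) e"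
    for c :: "nat \<Rightarrow> ('v, int) mpoly"
  have Dc_coeff: "coeff (Dc c) k = (if k < e then mconst (\<Prod>i\<in>{..<e} - {k}. q i) * c k else if k = e then mconst Q0 * h ^ e else 0)" for c k
    unfolding Dc_def coeff_add coeff_sum_monom by auto
  have "(mconst Q0 :: ('v, int) mpoly) \<noteq> 0"
  proof
    assume "(mconst Q0 :: ('v, int) mpoly) = 0"
    then have "Poly_Mapping.lookup (mconst Q0 :: ('v, int) mpoly) 0 = 0" by (simp only: lookup_zero)
    then show False using Q0 by (simp only: lookup_single_eq)
  qed
  then have top0: "mconst Q0 * h ^ e \<noteq> 0" using h0 by simp
  have Dc_deg: "degree (Dc c) = e" for c
  proof (rule antisym)
    show "degree (Dc c) \<le> e" by (rule degree_le) (simp add: Dc_coeff)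
    show "e \<le> degree (Dc c)" using top0 by (intro le_degree) (simp add: Dc_coeff)
  qed
  define CC where "CC = (\<Pi>\<^sub>E k\<in>{..<e}. R k)"
  have finCC: "finite CC" unfolding CC_def by (intro finite_PiE finR) auto
  \<comment> \<open>c0 will be the leading coefficient of the pseudo-remainder of P by
    \<open>Dc c\<close>: a nonzero polynomial that vanishes wherever the two specializations share a
    factor of the full degree e.\<close>
  define Pc where "Pc c c0 \<longleftrightarrow> c0 \<noteq> 0 \<and> mvars c0 \<subseteq> V \<and> (\<forall>u D. D dvd map_poly complex_of_int (evP u P) \<longrightarrow>
      degree D = e \<longrightarrow> D dvd map_poly complex_of_int (evP u (Dc c)) \<longrightarrow> ev u c0 = 0)" for c c0
  have rem: "\<exists>c0. Pc c c0" if c: "c \<in> CC" for c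
  proof -
    have DcV: "mvars (coeff (Dc c) k) \<subseteq> V" for k
    proof -
      have cV: "mvars (c k) \<subseteq> V" if "k < e" using c RV that unfolding CC_def by blast
      have "mvars (h ^ e) \<subseteq> V" using mvars_power[of h e] PV unfolding h_def by blast
      then show ?thesis
        using cV mvars_mult[of "mconst (\<Prod>i\<in>{..<e} - {k}. q i)" "c k"] mvars_mult[of "mconst Q0" "h ^ e"]
        unfolding Dc_coeff by auto
    qed
    have D0: "Dc c \<noteq> 0" using Dc_deg[of c] e by auto
    have "\<exists>j Q R. (\<forall>k. mvars (coeff Q k) \<subseteq> V) \<and> (\<forall>k. mvars (coeff R k) \<subseteq> V) \<and>
       smult (lead_coeff (Dc c) ^ j) P = Dc c * Q + R \<and> (R = 0 \<or> degree R < degree (Dc c))"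
    proof (rule pseudo_division)
      fix a b :: "('v, int) mpoly" assume "mvars a \<subseteq> V" "mvars b \<subseteq> V"
      then show "mvars (a + b) \<subseteq> V" "mvars (a - b) \<subseteq> V" "mvars (a * b) \<subseteq> V"
        using mvars_add[of a b] mvars_diff[of a b] mvars_mult[of a b] by blast+
    qed (use D0 DcV PV in auto)
    then obtain j Q R where QV: "\<And>k. mvars (coeff Q k) \<subseteq> V" and RRV: "\<And>k. mvars (coeff R k) \<subseteq> V"
      and pd: "smult (lead_coeff (Dc c) ^ j) P = Dc c * Q + R" and dR: "R = 0 \<or> degree R < e"
      unfolding Dc_deg by blast
    \<comment> \<open>Otherwise a w-free multiple of F would be divisible by a polynomial of degree
      e in w, with e strictly between 0 and the degree of F.\<close>
    have R0: "R \<noteq> 0"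
    proof
      assume "R = 0"
      define l where "l = lead_coeff (Dc c) ^ j"
      have l0: "l \<noteq> 0" unfolding l_def using D0 by simp
      have "mvars l \<subseteq> V" unfolding l_def using mvars_power[of "lead_coeff (Dc c)" j] DcV by blast
      then have lw: "vdeg w l = 0" unfolding vdeg_eq_0_iff V_def by auto
      have "poly (smult l P) (mvar w) = poly (Dc c * Q) (mvar w)" using pd \<open>R = 0\<close> unfolding l_def by simp
      then have eq: "l * F = poly (Dc c) (mvar w) * poly Q (mvar w)" unfolding P_def by simp
      have "w \<notin> mvars (coeff (Dc c) k)" for k using DcV[of k] unfolding V_def by auto
      then have "vdeg w (poly (Dc c) (mvar w)) = e" unfolding vdeg_def by (subst toP_poly) (auto simp: Dc_deg)
      then show False using clear_denominators_irreducible[OF irr eq l0 lw] e by simp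
    qed
    show ?thesis unfolding Pc_def
    proof (intro exI[of _ "lead_coeff R"] conjI allI impI)
      show "lead_coeff R \<noteq> 0" using R0 by simp
      show "mvars (lead_coeff R) \<subseteq> V" by (rule RRV)
      fix u and D :: "complex poly"
      assume D: "D dvd map_poly complex_of_int (evP u P)" "degree D = e" "D dvd map_poly complex_of_int (evP u (Dc c))"
      interpret h: map_poly_comm_ring_hom "\<lambda>p. complex_of_int (ev u p)"
        unfolding map_poly_comm_ring_hom_def by (rule comm_ring_hom_comp[OF comm_ring_hom_of_int comm_ring_hom_ev])
      let ?m = "map_poly (\<lambda>p. complex_of_int (ev u p))"
      have "?m (smult (lead_coeff (Dc c) ^ j) P) = ?m (Dc c) * ?m Q + ?m R"
        unfolding pd h.hom_add h.hom_mult ..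
      then have "?m R = smult (complex_of_int (ev u (lead_coeff (Dc c) ^ j))) (?m P) - ?m (Dc c) * ?m Q"
        by (simp only: h.base.map_poly_hom_smult) simp
      moreover have "D dvd smult (complex_of_int (ev u (lead_coeff (Dc c) ^ j))) (?m P) - ?m (Dc c) * ?m Q"
        using D by (intro dvd_diff dvd_smult dvd_mult2) (simp_all only: map_poly_comp_of_int)
      ultimately have "D dvd ?m R" by simp
      \<comment> \<open>D divides the specialized remainder and has larger degree, so the remainder
        vanishes at u altogether.\<close>
      moreover have "degree (?m R) < degree D" using dR R0 D(2) degree_map_poly_le[of "\<lambda>p. complex_of_int (ev u p)" R] by linarith
      ultimately have "?m R = 0" using dvd_imp_degree_le by (metis not_le)
      then have "coeff (?m R) (degree R) = 0" by simp
      then show "ev u (lead_coeff R) = 0" by (simp add: coeff_map_poly)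
    qed
  qed
  define c0 where "c0 c = (SOME c0. Pc c c0)" for c
  have c0: "Pc c (c0 c)" if "c \<in> CC" for c unfolding c0_def by (rule someI_ex[OF rem[OF that]])
  have c0': "c0 c \<noteq> 0" "mvars (c0 c) \<subseteq> V" if "c \<in> CC" for c
    using c0[OF that] unfolding Pc_def by blast+
  have c0z: "ev u (c0 c) = 0" if "c \<in> CC" "D dvd map_poly complex_of_int (evP u P)"
      "degree D = e" "D dvd map_poly complex_of_int (evP u (Dc c))" for c u D
    using c0[OF that(1)] that(2-4) unfolding Pc_def by blast
  have t1: "thin V \<epsilon> (\<lambda>u. \<exists>k\<in>{..<e}. \<exists>z. poly (evP u (\<Phi> k)) z = 0 \<and> (\<forall>r\<in>R k. q k * z \<noteq> ev u r))"
    by (rule thin_finite_ex[OF _ finV exc]) simp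
  have t2: "thin V \<epsilon> (\<lambda>u. \<exists>c\<in>CC. ev u (c0 c) = 0)"
    by (rule thin_finite_ex[OF finCC finV thin_zeros[OF finV _ _ \<epsilon>]]) (use c0' in auto)
  show ?thesis unfolding V_def[symmetric] P_def[symmetric] h_def[symmetric]
  proof (rule thin_mono[OF thin_disj[OF t1 t2 finV] finV])
    fix u assume uV: "\<And>v. v \<notin> V \<Longrightarrow> u v = 0"
      and fact: "ev u h \<noteq> 0 \<and> (\<exists>D Q :: rat poly. map_poly of_int (evP u P) = D * Q \<and> degree D = e)"
    have uw: "u w = 0" by (rule uV) (simp add: V_def)
    have hu: "ev u h \<noteq> 0" using fact by blast
    obtain D0 Q1 :: "rat poly" where D0: "map_poly of_int (evP u P) = D0 * Q1" "degree D0 = e" using fact by blast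
    have D00: "D0 \<noteq> 0" using D0(2) e by auto
    define D where "D = smult (inverse (lead_coeff D0)) D0"
    have Dm: "lead_coeff D = 1" "degree D = e" unfolding D_def using D00 D0(2) by auto
    have Ddvd: "D dvd map_poly of_int (evP u P)" unfolding D0(1) D_def using D00 by (simp add: smult_dvd_iff)
    define cD where "cD = map_poly (of_rat :: rat \<Rightarrow> complex) D"
    interpret rt: map_poly_comm_ring_hom "of_rat :: rat \<Rightarrow> complex"
      by unfold_locales (simp_all add: of_rat_add of_rat_mult)
    have cDm: "degree cD = e" "lead_coeff cD = 1"
      unfolding cD_def using monic_map_poly[OF Dm(1), of "of_rat :: rat \<Rightarrow> complex"] Dm(2) by auto
    have cP: "map_poly complex_of_int (evP u P) = map_poly of_rat (map_poly of_int (evP u P))"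
      by (rule poly_eqI) (simp add: coeff_map_poly)
    have cDdvd: "cD dvd map_poly complex_of_int (evP u P)"
      unfolding cP cD_def using Ddvd by (auto elim!: dvdE simp: rt.hom_mult)
    obtain as where as: "smult (coeff cD (degree cD)) (\<Prod>a\<leftarrow>as. [:- a, 1:]) = cD" "length as = degree cD"
      using fundamental_theorem_algebra_factorized[of cD] by blast
    have as': "cD = (\<Prod>i<e. [:- (as ! i), 1:])" "length as = e"
      using as cDm by (auto simp: prod.list_conv_set_nth lessThan_atLeast0)
    \<comment> \<open>Scaled by h(u), the roots of the factor become roots of
      \<open>monicize P\<close>, as the equations \<Phi> k require.\<close>
    define ys where "ys i = of_int (ev u h) * as ! i" for i
    have ys: "poly (map_poly of_int (evP u (monicize P))) (ys i) = 0" if i: "i < e" for i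
    proof -
      have "poly cD (as ! i) = 0" unfolding as'(1) poly_prod using i by (intro prod_zero) auto
      then have z: "poly (map_poly of_int (evP u P)) (as ! i) = 0" using cDdvd by (auto elim!: dvdE)
      have hom: "comm_ring_hom (\<lambda>p. complex_of_int (ev u p))"
        by (rule comm_ring_hom_comp[OF comm_ring_hom_of_int comm_ring_hom_ev])
      have "degree P > 0" using e n unfolding n_def by simp
      from poly_monicize[OF hom this, of "as ! i"] show ?thesis
        unfolding ys_def map_poly_comp_of_int h_def[symmetric] using z by simp
    qed
    define E where "E = (\<Prod>i<e. [:- ys i, complex_of_int (ev u h):])"
    have E: "E = smult (of_int (ev u h) ^ e) cD"
    proof -
      have "E = (\<Prod>i<e. smult (of_int (ev u h)) [:- (as ! i), 1:])" unfolding E_def ys_def by simp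
      also have "\<dots> = smult (of_int (ev u h) ^ e) (\<Prod>i<e. [:- (as ! i), 1:])"
        unfolding prod_smult by simp
      finally show ?thesis unfolding as'(1) .
    qed
    have cz: "\<exists>z. coeff E k = of_int z \<and> poly (evP u (\<Phi> k)) z = 0" for k
    proof -
      \<comment> \<open>The coefficient is assembled from complex roots but is rational, because the
        factor has rational coefficients. As a root of a monic integer polynomial it is therefore an
        integer.\<close>
      have ce: "coeff E k = of_rat (of_int (ev u h) ^ e * coeff D k)"
        unfolding E cD_def by (simp add: coeff_map_poly of_rat_mult of_rat_power)
      have "poly (map_poly of_int (evP u (\<Phi> k))) (coeff E k) = 0" unfolding E_def by (rule \<Phi>3[OF uw ys])
      then have rt: "poly (map_poly of_int (evP u (\<Phi> k))) (of_rat (of_int (ev u h) ^ e * coeff D k) :: complex) = 0"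
        unfolding ce .
      have "lead_coeff (evP u (\<Phi> k)) = 1" by (rule monic_map_poly(2)[OF \<Phi>1]) auto
      from rational_root_of_monic_int[OF this rt]
      obtain z where z: "of_int (ev u h) ^ e * coeff D k = of_int z" "poly (evP u (\<Phi> k)) z = 0" by blast
      have "coeff E k = of_int z" unfolding ce z(1) by simp
      then show ?thesis using z(2) by blast
    qed
    show "(\<exists>k\<in>{..<e}. \<exists>z. poly (evP u (\<Phi> k)) z = 0 \<and> (\<forall>r\<in>R k. q k * z \<noteq> ev u r)) \<or> (\<exists>c\<in>CC. ev u (c0 c) = 0)"
      unfolding disj_imp
    proof (rule impI)
      assume ne: "\<not> (\<exists>k\<in>{..<e}. \<exists>z. poly (evP u (\<Phi> k)) z = 0 \<and> (\<forall>r\<in>R k. q k * z \<noteq> ev u r))"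
      have "\<exists>r. r \<in> R k \<and> of_int (q k) * coeff E k = of_int (ev u r)" if ke: "k < e" for k
      proof -
        obtain z where z: "coeff E k = of_int z" "poly (evP u (\<Phi> k)) z = 0" using cz by blast
        then obtain r where "r \<in> R k" "q k * z = ev u r" using ne ke by blast
        then show ?thesis using z(1) by (metis of_int_mult)
      qed
      then obtain c where c: "\<And>k. k < e \<Longrightarrow> c k \<in> R k \<and> of_int (q k) * coeff E k = of_int (ev u (c k))" by metis
      define c' where "c' = restrict c {..<e}"
      have c'C: "c' \<in> CC" unfolding CC_def c'_def using c by auto
      have "map_poly complex_of_int (evP u (Dc c')) = smult (of_int Q0) E"
      proof (rule poly_eqI)
        fix k
        consider "k < e" | "k = e" | "k > e" by linarith
        then show "coeff (map_poly complex_of_int (evP u (Dc c'))) k = coeff (smult (of_int Q0) E) k"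
        proof cases
          case 1
          have "Q0 = q k * (\<Prod>i\<in>{..<e} - {k}. q i)" unfolding Q0_def using 1 by (intro prod.remove) auto
          moreover have "of_int (ev u (c' k)) = of_int (q k) * coeff E k" using c[OF 1] 1 unfolding c'_def by simp
          ultimately show ?thesis using 1 by (simp add: coeff_map_poly Dc_coeff ev.hom_mult)
        next
          case 2
          have "coeff E e = of_int (ev u h) ^ e" unfolding E using cDm by simp
          then show ?thesis unfolding 2 by (simp add: coeff_map_poly Dc_coeff ev.hom_mult ev.hom_power)
        next
          case 3
          then have "coeff E k = 0" unfolding E using cDm by (simp add: coeff_eq_0)
          then show ?thesis using 3 by (simp add: coeff_map_poly Dc_coeff)
        qed
      qed
      then have "cD dvd map_poly complex_of_int (evP u (Dc c'))" unfolding E by (simp add: dvd_smult)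
      then have "ev u (c0 c') = 0" using c0z[OF c'C cDdvd cDm(1)] by blast
      then show "\<exists>c\<in>CC. ev u (c0 c) = 0" using c'C by blast
    qed
  qed
qed

lemma split_thin:
  fixes F :: "('v::{finite,linorder}, int) mpoly"
  assumes irr: "irreducible (rat_mpoly F)" and \<epsilon>: "\<epsilon> > 0"
  shows "thin (- {w}) \<epsilon> (\<lambda>u. ev u (lead_coeff (toP w F)) \<noteq> 0 \<and>
     (\<exists>D Q :: rat poly. map_poly of_int (evP u (toP w F)) = D * Q \<and> 0 < degree D \<and> degree D < vdeg w F))"
proof -
  have "thin (- {w}) \<epsilon> (\<lambda>u. \<exists>e\<in>{0<..<vdeg w F}. ev u (lead_coeff (toP w F)) \<noteq> 0 \<and>
     (\<exists>D Q :: rat poly. map_poly of_int (evP u (toP w F)) = D * Q \<and> degree D = e))"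
    by (rule thin_finite_ex) (use degree_split_thin[OF irr \<epsilon>] in auto)
  then show ?thesis
  proof (rule thin_mono)
    fix u
    assume u: "ev u (lead_coeff (toP w F)) \<noteq> 0 \<and>
      (\<exists>D Q :: rat poly. map_poly of_int (evP u (toP w F)) = D * Q \<and> 0 < degree D \<and> degree D < vdeg w F)"
    then obtain D Q :: "rat poly" where "map_poly of_int (evP u (toP w F)) = D * Q" "0 < degree D" "degree D < vdeg w F"
      by blast
    with u show "\<exists>e\<in>{0<..<vdeg w F}. ev u (lead_coeff (toP w F)) \<noteq> 0 \<and>
       (\<exists>D Q :: rat poly. map_poly of_int (evP u (toP w F)) = D * Q \<and> degree D = e)"
      by (intro bexI[of _ "degree D"] conjI exI[of _ D] exI[of _ Q]) simp_all
  qed simp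
qed

section \<open>Extending homomorphisms of subfields\<close>

definition is_subfield :: "'k::field set \<Rightarrow> bool" where
  "is_subfield E \<longleftrightarrow> 1 \<in> E \<and> (\<forall>x\<in>E. \<forall>y\<in>E. x + y \<in> E \<and> x * y \<in> E) \<and> (\<forall>x\<in>E. - x \<in> E \<and> inverse x \<in> E)"

lemma is_subfieldD:
  assumes "is_subfield E"
  shows "1 \<in> E" "0 \<in> E" "x \<in> E \<Longrightarrow> y \<in> E \<Longrightarrow> x + y \<in> E" "x \<in> E \<Longrightarrow> y \<in> E \<Longrightarrow> x * y \<in> E"
    "x \<in> E \<Longrightarrow> - x \<in> E" "x \<in> E \<Longrightarrow> inverse x \<in> E" "x \<in> E \<Longrightarrow> y \<in> E \<Longrightarrow> x - y \<in> E"
    "x \<in> E \<Longrightarrow> y \<in> E \<Longrightarrow> x / y \<in> E"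
proof -
  show 1: "1 \<in> E" using assms by (simp add: is_subfield_def)
  show add: "x + y \<in> E" if "x \<in> E" "y \<in> E" for x y using assms that by (simp add: is_subfield_def)
  show mult: "x * y \<in> E" if "x \<in> E" "y \<in> E" for x y using assms that by (simp add: is_subfield_def)
  show neg: "- x \<in> E" if "x \<in> E" for x using assms that by (simp add: is_subfield_def)
  show inv: "inverse x \<in> E" if "x \<in> E" for x using assms that by (simp add: is_subfield_def)
  show "0 \<in> E" using add[OF 1 neg[OF 1]] by simp
  show "x - y \<in> E" if "x \<in> E" "y \<in> E" for x y using add[OF that(1) neg[OF that(2)]] by simp
  show "x / y \<in> E" if "x \<in> E" "y \<in> E" for x y using mult[OF that(1) inv[OF that(2)]] by (simp add: divide_inverse)
qed

text \<open>A homomorphism is a total function on the ambient field of which only the values on E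
  matter, so extending it along a tower of subfields involves no change of type.\<close>

definition hom_on :: "'k::field set \<Rightarrow> ('k \<Rightarrow> 'k) \<Rightarrow> bool" where
  "hom_on E \<sigma> \<longleftrightarrow> \<sigma> 1 = 1 \<and> (\<forall>x\<in>E. \<forall>y\<in>E. \<sigma> (x + y) = \<sigma> x + \<sigma> y \<and> \<sigma> (x * y) = \<sigma> x * \<sigma> y)"

lemma hom_on_zero:
  assumes "is_subfield E" "hom_on E \<sigma>" shows "\<sigma> 0 = 0"
proof -
  have "\<sigma> (0 + 0) = \<sigma> 0 + \<sigma> 0" using assms is_subfieldD(2)[OF assms(1)] unfolding hom_on_def by blast
  then have "\<sigma> 0 = \<sigma> 0 + \<sigma> 0" by (simp only: add_0_right)
  then show ?thesis by (simp only: add_cancel_right_right)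
qed

lemma hom_on_uminus:
  assumes "is_subfield E" "hom_on E \<sigma>" "x \<in> E" shows "\<sigma> (- x) = - \<sigma> x"
proof -
  have "\<sigma> (x + - x) = \<sigma> x + \<sigma> (- x)" using assms is_subfieldD(5)[OF assms(1,3)] unfolding hom_on_def by blast
  then show ?thesis using hom_on_zero[OF assms(1,2)] by (simp add: eq_neg_iff_add_eq_0 add.commute)
qed

lemma hom_on_inverse:
  assumes "is_subfield E" "hom_on E \<sigma>" "x \<in> E" shows "\<sigma> (inverse x) = inverse (\<sigma> x)"
proof (cases "x = 0")
  case False
  have "\<sigma> (x * inverse x) = \<sigma> x * \<sigma> (inverse x)" using assms is_subfieldD(6)[OF assms(1,3)] unfolding hom_on_def by blast
  then have "\<sigma> x * \<sigma> (inverse x) = 1" using False assms(2) unfolding hom_on_def by simp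
  then show ?thesis by (metis inverse_unique)
qed (use hom_on_zero[OF assms(1,2)] in simp)

lemma hom_on_inj:
  assumes "is_subfield E" "hom_on E \<sigma>" shows "inj_on \<sigma> E"
proof (rule inj_onI)
  fix x y assume xy: "x \<in> E" "y \<in> E" "\<sigma> x = \<sigma> y"
  have d: "x - y \<in> E" using is_subfieldD(7)[OF assms(1) xy(1,2)] .
  have "\<sigma> (x + - y) = \<sigma> x + \<sigma> (- y)" using assms xy is_subfieldD(5)[OF assms(1)] unfolding hom_on_def by blast
  then have z: "\<sigma> (x - y) = 0" using hom_on_uminus[OF assms xy(2)] xy(3) by simp
  show "x = y"
  proof (rule ccontr)
    assume "x \<noteq> y"
    then have "(x - y) * inverse (x - y) = 1" by simp
    moreover have "\<sigma> ((x - y) * inverse (x - y)) = \<sigma> (x - y) * \<sigma> (inverse (x - y))"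
      using assms(2) d is_subfieldD(6)[OF assms(1) d] unfolding hom_on_def by blast
    ultimately show False using z assms(2) unfolding hom_on_def by simp
  qed
qed

definition poly_over :: "'k::field set \<Rightarrow> 'k poly \<Rightarrow> bool" where
  "poly_over E p \<longleftrightarrow> (\<forall>i. coeff p i \<in> E)"

lemma subfield_sum: "is_subfield E \<Longrightarrow> (\<And>i. i \<in> A \<Longrightarrow> f i \<in> E) \<Longrightarrow> sum f A \<in> E"
  by (induction A rule: infinite_finite_induct) (auto intro: is_subfieldD)

lemma poly_over_add: "is_subfield E \<Longrightarrow> poly_over E p \<Longrightarrow> poly_over E q \<Longrightarrow> poly_over E (p + q)"
  unfolding poly_over_def by (auto intro: is_subfieldD)

lemma poly_over_uminus: "is_subfield E \<Longrightarrow> poly_over E p \<Longrightarrow> poly_over E (- p)"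
  unfolding poly_over_def by (auto intro: is_subfieldD)

lemma poly_over_mult: "is_subfield E \<Longrightarrow> poly_over E p \<Longrightarrow> poly_over E q \<Longrightarrow> poly_over E (p * q)"
  unfolding poly_over_def coeff_mult by (auto intro!: subfield_sum is_subfieldD)

lemma poly_over_const: "is_subfield E \<Longrightarrow> c \<in> E \<Longrightarrow> poly_over E [:c:]"
  unfolding poly_over_def by (auto simp: coeff_pCons is_subfieldD split: nat.split)

lemma poly_over_linear: "is_subfield E \<Longrightarrow> poly_over E [:0, 1:]"
  unfolding poly_over_def by (auto simp: coeff_pCons is_subfieldD split: nat.splits)

lemma subfield_poly: "is_subfield E \<Longrightarrow> poly_over E p \<Longrightarrow> x \<in> E \<Longrightarrow> poly p x \<in> E"
proof -
  assume E: "is_subfield E" "poly_over E p" "x \<in> E"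
  have "x ^ k \<in> E" for k using E by (induction k) (auto intro: is_subfieldD)
  then show ?thesis unfolding poly_altdef using E
    by (auto intro!: subfield_sum is_subfieldD simp: poly_over_def)
qed

lemma hom_on_sum:
  assumes "is_subfield E" "hom_on E \<sigma>" "\<And>i. i \<in> A \<Longrightarrow> f i \<in> E"
  shows "\<sigma> (sum f A) = (\<Sum>i\<in>A. \<sigma> (f i))"
  using assms(3)
proof (induction A rule: infinite_finite_induct)
  case (insert a A)
  have "\<sigma> (f a + sum f A) = \<sigma> (f a) + \<sigma> (sum f A)"
    using assms(2) subfield_sum[OF assms(1), of A f] insert.prems unfolding hom_on_def by auto
  then show ?case using insert by simp
qed (use hom_on_zero[OF assms(1,2)] in auto)

lemma map_poly_hom_on_add:
  assumes "is_subfield E" "hom_on E \<sigma>" "poly_over E p" "poly_over E q"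
  shows "map_poly \<sigma> (p + q) = map_poly \<sigma> p + map_poly \<sigma> q"
  by (rule poly_eqI) (use assms hom_on_zero[OF assms(1,2)] in \<open>simp add: coeff_map_poly poly_over_def hom_on_def\<close>)

lemma map_poly_hom_on_uminus:
  assumes "is_subfield E" "hom_on E \<sigma>" "poly_over E p"
  shows "map_poly \<sigma> (- p) = - map_poly \<sigma> p"
  by (rule poly_eqI)
     (use assms hom_on_zero[OF assms(1,2)] hom_on_uminus[OF assms(1,2)] in \<open>simp add: coeff_map_poly poly_over_def\<close>)

lemma map_poly_hom_on_mult:
  assumes "is_subfield E" "hom_on E \<sigma>" "poly_over E p" "poly_over E q"
  shows "map_poly \<sigma> (p * q) = map_poly \<sigma> p * map_poly \<sigma> q"
proof (rule poly_eqI)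
  fix n
  note s0 = hom_on_zero[OF assms(1,2)]
  have in1: "coeff p i * coeff q (n - i) \<in> E" for i using assms unfolding poly_over_def by (auto intro: is_subfieldD)
  have "\<sigma> (coeff p i * coeff q (n - i)) = \<sigma> (coeff p i) * \<sigma> (coeff q (n - i))" for i
    using assms unfolding poly_over_def hom_on_def by blast
  then show "coeff (map_poly \<sigma> (p * q)) n = coeff (map_poly \<sigma> p * map_poly \<sigma> q) n"
    using hom_on_sum[OF assms(1,2), of "{..n}" "\<lambda>i. coeff p i * coeff q (n - i)"] in1
    by (simp add: coeff_map_poly s0 coeff_mult)
qed

definition adjoin :: "'k::field set \<Rightarrow> 'k \<Rightarrow> 'k set" where
  "adjoin E x = {poly p x / poly q x | p q. poly_over E p \<and> poly_over E q \<and> poly q x \<noteq> 0}"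

lemma adjoinI: "poly_over E p \<Longrightarrow> poly_over E q \<Longrightarrow> poly q x \<noteq> 0 \<Longrightarrow> poly p x / poly q x \<in> adjoin E x"
  unfolding adjoin_def by blast

lemma adjoin_subfield:
  assumes E: "is_subfield E" shows "is_subfield (adjoin E x)"
proof -
  have one: "poly_over E 1" using poly_over_const[OF E is_subfieldD(1)[OF E]] by (simp add: one_pCons)
  have "1 \<in> adjoin E x" using adjoinI[OF one one, of x] by simp
  moreover have "a + b \<in> adjoin E x \<and> a * b \<in> adjoin E x" if ab: "a \<in> adjoin E x" "b \<in> adjoin E x" for a b
  proof -
    obtain p q where a: "a = poly p x / poly q x" "poly_over E p" "poly_over E q" "poly q x \<noteq> 0" using ab(1) unfolding adjoin_def by blast
    obtain r s where b: "b = poly r x / poly s x" "poly_over E r" "poly_over E s" "poly s x \<noteq> 0" using ab(2) unfolding adjoin_def by blast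
    have qs: "poly (q * s) x \<noteq> 0" using a b by simp
    have ov: "poly_over E (p * s)" "poly_over E (r * q)" "poly_over E (q * s)" "poly_over E (p * r)"
      by (intro poly_over_mult[OF E] a b)+
    have "a + b = poly (p * s + r * q) x / poly (q * s) x" using a b by (simp add: add_frac_eq)
    then have "a + b \<in> adjoin E x" using adjoinI[OF poly_over_add[OF E ov(1,2)] ov(3) qs] by simp
    moreover have "a * b = poly (p * r) x / poly (q * s) x" using a b by simp
    then have "a * b \<in> adjoin E x" using adjoinI[OF ov(4,3) qs] by simp
    ultimately show ?thesis by blast
  qed
  moreover have "- a \<in> adjoin E x \<and> inverse a \<in> adjoin E x" if ab: "a \<in> adjoin E x" for a
  proof -
    obtain p q where a: "a = poly p x / poly q x" "poly_over E p" "poly_over E q" "poly q x \<noteq> 0" using ab unfolding adjoin_def by blast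
    have "- a = poly (- p) x / poly q x" using a by simp
    then have 1: "- a \<in> adjoin E x" using adjoinI[OF poly_over_uminus[OF E a(2)] a(3,4)] by simp
    show ?thesis
    proof (cases "poly p x = 0")
      case True
      then have "a = 0" using a by simp
      have "poly 0 x / poly 1 x \<in> adjoin E x"
        by (rule adjoinI) (use one in \<open>auto simp: poly_over_def is_subfieldD(2)[OF E]\<close>)
      then show ?thesis using \<open>a = 0\<close> by simp
    next
      case False
      have "inverse a = poly q x / poly p x" using a by simp
      then show ?thesis using 1 adjoinI[OF a(3,2) False] by simp
    qed
  qed
  ultimately show ?thesis unfolding is_subfield_def by blast
qed

lemma adjoin_superset:
  assumes E: "is_subfield E" shows "E \<subseteq> adjoin E x" "x \<in> adjoin E x"
proof -
  have one: "poly_over E 1" using poly_over_const[OF E is_subfieldD(1)[OF E]] by (simp add: one_pCons)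
  show "E \<subseteq> adjoin E x"
  proof
    fix c assume "c \<in> E"
    then show "c \<in> adjoin E x" using adjoinI[OF poly_over_const[OF E] one, of c x] by simp
  qed
  show "x \<in> adjoin E x" using adjoinI[OF poly_over_linear[OF E] one, of x] by simp
qed

lemma adjoin_minimal:
  assumes "is_subfield F" "E \<subseteq> F" "x \<in> F" shows "adjoin E x \<subseteq> F"
proof
  fix a assume "a \<in> adjoin E x"
  then obtain p q where a: "a = poly p x / poly q x" "poly_over E p" "poly_over E q" unfolding adjoin_def by blast
  then have "poly_over F p" "poly_over F q" using assms(2) unfolding poly_over_def by auto
  then show "a \<in> F" unfolding a(1) using assms by (intro is_subfieldD(8) subfield_poly)
qed

text \<open>Since x and y satisfy corresponding equations over E, sending p(x)/q(x) to the quotient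
  of the \<sigma>-images of p and q at y does not depend on the representation. The hypothesis is an
  equivalence so that denominators stay nonzero at y.\<close>

lemma extend_hom:
  assumes E: "is_subfield E" and \<sigma>: "hom_on E \<sigma>"
    and xy: "\<And>p. poly_over E p \<Longrightarrow> poly p x = 0 \<longleftrightarrow> poly (map_poly \<sigma> p) y = 0"
  shows "\<exists>\<tau>. hom_on (adjoin E x) \<tau> \<and> (\<forall>a\<in>E. \<tau> a = \<sigma> a) \<and> \<tau> x = y"
proof -
  let ?m = "map_poly \<sigma>"
  note s0 = hom_on_zero[OF E \<sigma>]
  have s1: "\<sigma> 1 = 1" using \<sigma> unfolding hom_on_def by simp
  have one: "poly_over E 1" using poly_over_const[OF E is_subfieldD(1)[OF E]] by (simp add: one_pCons)
  define rep where "rep a = (SOME pq. poly_over E (fst pq) \<and> poly_over E (snd pq) \<and> poly (snd pq) x \<noteq> 0 \<and> a = poly (fst pq) x / poly (snd pq) x)" for a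
  have rep: "poly_over E (fst (rep a)) \<and> poly_over E (snd (rep a)) \<and> poly (snd (rep a)) x \<noteq> 0 \<and> a = poly (fst (rep a)) x / poly (snd (rep a)) x"
    if aE: "a \<in> adjoin E x" for a
  proof -
    obtain p q where "poly_over E p" "poly_over E q" "poly q x \<noteq> 0" "a = poly p x / poly q x" using aE unfolding adjoin_def by blast
    then have "\<exists>pq. poly_over E (fst pq) \<and> poly_over E (snd pq) \<and> poly (snd pq) x \<noteq> 0 \<and> a = poly (fst pq) x / poly (snd pq) x"
      by (intro exI[of _ "(p, q)"]) simp
    then show ?thesis unfolding rep_def by (rule someI_ex)
  qed
  define \<tau> where "\<tau> a = poly (?m (fst (rep a))) y / poly (?m (snd (rep a))) y" for a
  have val: "\<tau> (poly p x / poly q x) = poly (?m p) y / poly (?m q) y"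
    if pq: "poly_over E p" "poly_over E q" "poly q x \<noteq> 0" for p q
  proof -
    let ?a = "poly p x / poly q x"
    define r s where "r = fst (rep ?a)" and "s = snd (rep ?a)"
    have rs: "poly_over E r" "poly_over E s" "poly s x \<noteq> 0" "?a = poly r x / poly s x"
      using rep[OF adjoinI[OF pq]] unfolding r_def s_def by auto
    have "poly (p * s + - (r * q)) x = 0" using rs(4) pq(3) rs(3) by (simp add: frac_eq_eq)
    moreover have ov: "poly_over E (p * s)" "poly_over E (- (r * q))" "poly_over E (r * q)"
      using pq rs E by (auto intro: poly_over_mult poly_over_uminus)
    ultimately have "poly (?m (p * s + - (r * q))) y = 0" using xy[OF poly_over_add[OF E ov(1,2)]] by blast
    then have "poly (?m p) y * poly (?m s) y = poly (?m r) y * poly (?m q) y"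
      unfolding map_poly_hom_on_add[OF E \<sigma> ov(1,2)] map_poly_hom_on_uminus[OF E \<sigma> ov(3)]
        map_poly_hom_on_mult[OF E \<sigma> pq(1) rs(2)] map_poly_hom_on_mult[OF E \<sigma> rs(1) pq(2)] by simp
    moreover have "poly (?m s) y \<noteq> 0" "poly (?m q) y \<noteq> 0" using xy[OF rs(2)] xy[OF pq(2)] rs(3) pq(3) by auto
    ultimately show ?thesis unfolding \<tau>_def r_def[symmetric] s_def[symmetric] by (simp add: frac_eq_eq)
  qed
  have vale: "\<tau> a = \<sigma> a" if "a \<in> E" for a
    using val[OF poly_over_const[OF E that] one] by (simp add: map_poly_const s0 s1)
  have valx: "\<tau> x = y"
    using val[OF poly_over_linear[OF E] one] by (simp add: map_poly_linear s0 s1)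
  have "hom_on (adjoin E x) \<tau>"
    unfolding hom_on_def
  proof (intro conjI ballI)
    show "\<tau> 1 = 1" using vale[OF is_subfieldD(1)[OF E]] s1 by simp
    fix a b assume ab: "a \<in> adjoin E x" "b \<in> adjoin E x"
    obtain p q where a: "a = poly p x / poly q x" "poly_over E p" "poly_over E q" "poly q x \<noteq> 0" using ab(1) unfolding adjoin_def by blast
    obtain r s where b: "b = poly r x / poly s x" "poly_over E r" "poly_over E s" "poly s x \<noteq> 0" using ab(2) unfolding adjoin_def by blast
    have nz: "poly (?m q) y \<noteq> 0" "poly (?m s) y \<noteq> 0" using xy[OF a(3)] xy[OF b(3)] a(4) b(4) by auto
    have ov: "poly_over E (p * s)" "poly_over E (r * q)" "poly_over E (q * s)" "poly_over E (p * r)"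
      using a b E by (auto intro: poly_over_mult)
    have qs: "poly (q * s) x \<noteq> 0" using a b by simp
    have "a + b = poly (p * s + r * q) x / poly (q * s) x" using a b by (simp add: add_frac_eq)
    then have "\<tau> (a + b) = poly (?m (p * s + r * q)) y / poly (?m (q * s)) y"
      using val[OF poly_over_add[OF E ov(1,2)] ov(3) qs] by simp
    also have "\<dots> = poly (?m p) y / poly (?m q) y + poly (?m r) y / poly (?m s) y"
      unfolding map_poly_hom_on_add[OF E \<sigma> ov(1,2)] map_poly_hom_on_mult[OF E \<sigma> a(2) b(3)]
        map_poly_hom_on_mult[OF E \<sigma> b(2) a(3)] map_poly_hom_on_mult[OF E \<sigma> a(3) b(3)]
      using nz by (simp add: add_frac_eq)
    also have "\<dots> = \<tau> a + \<tau> b" unfolding a(1) b(1) val[OF a(2-4)] val[OF b(2-4)] ..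
    finally show "\<tau> (a + b) = \<tau> a + \<tau> b" .
    have "a * b = poly (p * r) x / poly (q * s) x" using a b by simp
    then have "\<tau> (a * b) = poly (?m (p * r)) y / poly (?m (q * s)) y" using val[OF ov(4,3) qs] by simp
    also have "\<dots> = (poly (?m p) y / poly (?m q) y) * (poly (?m r) y / poly (?m s) y)"
      unfolding map_poly_hom_on_mult[OF E \<sigma> a(2) b(2)] map_poly_hom_on_mult[OF E \<sigma> a(3) b(3)] by simp
    also have "\<dots> = \<tau> a * \<tau> b" unfolding a(1) b(1) val[OF a(2-4)] val[OF b(2-4)] ..
    finally show "\<tau> (a * b) = \<tau> a * \<tau> b" .
  qed
  then show ?thesis using vale valx by blast
qed

lemma poly_over_division:
  assumes E: "is_subfield E" and p: "poly_over E p" and m: "poly_over E m" "m \<noteq> 0"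
  shows "\<exists>q r. poly_over E q \<and> poly_over E r \<and> p = m * q + r \<and> (r = 0 \<or> degree r < degree m)"
proof -
  have "\<exists>e Q R. (\<forall>k. coeff Q k \<in> E) \<and> (\<forall>k. coeff R k \<in> E) \<and>
     smult (lead_coeff m ^ e) p = m * Q + R \<and> (R = 0 \<or> degree R < degree m)"
    by (rule pseudo_division) (use E p m in \<open>auto intro: is_subfieldD simp: poly_over_def\<close>)
  then obtain e Q R where QR: "poly_over E Q" "poly_over E R" "smult (lead_coeff m ^ e) p = m * Q + R" "R = 0 \<or> degree R < degree m"
    unfolding poly_over_def by blast
  define c where "c = inverse (lead_coeff m ^ e)"
  have "lead_coeff m ^ e \<in> E" using m E unfolding poly_over_def by (induction e) (auto intro: is_subfieldD)
  then have cE: "c \<in> E" unfolding c_def using E by (intro is_subfieldD)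
  have "p = smult c (smult (lead_coeff m ^ e) p)" unfolding c_def using m(2) by simp
  also have "\<dots> = m * smult c Q + smult c R" unfolding QR(3) by (simp add: smult_add_right)
  finally have eq: "p = m * smult c Q + smult c R" .
  have "poly_over E (smult c Q)" "poly_over E (smult c R)" using QR(1,2) cE E unfolding poly_over_def by (auto intro: is_subfieldD)
  moreover have "smult c R = 0 \<or> degree (smult c R) < degree m" using QR(4) degree_smult_le[of c R] by auto
  ultimately show ?thesis using eq by blast
qed

text \<open>Let m be of least degree with root x, and y a root of its image. That p vanishes at x if
  its image vanishes at y is seen as follows: a polynomial n of least degree whose image vanishes at
  y divides m, and the cofactor has too small a degree to vanish at x, so n does.\<close>

lemma extend_hom_algebraic:
  fixes E :: "'k::alg_closed_field set"
  assumes E: "is_subfield E" and \<sigma>: "hom_on E \<sigma>"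
    and alg: "poly_over E f" "f \<noteq> 0" "poly f x = 0"
  shows "\<exists>\<tau>. hom_on (adjoin E x) \<tau> \<and> (\<forall>a\<in>E. \<tau> a = \<sigma> a)"
proof -
  let ?m = "map_poly \<sigma>"
  note s0 = hom_on_zero[OF E \<sigma>]
  have s_inj: "\<sigma> c = 0 \<longleftrightarrow> c = 0" if "c \<in> E" for c
    using hom_on_inj[OF E \<sigma>] that is_subfieldD(2)[OF E] s0 by (metis inj_on_eq_iff)
  have degm: "degree (?m p) = degree p" if "poly_over E p" for p
    using that s_inj by (intro degree_map_poly) (auto simp: poly_over_def)
  obtain m where m: "poly_over E m" "m \<noteq> 0" "poly m x = 0"
    and mmin: "\<And>p. poly_over E p \<Longrightarrow> p \<noteq> 0 \<Longrightarrow> poly p x = 0 \<Longrightarrow> degree m \<le> degree p"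
    using ex_has_least_nat[of "\<lambda>p. poly_over E p \<and> p \<noteq> 0 \<and> poly p x = 0" f degree] alg by blast
  have "degree m > 0"
  proof (rule ccontr)
    assume "\<not> degree m > 0"
    then obtain c where "m = [:c:]" by (auto elim: degree_eq_zeroE)
    then show False using m by simp
  qed
  then have "degree (?m m) > 0" using degm[OF m(1)] by simp
  then obtain y where y: "poly (?m m) y = 0" using alg_closed_imp_poly_has_root by blast
  have dvd_m: "\<exists>q. poly_over E q \<and> p = m * q" if p: "poly_over E p" "poly p x = 0" for p
  proof -
    obtain q r where qr: "poly_over E q" "poly_over E r" "p = m * q + r" "r = 0 \<or> degree r < degree m"
      using poly_over_division[OF E p(1) m(1,2)] by blast
    have "poly r x = 0" using p(2) m(3) qr(3) by simp
    then have "r = 0" using mmin[OF qr(2)] qr(4) by (metis not_le)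
    then show ?thesis using qr by auto
  qed
  have fwd: "poly (?m p) y = 0" if p: "poly_over E p" "poly p x = 0" for p
  proof -
    obtain q where "poly_over E q" "p = m * q" using dvd_m[OF p] by blast
    then show ?thesis using map_poly_hom_on_mult[OF E \<sigma> m(1)] y by simp
  qed
  obtain n where n: "poly_over E n" "n \<noteq> 0" "poly (?m n) y = 0"
    and nmin: "\<And>p. poly_over E p \<Longrightarrow> p \<noteq> 0 \<Longrightarrow> poly (?m p) y = 0 \<Longrightarrow> degree n \<le> degree p"
    using ex_has_least_nat[of "\<lambda>p. poly_over E p \<and> p \<noteq> 0 \<and> poly (?m p) y = 0" m degree] m y by blast
  have dvd_n: "\<exists>q. poly_over E q \<and> p = n * q" if p: "poly_over E p" "poly (?m p) y = 0" for p
  proof -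
    obtain q r where qr: "poly_over E q" "poly_over E r" "p = n * q + r" "r = 0 \<or> degree r < degree n"
      using poly_over_division[OF E p(1) n(1,2)] by blast
    have "?m p = ?m n * ?m q + ?m r"
      unfolding qr(3) using map_poly_hom_on_add[OF E \<sigma> poly_over_mult[OF E n(1) qr(1)] qr(2)]
        map_poly_hom_on_mult[OF E \<sigma> n(1) qr(1)] by simp
    then have "poly (?m r) y = 0" using p(2) n(3) by simp
    then have "r = 0" using nmin[OF qr(2)] qr(4) by (metis not_le)
    then show ?thesis using qr by auto
  qed
  obtain q where q: "poly_over E q" "m = n * q" using dvd_n[OF m(1) y] by blast
  have "degree n > 0"
  proof (rule ccontr)
    assume "\<not> degree n > 0"
    then obtain c where c: "n = [:c:]" by (auto elim: degree_eq_zeroE)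
    then have "c \<in> E" "c \<noteq> 0" using n by (auto simp: poly_over_def dest: spec[of _ 0])
    then show False using n(3) s_inj unfolding c by (simp add: map_poly_const s0)
  qed
  have qn: "q \<noteq> 0" using q m by auto
  then have "degree m = degree n + degree q" unfolding q(2) using n by (intro degree_mult_eq) auto
  then have "degree q < degree m" using \<open>degree n > 0\<close> by simp
  then have "poly q x \<noteq> 0" using mmin[OF q(1) qn] by auto
  then have nx: "poly n x = 0" using m(3) q(2) by simp
  have bwd: "poly p x = 0" if "poly_over E p" "poly (?m p) y = 0" for p
    using dvd_n[OF that] nx by auto
  have "\<exists>\<tau>. hom_on (adjoin E x) \<tau> \<and> (\<forall>a\<in>E. \<tau> a = \<sigma> a) \<and> \<tau> x = y"
    by (rule extend_hom[OF E \<sigma>]) (use fwd bwd in blast)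
  then show ?thesis by blast
qed

lemma extend_hom_finite:
  fixes E :: "'k::alg_closed_field set"
  assumes A: "finite A" "\<And>x. x \<in> A \<Longrightarrow> \<exists>f. poly_over E f \<and> f \<noteq> 0 \<and> poly f x = 0"
    and E: "is_subfield E" "hom_on E \<sigma>"
  shows "\<exists>M \<tau>. is_subfield M \<and> E \<union> A \<subseteq> M \<and> hom_on M \<tau> \<and> (\<forall>a\<in>E. \<tau> a = \<sigma> a) \<and>
     (\<forall>F. is_subfield F \<longrightarrow> E \<union> A \<subseteq> F \<longrightarrow> M \<subseteq> F)"
  using A
proof (induction A rule: finite_induct)
  case empty
  then show ?case using E by (intro exI[of _ E] exI[of _ \<sigma>]) auto
next
  case (insert x A)
  then obtain M \<tau> where M: "is_subfield M" "E \<union> A \<subseteq> M" "hom_on M \<tau>" "\<forall>a\<in>E. \<tau> a = \<sigma> a"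
    "\<And>F. is_subfield F \<Longrightarrow> E \<union> A \<subseteq> F \<Longrightarrow> M \<subseteq> F" by blast
  obtain f where f: "poly_over E f" "f \<noteq> 0" "poly f x = 0" using insert.prems by blast
  have "poly_over M f" using f(1) M(2) unfolding poly_over_def by blast
  from extend_hom_algebraic[OF M(1,3) this f(2,3)] obtain \<upsilon> where u: "hom_on (adjoin M x) \<upsilon>" "\<forall>a\<in>M. \<upsilon> a = \<tau> a" by blast
  show ?case
  proof (intro exI conjI allI impI)
    show "is_subfield (adjoin M x)" by (rule adjoin_subfield[OF M(1)])
    show "E \<union> insert x A \<subseteq> adjoin M x" using M(2) adjoin_superset[OF M(1), of x] by blast
    show "hom_on (adjoin M x) \<upsilon>" by fact
    show "\<forall>a\<in>E. \<upsilon> a = \<sigma> a" using u(2) M(2,4) by auto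
    fix F assume "is_subfield F" "E \<union> insert x A \<subseteq> F"
    then show "adjoin M x \<subseteq> F" using M(5)[of F] by (intro adjoin_minimal) auto
  qed
qed

text \<open>The identity on E first extends to E(x) with the prescribed value y at x, and then over
  the finitely many elements of A one at a time.\<close>

lemma ex_hom_moving_root:
  fixes E :: "'k::alg_closed_field set"
  assumes A: "finite A" "\<And>x. x \<in> A \<Longrightarrow> \<exists>f. poly_over E f \<and> f \<noteq> 0 \<and> poly f x = 0"
    and E: "is_subfield E" and xy: "x \<in> A" "\<And>p. poly_over E p \<Longrightarrow> poly p x = 0 \<longleftrightarrow> poly p y = 0"
  shows "\<exists>M \<tau>. is_subfield M \<and> E \<union> A \<subseteq> M \<and> hom_on M \<tau> \<and> (\<forall>a\<in>E. \<tau> a = a) \<and> \<tau> x = y \<and>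
     (\<forall>F. is_subfield F \<longrightarrow> E \<union> A \<subseteq> F \<longrightarrow> M \<subseteq> F)"
proof -
  have "hom_on E (\<lambda>a. a)" unfolding hom_on_def by simp
  moreover have "map_poly (\<lambda>a. a) p = p" for p :: "'k poly" by (rule poly_eqI) (simp add: coeff_map_poly)
  ultimately obtain \<sigma> where \<sigma>: "hom_on (adjoin E x) \<sigma>" "\<forall>a\<in>E. \<sigma> a = a" "\<sigma> x = y"
    using extend_hom[OF E, of "\<lambda>a. a" x y] xy(2) by auto
  have E': "is_subfield (adjoin E x)" by (rule adjoin_subfield[OF E])
  have "\<exists>f. poly_over (adjoin E x) f \<and> f \<noteq> 0 \<and> poly f z = 0" if "z \<in> A" for z
    using A(2)[OF that] adjoin_superset(1)[OF E, of x] unfolding poly_over_def by blast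
  from extend_hom_finite[OF A(1) this E' \<sigma>(1)] obtain M \<tau> where M: "is_subfield M" "adjoin E x \<union> A \<subseteq> M"
    "hom_on M \<tau>" "\<forall>a\<in>adjoin E x. \<tau> a = \<sigma> a" "\<And>F. is_subfield F \<Longrightarrow> adjoin E x \<union> A \<subseteq> F \<Longrightarrow> M \<subseteq> F" by blast
  show ?thesis
  proof (intro exI conjI allI impI)
    show "is_subfield M" "hom_on M \<tau>" by fact+
    show "E \<union> A \<subseteq> M" using M(2) adjoin_superset(1)[OF E, of x] by blast
    show "\<forall>a\<in>E. \<tau> a = a" using M(4) \<sigma>(2) adjoin_superset(1)[OF E, of x] by auto
    show "\<tau> x = y" using M(4) \<sigma>(3) adjoin_superset(2)[OF E, of x] by auto
    fix F assume F: "is_subfield F" "E \<union> A \<subseteq> F"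
    then have "adjoin E x \<subseteq> F" using xy(1) by (intro adjoin_minimal) auto
    then show "M \<subseteq> F" using M(5)[OF F(1)] F(2) by blast
  qed
qed

section \<open>The Galois group acts transitively\<close>

definition in_closure :: "('v::linorder, rat) mpoly \<Rightarrow> 'v closure" where
  "in_closure p = to_ac (Fraction_Field.Fract p 1)"

lemma comm_ring_hom_in_closure: "comm_ring_hom (in_closure :: ('v::linorder, rat) mpoly \<Rightarrow> _)"
proof (unfold_locales)
  show "in_closure 0 = (0 :: 'v closure)" unfolding in_closure_def by (simp add: Zero_fract_def[symmetric])
  show "in_closure 1 = (1 :: 'v closure)" unfolding in_closure_def by (simp add: One_fract_def[symmetric])
  fix p q :: "('v, rat) mpoly"
  show "in_closure (p + q) = in_closure p + in_closure q"
    unfolding in_closure_def to_ac_add[symmetric] by simp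
  show "in_closure (p * q) = in_closure p * in_closure q"
    unfolding in_closure_def to_ac_mult[symmetric] by simp
qed

interpretation in_closure: comm_ring_hom in_closure by (rule comm_ring_hom_in_closure)

lemma in_closure_eq_0_iff [simp]: "in_closure p = 0 \<longleftrightarrow> p = 0"
proof -
  have "in_closure p = 0 \<longleftrightarrow> Fraction_Field.Fract p 1 = 0" unfolding in_closure_def by simp
  also have "\<dots> \<longleftrightarrow> p = 0" unfolding Zero_fract_def by (subst eq_fract) auto
  finally show ?thesis .
qed

lemma to_ac_Fract: "q \<noteq> 0 \<Longrightarrow> to_ac (Fraction_Field.Fract p q) = in_closure p / in_closure q"
  unfolding in_closure_def to_ac_divide[symmetric] by simp

lemma function_field_eq:
  "function_field w = {in_closure p / in_closure q | p q. q \<noteq> 0 \<and> w \<notin> mvars p \<and> w \<notin> mvars q}"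
  unfolding function_field_def by (rule Collect_cong, intro ex_cong1) (auto simp: to_ac_Fract)

lemma in_closure_function_field: "w \<notin> mvars p \<Longrightarrow> in_closure p \<in> function_field w"
  unfolding function_field_eq by (rule CollectI, rule exI[of _ p], rule exI[of _ 1]) simp

lemma function_fieldI:
  "q \<noteq> 0 \<Longrightarrow> w \<notin> mvars p \<Longrightarrow> w \<notin> mvars q \<Longrightarrow> in_closure p / in_closure q \<in> function_field w"
  unfolding function_field_eq by blast

lemma function_fieldE:
  assumes "a \<in> function_field w"
  obtains p q where "a = in_closure p / in_closure q" "q \<noteq> 0" "w \<notin> mvars p" "w \<notin> mvars q"
  using assms unfolding function_field_eq by blast

lemma function_field_subfield: "is_subfield (function_field (w :: 'v::linorder))"
  unfolding is_subfield_def
proof (intro conjI ballI)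
  show "1 \<in> function_field w" using in_closure_function_field[of w 1] by simp
  fix a assume a: "a \<in> function_field w"
  obtain p q where pq: "a = in_closure p / in_closure q" "q \<noteq> 0" "w \<notin> mvars p" "w \<notin> mvars q"
    by (rule function_fieldE[OF a])
  have "- a = in_closure (- p) / in_closure q" unfolding pq(1) by (simp add: in_closure.hom_uminus)
  then show "- a \<in> function_field w" using function_fieldI[OF pq(2), of w "- p"] pq by simp
  show "inverse a \<in> function_field w"
  proof (cases "p = 0")
    case True
    then show ?thesis using pq in_closure_function_field[of w 0] by simp
  next
    case False
    have "inverse a = in_closure q / in_closure p" unfolding pq(1) by simp
    then show ?thesis using function_fieldI[OF False pq(4,3)] by simp
  qed
  fix b assume b: "b \<in> function_field w"
  obtain r s where rs: "b = in_closure r / in_closure s" "s \<noteq> 0" "w \<notin> mvars r" "w \<notin> mvars s"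
    by (rule function_fieldE[OF b])
  have qs: "q * s \<noteq> 0" "w \<notin> mvars (q * s)" using pq rs mvars_mult[of q s] by auto
  have "a + b = in_closure (p * s + r * q) / in_closure (q * s)"
    unfolding pq(1) rs(1) using pq(2) rs(2) by (simp add: in_closure.hom_add in_closure.hom_mult add_frac_eq)
  moreover have "w \<notin> mvars (p * s + r * q)"
    using mvars_add[of "p * s" "r * q"] mvars_mult[of p s] mvars_mult[of r q] pq rs by blast
  ultimately show "a + b \<in> function_field w" using function_fieldI[OF qs(1) _ qs(2)] by simp
  have "a * b = in_closure (p * r) / in_closure (q * s)"
    unfolding pq(1) rs(1) by (simp add: in_closure.hom_mult)
  moreover have "w \<notin> mvars (p * r)" using mvars_mult[of p r] pq rs by blast
  ultimately show "a * b \<in> function_field w" using function_fieldI[OF qs(1) _ qs(2)] by simp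
qed

text \<open>Substituting x for w alone, with the other variables kept as elements of the closure,
  turns a polynomial in all variables into an equation over the function field.\<close>

definition eval_at :: "'v::linorder \<Rightarrow> 'v closure \<Rightarrow> ('v, rat) mpoly \<Rightarrow> 'v closure" where
  "eval_at w x p = poly (map_poly in_closure (toP w p)) x"

lemma comm_ring_hom_eval_at: "comm_ring_hom (eval_at w x)"
  unfolding eval_at_def
  by (rule comm_ring_hom_comp[OF comm_ring_hom_poly comm_ring_hom_comp[OF comm_ring_hom_map_poly[OF comm_ring_hom_in_closure] comm_ring_hom_toP]])

interpretation eval_at: comm_ring_hom "eval_at w x" for w x by (rule comm_ring_hom_eval_at)

lemma eval_at_no_var: "w \<notin> mvars p \<Longrightarrow> eval_at w x p = in_closure p"
  unfolding eval_at_def by (simp add: toP_no_var map_poly_const)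

lemma eval_at_mvar: "eval_at w x (mvar w) = x"
  unfolding eval_at_def by (simp add: toP_mvar map_poly_linear)

definition root_poly :: "'v::linorder \<Rightarrow> ('v, int) mpoly \<Rightarrow> 'v closure poly" where
  "root_poly w f = map_poly in_closure (toP w (rat_mpoly f))"

lemma root_set_eq: "root_set w f = {x. poly (root_poly w f) x = 0}"
proof -
  have "map_poly (\<lambda>c. to_ac (Fraction_Field.Fract (rat_mpoly c) 1)) (poly_in w f) = root_poly w f"
    unfolding root_poly_def toP_rat_mpoly poly_in_eq_toP in_closure_def[symmetric]
    by (rule poly_eqI) (simp add: coeff_map_poly)
  then show ?thesis unfolding root_set_def by (simp only:)
qed

lemma root_set_eval_at: "x \<in> root_set w f \<longleftrightarrow> eval_at w x (rat_mpoly f) = 0"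
  unfolding root_set_eq root_poly_def eval_at_def by simp

lemma root_poly_over: "poly_over (function_field w) (root_poly w f)"
  unfolding poly_over_def root_poly_def using mvars_coeff_toP[of w "rat_mpoly f"]
  by (auto simp: coeff_map_poly intro!: in_closure_function_field)

lemma root_poly_nonzero: "f \<noteq> 0 \<Longrightarrow> root_poly w f \<noteq> 0"
  unfolding root_poly_def by (subst map_poly_eq_0_iff) auto

lemma finite_root_set: "f \<noteq> 0 \<Longrightarrow> finite (root_set w f)"
  unfolding root_set_eq by (intro poly_roots_finite root_poly_nonzero)

lemma clear_denominators:
  assumes "poly_over (function_field w) p"
  shows "\<exists>P d. d \<noteq> 0 \<and> w \<notin> mvars d \<and> (\<forall>x. eval_at w x P = in_closure d * poly p x)"
  using assms
proof (induction p)
  case 0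
  show ?case by (rule exI[of _ 0], rule exI[of _ 1]) (simp only: eval_at.hom_zero mvars_1 poly_0 mult_zero_right, simp)
next
  case (pCons c p)
  have "poly_over (function_field w) p" unfolding poly_over_def
  proof
    fix i show "coeff p i \<in> function_field w"
      using pCons.prems[unfolded poly_over_def, rule_format, of "Suc i"] by simp
  qed
  then obtain P d where P: "d \<noteq> 0" "w \<notin> mvars d" "\<And>x. eval_at w x P = in_closure d * poly p x" using pCons.IH by blast
  have "c \<in> function_field w" using pCons.prems[unfolded poly_over_def, rule_format, of 0] by simp
  then obtain a b where ab: "c = in_closure a / in_closure b" "b \<noteq> 0" "w \<notin> mvars a" "w \<notin> mvars b"
    by (rule function_fieldE)
  show ?case
  proof (intro exI conjI allI)
    show "d * b \<noteq> 0" using P ab by simp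
    show "w \<notin> mvars (d * b)" using P ab mvars_mult[of d b] by blast
    fix x
    have "eval_at w x (d * a + b * mvar w * P) = in_closure d * in_closure a + in_closure b * x * (in_closure d * poly p x)"
      using P ab by (simp add: eval_at.hom_add eval_at.hom_mult eval_at_no_var eval_at_mvar)
    also have "\<dots> = in_closure (d * b) * poly (pCons c p) x"
      using ab(2) by (simp add: in_closure.hom_mult ab(1) field_simps)
    finally show "eval_at w x (d * a + b * mvar w * P) = in_closure (d * b) * poly (pCons c p) x" .
  qed
qed

text \<open>f acts as the minimal polynomial of each of its roots. If f did not divide the
  polynomial P obtained from p by clearing denominators, a Bezout identity would produce a nonzero
  polynomial free of w vanishing at x, which is impossible for a nonzero element of the function
  field.\<close>

lemma roots_conjugate:
  fixes f :: "('v::{finite,linorder}, int) mpoly"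
  assumes irr: "irreducible (rat_mpoly f)" and w: "w \<in> mvars f"
    and xy: "x \<in> root_set w f" "y \<in> root_set w f"
    and p: "poly_over (function_field w) p" "poly p x = 0"
  shows "poly p y = 0"
proof -
  obtain P d where P: "d \<noteq> 0" "w \<notin> mvars d" "\<And>x. eval_at w x P = in_closure d * poly p x"
    using clear_denominators[OF p(1)] by blast
  have fx: "eval_at w x (rat_mpoly f) = 0" "eval_at w y (rat_mpoly f) = 0" using xy root_set_eval_at by auto
  have Px: "eval_at w x P = 0" using P(3) p(2) by simp
  have "rat_mpoly f dvd P"
  proof (rule ccontr)
    assume "\<not> rat_mpoly f dvd P"
    moreover have "w \<in> mvars (rat_mpoly f)" using w by simp
    ultimately obtain s a b where s: "s \<noteq> 0" "w \<notin> mvars s" "s = a * rat_mpoly f + b * P"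
      using mpoly_irreducible_bezout[OF irr] by blast
    have "eval_at w x s = 0" unfolding s(3) using fx Px by (simp add: eval_at.hom_add eval_at.hom_mult)
    then show False using s eval_at_no_var[OF s(2)] by simp
  qed
  then obtain e where "P = rat_mpoly f * e" by blast
  then have "eval_at w y P = 0" using fx by (simp add: eval_at.hom_mult)
  then show ?thesis using P by simp
qed

section \<open>The splitting field as a generated subfield\<close>

lemma ring_of_type_algebra_sel:
  "carrier ring_of_type_algebra = UNIV" "x \<otimes>\<^bsub>ring_of_type_algebra\<^esub> y = x * y"
  "\<one>\<^bsub>ring_of_type_algebra\<^esub> = 1" "\<zero>\<^bsub>ring_of_type_algebra\<^esub> = 0"
  "x \<oplus>\<^bsub>ring_of_type_algebra\<^esub> y = x + y"
  unfolding ring_of_type_algebra_def by simp_all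

lemma ring_of_type_algebra_a_inv:
  fixes h :: "'k::field"
  shows "a_inv ring_of_type_algebra h = - h"
proof -
  interpret R: Ring.field "ring_of_type_algebra :: 'k ring" by (rule field_from_type_algebra)
  show ?thesis by (rule R.minus_equality) (simp_all add: ring_of_type_algebra_sel)
qed

lemma ring_of_type_algebra_m_inv:
  fixes h :: "'k::field"
  assumes "h \<noteq> 0"
  shows "m_inv ring_of_type_algebra h = inverse h"
proof -
  interpret R: Ring.field "ring_of_type_algebra :: 'k ring" by (rule field_from_type_algebra)
  have "inverse h = m_inv ring_of_type_algebra h"
    by (rule R.inv_unique') (use assms in \<open>simp_all add: ring_of_type_algebra_sel\<close>)
  then show ?thesis ..
qed

lemma generate_field_least:
  fixes H :: "'k::field set"
  assumes M: "is_subfield M" "H \<subseteq> M"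
  shows "generate_field ring_of_type_algebra H \<subseteq> M"
proof
  fix x :: 'k assume "x \<in> generate_field ring_of_type_algebra H"
  then show "x \<in> M"
    by induction (use M in \<open>auto simp: ring_of_type_algebra_sel ring_of_type_algebra_a_inv ring_of_type_algebra_m_inv intro: is_subfieldD\<close>)
qed

lemma generate_field_subfield:
  fixes H :: "'k::field set"
  shows "is_subfield (generate_field ring_of_type_algebra H)"
proof -
  let ?G = "generate_field ring_of_type_algebra H"
  have one: "1 \<in> ?G" using generate_field.one[of ring_of_type_algebra H] by (simp add: ring_of_type_algebra_sel)
  have add: "x + y \<in> ?G" if "x \<in> ?G" "y \<in> ?G" for x y
    using generate_field.eng_add[OF that] by (simp add: ring_of_type_algebra_sel)
  have mul: "x * y \<in> ?G" if "x \<in> ?G" "y \<in> ?G" for x y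
    using generate_field.eng_mult[OF that] by (simp add: ring_of_type_algebra_sel)
  have neg: "- x \<in> ?G" if "x \<in> ?G" for x
    using generate_field.a_inv[OF that] by (simp add: ring_of_type_algebra_a_inv)
  have inv: "inverse x \<in> ?G" if "x \<in> ?G" for x
  proof (cases "x = 0")
    case True
    then show ?thesis using that by simp
  next
    case False
    then show ?thesis using generate_field.m_inv[OF that]
      by (simp add: ring_of_type_algebra_m_inv ring_of_type_algebra_sel)
  qed
  show ?thesis unfolding is_subfield_def by (intro conjI ballI one add mul neg inv)
qed

lemma hom_on_poly:
  assumes "is_subfield M" "hom_on M \<tau>" "poly_over M p" "x \<in> M" "\<And>i. \<tau> (coeff p i) = coeff p i"
  shows "\<tau> (poly p x) = poly p (\<tau> x)"
  using assms(3,5)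
proof (induction p)
  case 0
  then show ?case using hom_on_zero[OF assms(1,2)] by simp
next
  case (pCons c p)
  have pM: "poly_over M p" unfolding poly_over_def
  proof
    fix i show "coeff p i \<in> M" using pCons.prems(1)[unfolded poly_over_def, rule_format, of "Suc i"] by simp
  qed
  have cM: "c \<in> M" using pCons.prems(1)[unfolded poly_over_def, rule_format, of 0] by simp
  have IH: "\<tau> (poly p x) = poly p (\<tau> x)"
    by (rule pCons.IH[OF pM]) (use pCons.prems(2)[of "Suc i" for i] in simp)
  have px: "poly p x \<in> M" by (rule subfield_poly[OF assms(1) pM assms(4)])
  have xp: "x * poly p x \<in> M" by (rule is_subfieldD(4)[OF assms(1) assms(4) px])
  have "\<tau> (c + x * poly p x) = \<tau> c + \<tau> x * \<tau> (poly p x)"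
    using assms(2) cM px xp assms(4) unfolding hom_on_def by simp
  then show ?case using IH pCons.prems(2)[of 0] by simp
qed

lemma subfield_image:
  assumes "is_subfield M" "hom_on M \<tau>"
  shows "is_subfield (\<tau> ` M)"
  unfolding is_subfield_def
proof (intro conjI ballI)
  show "1 \<in> \<tau> ` M" using assms(2) is_subfieldD(1)[OF assms(1)] unfolding hom_on_def by (metis image_eqI)
  fix a assume "a \<in> \<tau> ` M"
  then obtain x where x: "x \<in> M" "a = \<tau> x" by blast
  show "- a \<in> \<tau> ` M" using hom_on_uminus[OF assms x(1)] is_subfieldD(5)[OF assms(1) x(1)] x(2) by (metis image_eqI)
  show "inverse a \<in> \<tau> ` M"
    using hom_on_inverse[OF assms x(1)] is_subfieldD(6)[OF assms(1) x(1)] x(2) by (metis image_eqI)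
  fix b assume "b \<in> \<tau> ` M"
  then obtain y where y: "y \<in> M" "b = \<tau> y" by blast
  have xy: "\<tau> (x + y) = a + b" "\<tau> (x * y) = a * b" using assms(2) x y unfolding hom_on_def by auto
  show "a + b \<in> \<tau> ` M" using xy(1) is_subfieldD(3)[OF assms(1) x(1) y(1)] by (metis image_eqI)
  show "a * b \<in> \<tau> ` M" using xy(2) is_subfieldD(4)[OF assms(1) x(1) y(1)] by (metis image_eqI)
qed

lemma subfield_vimage:
  assumes M: "is_subfield M" "hom_on M \<tau>" and N: "is_subfield N"
  shows "is_subfield {z \<in> M. \<tau> z \<in> N}"
  unfolding is_subfield_def
proof (intro conjI ballI)
  show "1 \<in> {z \<in> M. \<tau> z \<in> N}"
    using M(2) is_subfieldD(1)[OF M(1)] is_subfieldD(1)[OF N] unfolding hom_on_def by simp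
  fix a assume a: "a \<in> {z \<in> M. \<tau> z \<in> N}"
  then show "- a \<in> {z \<in> M. \<tau> z \<in> N}"
    using hom_on_uminus[OF M, of a] is_subfieldD(5)[OF M(1)] is_subfieldD(5)[OF N] by simp
  show "inverse a \<in> {z \<in> M. \<tau> z \<in> N}"
    using a hom_on_inverse[OF M, of a] is_subfieldD(6)[OF M(1)] is_subfieldD(6)[OF N] by simp
  fix b assume b: "b \<in> {z \<in> M. \<tau> z \<in> N}"
  have ab: "\<tau> (a + b) = \<tau> a + \<tau> b" "\<tau> (a * b) = \<tau> a * \<tau> b" using M(2) a b unfolding hom_on_def by auto
  show "a + b \<in> {z \<in> M. \<tau> z \<in> N}" using a b ab(1) is_subfieldD(3)[OF M(1)] is_subfieldD(3)[OF N] by simp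
  show "a * b \<in> {z \<in> M. \<tau> z \<in> N}" using a b ab(2) is_subfieldD(4)[OF M(1)] is_subfieldD(4)[OF N] by simp
qed

lemma hom_on_inv_into:
  assumes M: "is_subfield M" "hom_on M \<sigma>" and b: "bij_betw \<sigma> M M"
  shows "hom_on M (inv_into M \<sigma>)"
  unfolding hom_on_def
proof (intro conjI ballI)
  have inj: "inj_on \<sigma> M" and surj: "\<sigma> ` M = M" using b unfolding bij_betw_def by auto
  have "\<sigma> 1 = 1" using M(2) unfolding hom_on_def by simp
  then show "inv_into M \<sigma> 1 = 1" using inv_into_f_f[OF inj is_subfieldD(1)[OF M(1)]] by simp
  fix x y assume xy: "x \<in> M" "y \<in> M"
  define a b where ab: "a = inv_into M \<sigma> x" "b = inv_into M \<sigma> y"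
  have abM: "a \<in> M" "b \<in> M" unfolding ab using inv_into_into[of _ \<sigma> M] xy surj by auto
  have s: "\<sigma> a = x" "\<sigma> b = y" unfolding ab using f_inv_into_f[of _ \<sigma> M] xy surj by auto
  have "\<sigma> (a + b) = x + y" "\<sigma> (a * b) = x * y" using M(2) abM s unfolding hom_on_def by auto
  then show "inv_into M \<sigma> (x + y) = inv_into M \<sigma> x + inv_into M \<sigma> y"
    "inv_into M \<sigma> (x * y) = inv_into M \<sigma> x * inv_into M \<sigma> y"
    using inv_into_f_f[OF inj is_subfieldD(3)[OF M(1) abM]] inv_into_f_f[OF inj is_subfieldD(4)[OF M(1) abM]]
    unfolding ab[symmetric] by auto
qed

definition splitting_carrier :: "'v::linorder \<Rightarrow> ('v, int) mpoly \<Rightarrow> 'v closure set" where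
  "splitting_carrier w f = generate_field ring_of_type_algebra (function_field w \<union> root_set w f)"

lemma splitting_carrier_subfield: "is_subfield (splitting_carrier w f)"
  unfolding splitting_carrier_def by (rule generate_field_subfield)

lemma splitting_carrier_supset: "function_field w \<union> root_set w f \<subseteq> splitting_carrier w f"
  unfolding splitting_carrier_def by (blast intro: generate_field.incl)

lemma splitting_carrier_least:
  "is_subfield M \<Longrightarrow> function_field w \<union> root_set w f \<subseteq> M \<Longrightarrow> splitting_carrier w f \<subseteq> M"
  unfolding splitting_carrier_def by (rule generate_field_least)

lemma galois_automorphisms_iff:
  "\<sigma> \<in> galois_automorphisms w f \<longleftrightarrow> \<sigma> \<in> extensional (splitting_carrier w f) \<and>
     bij_betw \<sigma> (splitting_carrier w f) (splitting_carrier w f) \<and> hom_on (splitting_carrier w f) \<sigma> \<and>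
     (\<forall>a\<in>function_field w. \<sigma> a = a)"
  unfolding galois_automorphisms_def splitting_field_def splitting_carrier_def[symmetric] Bij_def Ring.ring_hom_def hom_on_def
  by (auto simp: ring_of_type_algebra_sel dest: bij_betwE)

lemma bij_betw_root_set:
  assumes f: "f \<noteq> 0" and \<tau>: "hom_on (splitting_carrier w f) \<tau>" "\<And>a. a \<in> function_field w \<Longrightarrow> \<tau> a = a"
  shows "bij_betw \<tau> (root_set w f) (root_set w f)"
proof -
  let ?L = "splitting_carrier w f"
  have L: "is_subfield ?L" by (rule splitting_carrier_subfield)
  have AL: "root_set w f \<subseteq> ?L" and KL: "function_field w \<subseteq> ?L" using splitting_carrier_supset[of w f] by auto
  have c: "coeff (root_poly w f) i \<in> function_field w" for i using root_poly_over[of w f] unfolding poly_over_def by blast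
  have po: "poly_over ?L (root_poly w f)" unfolding poly_over_def using c KL by blast
  have "\<tau> x \<in> root_set w f" if "x \<in> root_set w f" for x
  proof -
    have "\<tau> (poly (root_poly w f) x) = poly (root_poly w f) (\<tau> x)"
      by (rule hom_on_poly[OF L \<tau>(1) po]) (use that AL c \<tau>(2) in auto)
    then show ?thesis using that hom_on_zero[OF L \<tau>(1)] unfolding root_set_eq by simp
  qed
  then have "\<tau> ` root_set w f \<subseteq> root_set w f" by blast
  moreover have "inj_on \<tau> (root_set w f)" using hom_on_inj[OF L \<tau>(1)] AL by (rule inj_on_subset)
  ultimately show ?thesis unfolding bij_betw_def using endo_inj_surj[OF finite_root_set[OF f]] by blast
qed

text \<open>Such a homomorphism permutes the roots and so maps the generators of the splitting field
  onto themselves. Minimality is used twice: applied to the image it gives surjectivity, applied to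
  the preimage it shows that the field is mapped into itself.\<close>

lemma restrict_galois_automorphism:
  assumes f: "f \<noteq> 0" and \<tau>: "hom_on (splitting_carrier w f) \<tau>" "\<And>a. a \<in> function_field w \<Longrightarrow> \<tau> a = a"
  shows "restrict \<tau> (splitting_carrier w f) \<in> galois_automorphisms w f"
proof -
  let ?L = "splitting_carrier w f" and ?B = "function_field w \<union> root_set w f"
  have L: "is_subfield ?L" by (rule splitting_carrier_subfield)
  have "\<tau> ` root_set w f = root_set w f" using bij_betw_root_set[OF assms] unfolding bij_betw_def by blast
  moreover have "\<tau> ` function_field w = function_field w" using \<tau>(2) by simp
  ultimately have B: "\<tau> ` ?B = ?B" by (simp add: image_Un)
  have BL: "?B \<subseteq> ?L" by (rule splitting_carrier_supset)
  have "?L \<subseteq> \<tau> ` ?L" by (rule splitting_carrier_least[OF subfield_image[OF L \<tau>(1)]]) (use B BL in blast)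
  moreover have "?L \<subseteq> {z \<in> ?L. \<tau> z \<in> ?L}"
    by (rule splitting_carrier_least[OF subfield_vimage[OF L \<tau>(1) L]]) (use B BL in blast)
  ultimately have "\<tau> ` ?L = ?L" by blast
  then have b: "bij_betw (restrict \<tau> ?L) ?L ?L" using hom_on_inj[OF L \<tau>(1)] unfolding bij_betw_def by simp
  have h: "hom_on ?L (restrict \<tau> ?L)"
    using \<tau>(1) is_subfieldD(1,3,4)[OF L] unfolding hom_on_def by simp
  have "\<forall>a\<in>function_field w. restrict \<tau> ?L a = a" using \<tau>(2) BL by auto
  then show ?thesis unfolding galois_automorphisms_iff using b h by simp
qed

lemma galois_group_sel:
  "carrier (galois_group w f) = (\<lambda>\<sigma>. restrict \<sigma> (root_set w f)) ` galois_automorphisms w f"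
  "\<one>\<^bsub>galois_group w f\<^esub> = (\<lambda>x\<in>root_set w f. x)"
  unfolding galois_group_def BijGroup_def by simp_all

lemma galois_group_subgroup:
  assumes f: "f \<noteq> 0"
  shows "subgroup (carrier (galois_group w f)) (BijGroup (root_set w f))"
proof -
  let ?A = "root_set w f" and ?L = "splitting_carrier w f" and ?G = "galois_automorphisms w f"
  interpret B: group "BijGroup ?A" by (rule group_BijGroup)
  have L: "is_subfield ?L" by (rule splitting_carrier_subfield)
  have AL: "?A \<subseteq> ?L" and KL: "function_field w \<subseteq> ?L" using splitting_carrier_supset[of w f] by auto
  have D: "bij_betw \<sigma> ?L ?L" "hom_on ?L \<sigma>" "\<And>a. a \<in> function_field w \<Longrightarrow> \<sigma> a = a" if "\<sigma> \<in> ?G" for \<sigma>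
    using that unfolding galois_automorphisms_iff by auto
  have A: "bij_betw \<sigma> ?A ?A" if "\<sigma> \<in> ?G" for \<sigma> by (rule bij_betw_root_set[OF f D(2,3)[OF that]])
  have mem: "restrict \<sigma> ?A \<in> Bij ?A" if "\<sigma> \<in> ?G" for \<sigma>
    using A[OF that] unfolding Bij_def by (simp add: bij_betw_def)
  have id: "restrict (\<lambda>x. x) ?L \<in> ?G" by (rule restrict_galois_automorphism[OF f]) (simp_all add: hom_on_def)
  show ?thesis unfolding galois_group_sel
  proof (rule B.subgroupI)
    show "(\<lambda>\<sigma>. restrict \<sigma> ?A) ` ?G \<subseteq> carrier (BijGroup ?A)" using mem unfolding BijGroup_def by auto
    show "(\<lambda>\<sigma>. restrict \<sigma> ?A) ` ?G \<noteq> {}" using id by blast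
  next
    fix a assume "a \<in> (\<lambda>\<sigma>. restrict \<sigma> ?A) ` ?G"
    then obtain \<sigma> where \<sigma>: "\<sigma> \<in> ?G" "a = restrict \<sigma> ?A" by blast
    have inj: "inj_on \<sigma> ?L" using D(1)[OF \<sigma>(1)] unfolding bij_betw_def by blast
    define \<rho> where "\<rho> = restrict (inv_into ?L \<sigma>) ?L"
    have \<rho>: "\<rho> \<in> ?G" unfolding \<rho>_def
    proof (rule restrict_galois_automorphism[OF f hom_on_inv_into[OF L D(2)[OF \<sigma>(1)] D(1)[OF \<sigma>(1)]]])
      fix b assume "b \<in> function_field w"
      then show "inv_into ?L \<sigma> b = b" using inv_into_f_f[OF inj, of b] D(3)[OF \<sigma>(1)] KL by auto
    qed
    have "inv\<^bsub>BijGroup ?A\<^esub> a = restrict \<rho> ?A"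
    proof (rule B.inv_equality)
      show "a \<in> carrier (BijGroup ?A)" "restrict \<rho> ?A \<in> carrier (BijGroup ?A)"
        using mem \<sigma> \<rho> unfolding BijGroup_def by auto
      have "compose ?A (restrict \<rho> ?A) a = (\<lambda>x\<in>?A. x)"
      proof
        fix x show "compose ?A (restrict \<rho> ?A) a x = (\<lambda>x\<in>?A. x) x"
        proof (cases "x \<in> ?A")
          case True
          then have "\<sigma> x \<in> ?A" using A[OF \<sigma>(1)] bij_betwE by blast
          then show ?thesis using True AL inv_into_f_f[OF inj, of x] by (auto simp: compose_def \<sigma>(2) \<rho>_def)
        qed (simp add: compose_def)
      qed
      then show "restrict \<rho> ?A \<otimes>\<^bsub>BijGroup ?A\<^esub> a = \<one>\<^bsub>BijGroup ?A\<^esub>"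
        using mem \<sigma> \<rho> unfolding BijGroup_def by simp
    qed
    then show "inv\<^bsub>BijGroup ?A\<^esub> a \<in> (\<lambda>\<sigma>. restrict \<sigma> ?A) ` ?G" using \<rho> by blast
    fix b assume "b \<in> (\<lambda>\<sigma>. restrict \<sigma> ?A) ` ?G"
    then obtain \<tau> where \<tau>: "\<tau> \<in> ?G" "b = restrict \<tau> ?A" by blast
    have c: "restrict (\<lambda>x. \<sigma> (\<tau> x)) ?L \<in> ?G"
    proof (rule restrict_galois_automorphism[OF f])
      show "hom_on ?L (\<lambda>x. \<sigma> (\<tau> x))"
        using D(2)[OF \<sigma>(1)] D(2)[OF \<tau>(1)] bij_betwE[OF D(1)[OF \<tau>(1)]] unfolding hom_on_def by simp
    qed (simp add: D(3)[OF \<sigma>(1)] D(3)[OF \<tau>(1)])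
    have "a \<otimes>\<^bsub>BijGroup ?A\<^esub> b = compose ?A a b" using mem \<sigma> \<tau> unfolding BijGroup_def by simp
    also have "\<dots> = restrict (restrict (\<lambda>x. \<sigma> (\<tau> x)) ?L) ?A"
      using AL bij_betwE[OF A[OF \<tau>(1)]] by (auto simp: fun_eq_iff compose_def \<sigma>(2) \<tau>(2))
    finally show "a \<otimes>\<^bsub>BijGroup ?A\<^esub> b \<in> (\<lambda>\<sigma>. restrict \<sigma> ?A) ` ?G" using c by blast
  qed
qed

text \<open>Two roots satisfy the same equations over the function field, so a homomorphism on a
  field containing all roots sends one to the other; its restriction to the splitting field is an
  automorphism.\<close>

lemma galois_group_transitive:
  fixes f :: "('v::{finite,linorder}, int) mpoly"
  assumes irr: "irreducible (rat_mpoly f)" and w: "w \<in> mvars f"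
  shows "transitive_action (galois_group w f) (root_set w f) (\<lambda>\<sigma>. \<sigma>)"
proof -
  let ?A = "root_set w f" and ?L = "splitting_carrier w f"
  have f: "f \<noteq> 0" using w by auto
  have sub: "subgroup (carrier (galois_group w f)) (BijGroup ?A)" by (rule galois_group_subgroup[OF f])
  have G: "group (galois_group w f)"
    using group.subgroup_imp_group[OF group_BijGroup sub] unfolding galois_group_def by simp
  have "group_hom (galois_group w f) (BijGroup ?A) (\<lambda>\<sigma>. \<sigma>)"
  proof (rule group_hom.intro[OF G group_BijGroup], rule group_hom_axioms.intro, rule homI)
    show "\<sigma> \<in> carrier (galois_group w f) \<Longrightarrow> \<sigma> \<in> carrier (BijGroup ?A)" for \<sigma>
      using subgroup.subset[OF sub] by blast
  qed (simp add: galois_group_def)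
  moreover have "\<exists>g\<in>carrier (galois_group w f). g x = y" if xy: "x \<in> ?A" "y \<in> ?A" for x y
  proof -
    have "\<exists>p. poly_over (function_field w) p \<and> p \<noteq> 0 \<and> poly p z = 0" if "z \<in> ?A" for z
      using that root_poly_over[of w f] root_poly_nonzero[OF f, of w] unfolding root_set_eq by blast
    moreover have "poly p x = 0 \<longleftrightarrow> poly p y = 0" if "poly_over (function_field w) p" for p
      using roots_conjugate[OF irr w xy that] roots_conjugate[OF irr w xy(2,1) that] by blast
    ultimately obtain M \<tau> where M: "is_subfield M" "function_field w \<union> ?A \<subseteq> M" "hom_on M \<tau>"
      "\<forall>a\<in>function_field w. \<tau> a = a" "\<tau> x = y"
      using ex_hom_moving_root[OF finite_root_set[OF f] _ function_field_subfield[of w] xy(1), of y] by blast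
    have LM: "?L \<subseteq> M" by (rule splitting_carrier_least[OF M(1,2)])
    have "hom_on ?L \<tau>" using M(3) LM unfolding hom_on_def by blast
    then have r: "restrict \<tau> ?L \<in> galois_automorphisms w f"
      by (rule restrict_galois_automorphism[OF f]) (use M(4) in blast)
    moreover have "restrict (restrict \<tau> ?L) ?A x = y"
      using xy(1) splitting_carrier_supset[of w f] M(5) by auto
    ultimately show ?thesis unfolding galois_group_sel by blast
  qed
  ultimately show ?thesis
    by (intro transitive_action.intro group_action.intro transitive_action_axioms.intro)
qed

lemma gamma_le_half:
  fixes f :: "('v::{finite,linorder}, int) mpoly"
  assumes irr: "irreducible (rat_mpoly f)" and w: "w \<in> mvars f"
  shows "gamma w f \<le> 1 / 2"
proof -
  let ?G = "galois_group w f" and ?A = "root_set w f"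
  let ?S = "{inverse (real (card (rcosets\<^bsub>?G\<^esub> K))) | K. intransitive_subgroup w f K}"
  have f: "f \<noteq> 0" using w by auto
  have trans: "transitive_action ?G ?A (\<lambda>\<sigma>. \<sigma>)" by (rule galois_group_transitive[OF assms])
  interpret T: transitive_action ?G ?A "\<lambda>\<sigma>. \<sigma>" by (rule trans)
  interpret H: group_hom ?G "BijGroup ?A" "\<lambda>\<sigma>. \<sigma>" by (rule T.group_hom)
  have "Bij ?A \<subseteq> ?A \<rightarrow>\<^sub>E ?A" unfolding Bij_def PiE_def using bij_betw_imp_funcset by auto
  then have "finite (Bij ?A)" using finite_PiE[OF finite_root_set[OF f] finite_root_set[OF f]] by (rule finite_subset)
  then have fin: "finite (carrier ?G)"
    using subgroup.subset[OF galois_group_subgroup[OF f, of w]] unfolding BijGroup_def by (auto intro: finite_subset)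
  have "?S \<subseteq> (\<lambda>K. inverse (real (card (rcosets\<^bsub>?G\<^esub> K)))) ` Pow (carrier ?G)"
    using subgroup.subset unfolding intransitive_subgroup_def by fastforce
  then have "finite ?S" by (rule finite_subset) (use fin in simp)
  moreover have "inverse (real (card (rcosets\<^bsub>?G\<^esub> K))) \<le> 1 / 2" if "intransitive_subgroup w f K" for K
  proof -
    have K: "subgroup K ?G" "\<not> transitive_action (?G\<lparr>carrier := K\<rparr>) ?A (\<lambda>\<sigma>. \<sigma>)"
      using that unfolding intransitive_subgroup_def by auto
    have Ks: "K \<subseteq> carrier ?G" by (rule subgroup.subset[OF K(1)])
    have "card (rcosets\<^bsub>?G\<^esub> K) \<noteq> 1"
    proof
      assume "card (rcosets\<^bsub>?G\<^esub> K) = 1"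
      then obtain S where S: "rcosets\<^bsub>?G\<^esub> K = {S}" by (auto simp: card_1_singleton_iff)
      have coset: "K #>\<^bsub>?G\<^esub> g = S" if "g \<in> carrier ?G" for g
        using H.G.rcosetsI[OF Ks that] S by blast
      have "K = S" using coset[OF H.G.one_closed] H.G.coset_mult_one[OF Ks] by simp
      then have "carrier ?G \<subseteq> K" using coset H.G.rcos_self[OF _ K(1)] by blast
      then have "K = carrier ?G" using Ks by blast
      then show False using K(2) trans by simp
    qed
    then have "card (rcosets\<^bsub>?G\<^esub> K) = 0 \<or> card (rcosets\<^bsub>?G\<^esub> K) \<ge> 2" by linarith
    then show ?thesis by (auto simp: field_simps)
  qed
  ultimately show ?thesis unfolding gamma_def by (subst Max_le_iff) auto
qed

section \<open>Counting reducible specializations\<close>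

text \<open>A constant leading coefficient forces constant leading coefficients on both factors. A
  factor of degree 0 in i would therefore be a unit, and evaluating the other variables by \<beta>
  preserves the degrees.\<close>

lemma split_of_reducible:
  fixes G :: "('v::{finite,linorder}, rat) mpoly"
  assumes red: "reducible G" and c: "Polynomial.lead_coeff (toP i G) = mconst c" "c \<noteq> 0"
    and \<beta>: "comm_ring_hom \<beta>" "\<And>a. \<beta> (mconst a) = (a :: rat)"
  shows "\<exists>D Q. map_poly \<beta> (toP i G) = D * Q \<and> 0 < degree D \<and> degree D < vdeg i G"
proof -
  interpret b: comm_ring_hom \<beta> by (rule \<beta>(1))
  interpret bp: comm_ring_hom "map_poly \<beta>" by (rule comm_ring_hom_map_poly[OF \<beta>(1)])
  obtain p q where pq: "G = p * q" "\<not> p dvd 1" "\<not> q dvd 1" using red unfolding reducible_def by blast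
  have "mconst c \<noteq> (0 :: ('v, rat) mpoly)" using c(2) by (metis lookup_single_eq lookup_zero)
  then have "G \<noteq> 0" using c(1) by auto
  then have nz: "p \<noteq> 0" "q \<noteq> 0" using pq(1) by auto
  have T: "toP i G = toP i p * toP i q" unfolding pq(1) by (rule toP.hom_mult)
  have lc: "Polynomial.lead_coeff (toP i p) * Polynomial.lead_coeff (toP i q) = mconst c"
    using c(1) unfolding T by (simp add: lead_coeff_mult)
  have ln: "Polynomial.lead_coeff (toP i p) \<noteq> 0" "Polynomial.lead_coeff (toP i q) \<noteq> 0" using nz by auto
  have "mvars (Polynomial.lead_coeff (toP i p)) \<union> mvars (Polynomial.lead_coeff (toP i q)) = {}"
    unfolding mvars_mult_eq[OF ln, symmetric] lc by simp
  then obtain a b where ab: "Polynomial.lead_coeff (toP i p) = mconst a" "Polynomial.lead_coeff (toP i q) = mconst b"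
    using mvars_empty_imp_mconst by blast
  have deg: "0 < vdeg i r" if r: "Polynomial.lead_coeff (toP i r) = mconst d" "r \<noteq> 0" "\<not> r dvd 1" for r :: "('v, rat) mpoly" and d
  proof (rule ccontr)
    assume "\<not> 0 < vdeg i r"
    then have 0: "degree (toP i r) = 0" unfolding vdeg_def by simp
    have "toP i r = [:Polynomial.lead_coeff (toP i r):]" unfolding 0 by (rule degree_0_id[OF 0, symmetric])
    then have "toP i r = toP i (mconst d)" unfolding r(1) by simp
    then have "r = mconst d" by (simp only: toP_inject)
    then have "mvars r = {}" by simp
    then show False using r(2,3) mpoly_dvd_one_iff[of r] by blast
  qed
  have dp: "degree (map_poly \<beta> (toP i p)) = vdeg i p"
  proof -
    have "a \<noteq> 0" using ab(1) ln(1) by auto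
    then show ?thesis unfolding vdeg_def by (intro map_poly_degree_eq) (simp only: ab(1) \<beta>(2) not_False_eq_True)
  qed
  have "vdeg i G = vdeg i p + vdeg i q" unfolding pq(1) by (rule vdeg_mult[OF nz])
  then have "vdeg i p < vdeg i G" using deg[OF ab(2) nz(2) pq(3)] by simp
  moreover have "map_poly \<beta> (toP i G) = map_poly \<beta> (toP i p) * map_poly \<beta> (toP i q)"
    unfolding T by (rule bp.hom_mult)
  ultimately show ?thesis using dp deg[OF ab(1) nz(1) pq(2)] by auto
qed

lemma specialize_eq_meval: "specialize f t = meval of_int (case_var mvar (\<lambda>j. of_int (t j))) f"
  unfolding specialize_def by (rule mpoly_eval_eq_meval)

lemma comm_ring_hom_specialize: "comm_ring_hom (\<lambda>f. specialize f t)"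
  unfolding specialize_eq_meval by (rule mpoly_hom_meval[OF comm_ring_hom_of_int])

interpretation of_int_meval: mpoly_hom "of_int :: int \<Rightarrow> 'b::comm_ring_1"
  by (intro mpoly_hom.intro comm_ring_hom_of_int)

lemma specialize_mconst: "specialize (mconst c) t = mconst (of_int c)"
  unfolding specialize_eq_meval by simp

lemma specialize_mvar: "specialize (mvar v) t = case_var mvar (\<lambda>j. mconst (of_int (t j))) v"
  unfolding specialize_eq_meval by (cases v) simp_all

lemma toP_specialize: "toP i (specialize f t) = map_poly (\<lambda>c. specialize c t) (toP (XVar i) f)"
proof -
  interpret s: comm_ring_hom "\<lambda>f. specialize f t" by (rule comm_ring_hom_specialize)
  show ?thesis
  proof (rule mpoly_hom_ext[where p = f])
    show "comm_ring_hom (\<lambda>f. toP i (specialize f t))"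
      by (rule comm_ring_hom_comp[OF comm_ring_hom_toP comm_ring_hom_specialize])
    show "comm_ring_hom (\<lambda>f. map_poly (\<lambda>c. specialize c t) (toP (XVar i) f))"
      by (rule comm_ring_hom_comp[OF comm_ring_hom_map_poly[OF comm_ring_hom_specialize] comm_ring_hom_toP])
    show "toP i (specialize (mconst c) t) = map_poly (\<lambda>c. specialize c t) (toP (XVar i) (mconst c))" for c
      by (simp only: specialize_mconst toP_mconst map_poly_const[of "\<lambda>c. specialize c t", OF s.hom_zero])
    show "toP i (specialize (mvar v) t) = map_poly (\<lambda>c. specialize c t) (toP (XVar i) (mvar v))" for v
      by (cases v) (simp_all only: specialize_mvar toP_mvar toP_mconst map_poly_const[of "\<lambda>c. specialize c t", OF s.hom_zero]
          map_poly_linear[of "\<lambda>c. specialize c t", OF s.hom_zero] s.hom_zero s.hom_one var.case var.inject var.distinct if_True if_False split: if_split,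
          simp_all)
  qed
qed

text \<open>Since h involves only the T_j, specializing them already turns it into a nonzero
  constant. Evaluation of the coefficients at u then factors through this specialization, and a
  factorization there is carried along.\<close>

lemma specialize_split:
  fixes f :: "(('r::{finite,linorder}, 's::{finite,linorder}) var, int) mpoly"
  assumes red: "reducible (specialize f (\<lambda>j. u (TVar j)))"
    and h: "mvars (Polynomial.lead_coeff (toP (XVar i) f)) \<subseteq> range TVar"
      "ev u (Polynomial.lead_coeff (toP (XVar i) f)) \<noteq> 0"
  shows "\<exists>D Q :: rat poly. map_poly of_int (evP u (toP (XVar i) f)) = D * Q \<and> 0 < degree D \<and> degree D < vdeg (XVar i) f"
proof -
  define t where "t = (\<lambda>j. u (TVar j) :: int)"
  let ?\<theta> = "\<lambda>c. specialize c t" and ?P = "toP (XVar i) f" and ?G = "specialize f t"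
  define \<beta> where "\<beta> = meval (\<lambda>c :: rat. c) (\<lambda>j. of_int (u (XVar j)))"
  have \<beta>: "comm_ring_hom \<beta>" unfolding \<beta>_def by (rule mpoly_hom_meval[OF comm_ring_hom_id])
  have \<beta>_mconst: "\<beta> (mconst a) = a" for a
    unfolding \<beta>_def by (simp add: mpoly_hom.meval_single[OF mpoly_hom.intro[OF comm_ring_hom_id]])
  have \<beta>_mvar: "\<beta> (mvar j) = of_int (u (XVar j))" for j
    unfolding \<beta>_def by (simp add: mpoly_hom.meval_mvar[OF mpoly_hom.intro[OF comm_ring_hom_id]])
  interpret s: comm_ring_hom ?\<theta> by (rule comm_ring_hom_specialize)
  interpret b: comm_ring_hom \<beta> by (rule \<beta>)
  let ?h = "Polynomial.lead_coeff ?P"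
  have "?\<theta> ?h = meval of_int (\<lambda>v. of_int (u v)) ?h"
    unfolding specialize_eq_meval by (rule meval_cong) (use h(1) in \<open>auto simp: t_def\<close>)
  also have "\<dots> = of_int (ev u ?h)" unfolding ev_def by (rule hom_meval[OF comm_ring_hom_of_int comm_ring_hom_id, symmetric])
  also have "\<dots> = mconst (of_int (ev u ?h))" by simp
  finally have \<theta>h: "?\<theta> ?h = mconst (of_int (ev u ?h))" .
  have TG: "toP i ?G = map_poly ?\<theta> ?P" by (rule toP_specialize)
  have "?\<theta> ?h \<noteq> 0" unfolding \<theta>h using h(2) by (metis lookup_single_eq lookup_zero of_int_eq_0_iff)
  then have deg: "degree (map_poly ?\<theta> ?P) = degree ?P" by (rule map_poly_degree_eq)
  have lc: "Polynomial.lead_coeff (toP i ?G) = mconst (of_int (ev u ?h))"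
    unfolding TG deg using \<theta>h by (simp add: coeff_map_poly del: single_of_int)
  have "\<beta> (?\<theta> p) = of_int (ev u p)" for p
  proof (rule mpoly_hom_ext[where p = p])
    show "comm_ring_hom (\<lambda>p. \<beta> (?\<theta> p))" by (rule comm_ring_hom_comp[OF \<beta> comm_ring_hom_specialize])
    show "comm_ring_hom (\<lambda>p. of_int (ev u p) :: rat)" by (rule comm_ring_hom_comp[OF comm_ring_hom_of_int comm_ring_hom_ev])
    show "\<beta> (?\<theta> (mconst c)) = of_int (ev u (mconst c))" for c by (simp only: specialize_mconst \<beta>_mconst ev_mconst)
    show "\<beta> (?\<theta> (mvar v)) = of_int (ev u (mvar v))" for v
      by (cases v) (simp_all only: specialize_mvar \<beta>_mconst \<beta>_mvar ev_mvar var.case t_def)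
  qed
  then have "map_poly \<beta> (toP i ?G) = map_poly of_int (evP u ?P)"
    unfolding TG by (intro poly_eqI) (simp add: coeff_map_poly)
  moreover have "vdeg i ?G = vdeg (XVar i) f" unfolding vdeg_def TG deg ..
  moreover have "\<exists>D Q. map_poly \<beta> (toP i ?G) = D * Q \<and> 0 < degree D \<and> degree D < vdeg i ?G"
    by (rule split_of_reducible[OF red[folded t_def] lc _ \<beta> \<beta>_mconst]) (use h(2) in simp)
  ultimately show ?thesis by simp
qed

section \<open>From integer points back to specializations\<close>

lemma card_ibox_ge:
  assumes "finite V"
  shows "N ^ card V \<le> card (ibox V N)"
proof -
  let ?E = "V \<rightarrow>\<^sub>E {1..int N}" and ?g = "\<lambda>x v. if v \<in> V then x v else (0 :: int)"
  have "inj_on ?g ?E"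
  proof (rule inj_onI)
    fix x y assume xy: "x \<in> ?E" "y \<in> ?E" "?g x = ?g y"
    show "x = y"
    proof (rule PiE_ext[OF xy(1,2)])
      fix v assume "v \<in> V"
      then show "x v = y v" using fun_cong[OF xy(3), of v] by simp
    qed
  qed
  moreover have "?g ` ?E \<subseteq> ibox V N" by (fastforce simp: ibox_def PiE_def Pi_def)
  ultimately have "card ?E \<le> card (ibox V N)" by (rule card_inj_on_le) (rule finite_ibox[OF assms])
  then show ?thesis by (simp add: card_PiE[OF assms])
qed

text \<open>Each t carries at least N^(r-1) points u, one for every value of the X_j with j \<noteq>
  i. Dividing by this number turns a bound in dimension r - 1 + s into one in dimension s with the
  same saving.\<close>

lemma card_fibres_le:
  fixes S :: "('s::finite \<Rightarrow> int) set" and i :: "'r::finite"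
  assumes "\<And>u. u \<in> ibox (- {XVar i}) N \<Longrightarrow> (\<lambda>j. u (TVar j)) \<in> S \<Longrightarrow> A u" "S \<subseteq> {t. \<forall>j. \<bar>t j\<bar> \<le> int N}"
  shows "card S * N ^ card (- {i}) \<le> card {u \<in> ibox (- {XVar i}) N. A u}"
proof -
  let ?B = "ibox (- {i}) N" and ?g = "\<lambda>(t, x). case_var x t"
  have "inj_on ?g (S \<times> ?B)"
  proof (rule inj_onI)
    fix p q :: "('s \<Rightarrow> int) \<times> ('r \<Rightarrow> int)"
    assume "?g p = ?g q"
    then have "?g p (XVar j) = ?g q (XVar j)" "?g p (TVar k) = ?g q (TVar k)" for j k by simp_all
    then have "snd p = snd q" "fst p = fst q" by (auto simp: fun_eq_iff split_beta)
    then show "p = q" by (simp add: prod_eq_iff)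
  qed
  moreover have "?g ` (S \<times> ?B) \<subseteq> {u \<in> ibox (- {XVar i}) N. A u}"
  proof
    fix u assume "u \<in> ?g ` (S \<times> ?B)"
    then obtain t x where u: "u = case_var x t" "t \<in> S" "x \<in> ?B" by auto
    have "\<bar>u v\<bar> \<le> int N" for v using u assms(2) by (cases v) (auto simp: ibox_def)
    moreover have "u (XVar i) = 0" using u(1,3) unfolding ibox_def by simp
    ultimately have b: "u \<in> ibox (- {XVar i}) N" unfolding ibox_def by simp
    have "(\<lambda>j. u (TVar j)) = t" unfolding u(1) by simp
    then show "u \<in> {u \<in> ibox (- {XVar i}) N. A u}" using b assms(1)[OF b] u(2) by simp
  qed
  ultimately have "card (S \<times> ?B) \<le> card {u \<in> ibox (- {XVar i}) N. A u}"
    by (rule card_inj_on_le) (simp add: finite_ibox)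
  moreover have "card S * N ^ card (- {i}) \<le> card S * card ?B" by (intro mult_le_mono2 card_ibox_ge) simp
  ultimately show ?thesis unfolding card_cartesian_product by (rule le_trans[rotated])
qed

lemma card_Compl_XVar:
  "card (- {XVar i :: ('r::finite, 's::finite) var}) = card (- {i}) + CARD('s)"
proof -
  have "- {XVar i :: ('r, 's) var} = XVar ` (- {i}) \<union> range TVar"
  proof (rule Set.set_eqI)
    fix v :: "('r, 's) var"
    show "v \<in> - {XVar i} \<longleftrightarrow> v \<in> XVar ` (- {i}) \<union> range TVar" by (cases v) auto
  qed
  also have "card \<dots> = card (XVar ` (- {i}) :: ('r, 's) var set) + card (range TVar :: ('r, 's) var set)"
    by (rule card_Un_disjoint) auto
  also have "card (XVar ` (- {i}) :: ('r, 's) var set) = card (- {i})" by (rule card_image) (auto intro: inj_onI)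
  also have "card (range TVar :: ('r, 's) var set) = CARD('s)" by (rule card_image) (auto intro: inj_onI)
  finally show ?thesis .
qed

lemma reducible_specialization_count:
  fixes f :: "(('r::{finite,linorder}, 's::{finite,linorder}) var, int) mpoly"
  assumes \<epsilon>: "\<epsilon> > 0" and irr: "irreducible (rat_mpoly f)"
    and h: "mvars (Polynomial.lead_coeff (toP (XVar i) f)) \<subseteq> range TVar"
  shows "\<exists>C\<ge>0. \<forall>N\<ge>1. real (card {t. (\<forall>j. \<bar>t j\<bar> \<le> int N) \<and> reducible (specialize f t)})
     \<le> C * real N powr (real CARD('s) - 1/2 + \<epsilon>)"
proof -
  let ?w = "XVar i :: ('r, 's) var" and ?e = "real CARD('s) - 1/2 + \<epsilon>"
  let ?h = "Polynomial.lead_coeff (toP ?w f)"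
  define A where "A u \<longleftrightarrow> ev u ?h = 0 \<or> (ev u ?h \<noteq> 0 \<and>
     (\<exists>D Q :: rat poly. map_poly of_int (evP u (toP ?w f)) = D * Q \<and> 0 < degree D \<and> degree D < vdeg ?w f))" for u
  have "f \<noteq> 0" using irr by auto
  then have "?h \<noteq> 0" by simp
  moreover have "mvars ?h \<subseteq> - {?w}" using h by auto
  ultimately have "thin (- {?w}) \<epsilon> (\<lambda>u. ev u ?h = 0)" by (intro thin_zeros \<epsilon>) simp_all
  then have "thin (- {?w}) \<epsilon> A" unfolding A_def by (rule thin_disj[OF _ split_thin[OF irr \<epsilon>]]) simp
  then obtain C where C: "C \<ge> 0" "\<And>N. N \<ge> 1 \<Longrightarrow> real (card {u \<in> ibox (- {?w}) N. A u}) \<le> C * real N powr (real (card (- {?w})) - 1/2 + \<epsilon>)"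
    unfolding thin_def by blast
  have "real (card {t. (\<forall>j. \<bar>t j\<bar> \<le> int N) \<and> reducible (specialize f t)}) \<le> C * real N powr ?e" if N: "N \<ge> 1" for N
  proof -
    let ?S = "{t. (\<forall>j. \<bar>t j\<bar> \<le> int N) \<and> reducible (specialize f t)}"
    have "card ?S * N ^ card (- {i}) \<le> card {u \<in> ibox (- {?w}) N. A u}"
    proof (rule card_fibres_le)
      fix u :: "('r, 's) var \<Rightarrow> int" assume "(\<lambda>j. u (TVar j)) \<in> ?S"
      then have r: "reducible (specialize f (\<lambda>j. u (TVar j)))" by simp
      show "A u" unfolding A_def using specialize_split[OF r h] by blast
    qed auto
    then have "real (card ?S * N ^ card (- {i})) \<le> real (card {u \<in> ibox (- {?w}) N. A u})" by (simp only: of_nat_le_iff)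
    also have "\<dots> \<le> C * real N powr (real (card (- {?w})) - 1/2 + \<epsilon>)" by (rule C(2)[OF N])
    also have "real N powr (real (card (- {?w})) - 1/2 + \<epsilon>) = real N powr ?e * real N powr real (card (- {i}))"
      unfolding card_Compl_XVar powr_add[symmetric] by (simp add: algebra_simps)
    also have "real N powr real (card (- {i})) = real (N ^ card (- {i}))" using N by (simp add: powr_realpow)
    finally have "real (card ?S) * real (N ^ card (- {i})) \<le> (C * real N powr ?e) * real (N ^ card (- {i}))" by simp
    moreover have "real (N ^ card (- {i})) > 0" using N by simp
    ultimately show ?thesis by (rule mult_right_le_imp_le)
  qed
  then show ?thesis using C(1) by blast
qed

theorem theorem1p4:
  fixes f :: "(('r::{finite,linorder}, 's::{finite,linorder}) var, int) mpoly"
    and i :: 'r and n :: nat and \<epsilon> :: real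
  assumes "\<epsilon> > 0"
    and "Factorial_Ring.irreducible (rat_mpoly f)"
    and "n \<ge> 1"
    and "Polynomial.degree (poly_in (XVar i) f) = n"
    and "mvars (Polynomial.lead_coeff (poly_in (XVar i) f)) \<subseteq> Set.range TVar"
  shows "\<exists>C. \<forall>H\<ge>1. real (J f H) \<le> C * H powr (real CARD('s) - gamma (XVar i) f + \<epsilon>)"
proof -
  let ?w = "XVar i :: ('r, 's) var" and ?e = "real CARD('s) - 1/2 + \<epsilon>"
  obtain C where C: "C \<ge> 0" "\<And>N. N \<ge> 1 \<Longrightarrow>
      real (card {t. (\<forall>j. \<bar>t j\<bar> \<le> int N) \<and> reducible (specialize f t)}) \<le> C * real N powr ?e"
    using reducible_specialization_count[OF assms(1,2) assms(5)[unfolded poly_in_eq_toP]] by blast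
  have "?w \<in> mvars f" using assms(3,4) vdeg_eq_0_iff[of ?w f] unfolding poly_in_eq_toP vdeg_def by auto
  then have \<gamma>: "gamma ?w f \<le> 1/2" by (rule gamma_le_half[OF assms(2)])
  have "real (J f H) \<le> C * H powr (real CARD('s) - gamma ?w f + \<epsilon>)" if H: "H \<ge> 1" for H
  proof -
    \<comment> \<open>The coordinates of t are integers, so passing from H to its integer part loses
      no point.\<close>
    define N where "N = nat \<lfloor>H\<rfloor>"
    have N: "N \<ge> 1" "real N \<le> H" "int N = \<lfloor>H\<rfloor>" unfolding N_def using H by linarith+
    let ?S = "{t. (\<forall>j. \<bar>t j\<bar> \<le> int N) \<and> reducible (specialize f t)}"
    have "?S \<subseteq> ibox UNIV N" unfolding ibox_def by auto
    then have "finite ?S" by (rule finite_subset[OF _ finite_ibox[OF finite]])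
    moreover have "{t. real_of_int (MAX j. \<bar>t j\<bar>) \<le> H \<and> reducible (specialize f t)} \<subseteq> ?S"
    proof safe
      fix t :: "'s \<Rightarrow> int" and j assume "real_of_int (MAX j. \<bar>t j\<bar>) \<le> H"
      then have "(MAX j. \<bar>t j\<bar>) \<le> int N" unfolding N(3) by (simp add: le_floor_iff)
      moreover have "\<bar>t j\<bar> \<le> (MAX j. \<bar>t j\<bar>)" by (rule Max_ge) auto
      ultimately show "\<bar>t j\<bar> \<le> int N" by linarith
    qed
    ultimately have "real (J f H) \<le> real (card ?S)" unfolding J_def by (intro of_nat_mono card_mono)
    also have "\<dots> \<le> C * real N powr ?e" by (rule C(2)[OF N(1)])
    \<comment> \<open>Returning from N to H requires a nonnegative exponent, which holds because
      there is at least one T_j.\<close>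
    also have "\<dots> \<le> C * H powr ?e"
    proof (intro mult_left_mono powr_mono2 C(1))
      have "CARD('s) \<ge> 1" by (simp add: Suc_le_eq)
      then show "0 \<le> ?e" using assms(1) by linarith
    qed (use N in auto)
    also have "\<dots> \<le> C * H powr (real CARD('s) - gamma ?w f + \<epsilon>)"
      using \<gamma> H by (intro mult_left_mono powr_mono C(1)) auto
    finally show ?thesis .
  qed
  then show ?thesis by blast
qed

end
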